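(* Let $s\ge\frac12$ (respectively $s>\frac12$) be a real number. Then the following is true: (1) If $T$ is a linear and continuous map from $\mathcal A_s'(\mathbf C^d)$ to $\mathcal A_s(\mathbf C^d)$ (respectively from $\mathcal A_{0,s}'(\mathbf C^d)$ to $\mathcal A_{0,s}(\mathbf C^d)$), then there is a unique $a\in\widetilde A(\mathbf C^d\times\mathbf C^d)$ such that $$|a(z,w)|\lesssim e^{\frac12|z-w|^2-r(|z|^{1/s}+|w|^{1/s})},\qquad z,w\in\mathbf C^d,$$ for some (respectively for every) $r>0$, and $T=\operatorname{Op}_{\mathfrak V}(a)$. (2) If $T$ is a linear and continuous map from $\mathcal A_s(\mathbf C^d)$ to $\mathcal A_s'(\mathbf C^d)$ (respectively from $\mathcal A_{0,s}(\mathbf C^d)$ to $\mathcal A_{0,s}'(\mathbf C^d)$), then there is a unique $a\in\widetilde A(\mathbf C^d\times\mathbf C^d)$ such that $$|a(z,w)|\lesssim e^{\frac12|z-w|^2+r(|z|^{1/s}+|w|^{1/s})},\qquad z,w\in\mathbf C^d,$$ for every (respectively for some) $r>0$, and $T=\operatorname{Op}_{\mathfrak V}(a)$.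
   Context: $f\lesssim g$ means $f\le Cg$ for some constant $C>0$ (which may depend on $r$). For real $s>0$, $r>0$ and $\alpha\in\mathbf N^d$ let $\vartheta_{r,s}(\alpha)=e^{r|\alpha|^{1/(2s)}}$, and let $\ell^p_{[\vartheta]}(\mathbf N^d)$ be the Banach space of complex sequences $c$ with $\|c\,\vartheta\|_{\ell^p}<\infty$; fix any $p\in[1,\infty]$ (the spaces below do not depend on it). With $e_\alpha(z)=z^\alpha/\sqrt{\alpha!}$, the spaces $\mathcal A_{0,s}(\mathbf C^d)$, $\mathcal A_s(\mathbf C^d)$, $\mathcal A_s'(\mathbf C^d)$, $\mathcal A_{0,s}'(\mathbf C^d)$ consist of all power series $F=\sum_\alpha c(F,\alpha)e_\alpha$ whose coefficient sequences belong respectively to $\bigcap_{r>0}\ell^p_{[\vartheta_{r,s}]}$ (projective limit topology), $\bigcup_{r>0}\ell^p_{[\vartheta_{r,s}]}$ (inductive limit topology), $\bigcap_{r>0}\ell^p_{[1/\vartheta_{r,s}]}$ (projective limit topology), $\bigcup_{r>0}\ell^p_{[1/\vartheta_{r,s}]}$ (inductive limit topology); the topologies are transported from the sequence spaces. $\widetilde A(\mathbf C^d\times\mathbf C^d)$ is the set of all functions $a$ such that $(z,w)\mapsto a(z,\overline w)$ is entire on $\mathbf C^{2d}$. $\operatorname{Op}_{\mathfrak V}(a)$ is the analytic pseudo-differential operator $(\operatorname{Op}_{\mathfrak V}(a)F)(z)=\int_{\mathbf C^d}a(z,w)F(w)e^{(z,w)}\,d\mu(w)$, where $(z,w)=\sum_jz_j\overline{w_j}$,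 $d\mu(w)=\pi^{-d}e^{-|w|^2}d\lambda(w)$ and $d\lambda$ is Lebesgue measure; it is interpreted by duality when needed: writing $K(z,w)=e^{(z,w)}a(z,w)=\sum_{\alpha,\beta}c_K(\alpha,\beta)e_\alpha(z)e_\beta(\overline w)$, one has $\operatorname{Op}_{\mathfrak V}(a)F=\sum_\alpha\big(\sum_\beta c_K(\alpha,\beta)c(F,\beta)\big)e_\alpha$. *)

theory Defs
  imports "HOL-Analysis.Analysis"
begin

section \<open>Power series in the basis \<open>e\<^sub>\<alpha>(z) = z\<^sup>\<alpha> / sqrt \<alpha>!\<close>\<close>

text \<open>
  A formal power series \<open>F = (\<Sum>\<alpha>. c(F,\<alpha>) e\<^sub>\<alpha>)\<close> on \<open>complex ^ 'd\<close> is represented by its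
  coefficient family \<open>c(F,\<cdot>)\<close>. All spaces below carry the topology of the coefficient spaces.
\<close>

type_synonym 'd pseries = "nat ^ 'd \<Rightarrow> complex"

definition mi_abs :: "nat ^ 'd::finite \<Rightarrow> nat" where
  "mi_abs \<alpha> = (\<Sum>i\<in>UNIV. \<alpha> $ i)"

definition mi_fact :: "nat ^ 'd::finite \<Rightarrow> nat" where
  "mi_fact \<alpha> = (\<Prod>i\<in>UNIV. fact (\<alpha> $ i))"

definition e_mono :: "nat ^ 'd::finite \<Rightarrow> complex ^ 'd \<Rightarrow> complex" where
  "e_mono \<alpha> z = (\<Prod>i\<in>UNIV. z $ i ^ (\<alpha> $ i)) / complex_of_real (sqrt (real (mi_fact \<alpha>)))"

definition ps_eval :: "'d::finite pseries \<Rightarrow> complex ^ 'd \<Rightarrow> complex" where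
  "ps_eval F z = (\<Sum>\<^sub>\<infinity>\<alpha>. F \<alpha> * e_mono \<alpha> z)"

section \<open>Weighted sequence spaces\<close>

definition in_lp :: "ennreal \<Rightarrow> ('i \<Rightarrow> complex) \<Rightarrow> bool" where
  "in_lp p c \<longleftrightarrow>
     (if p = \<infinity> then bdd_above (range (\<lambda>i. cmod (c i)))
      else (\<lambda>i. cmod (c i) powr enn2real p) summable_on UNIV)"

text \<open>
  The supremum is taken in \<^typ>\<open>ennreal\<close>, so that the value is nonnegative (namely \<open>0\<close>) also for
  unbounded families; this makes the distance below nonnegative everywhere, as
  \<^locale>\<open>Metric_space\<close> requires.
\<close>

definition lp_norm :: "ennreal \<Rightarrow> ('i \<Rightarrow> complex) \<Rightarrow> real" where
  "lp_norm p c =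
     (if p = \<infinity> then enn2real (SUP i. ennreal (cmod (c i)))
      else (\<Sum>\<^sub>\<infinity>i. cmod (c i) powr enn2real p) powr (1 / enn2real p))"

definition weighted_lp :: "ennreal \<Rightarrow> ('i \<Rightarrow> real) \<Rightarrow> ('i \<Rightarrow> complex) topology" where
  "weighted_lp p \<theta> =
     Metric_space.mtopology {c. in_lp p (\<lambda>i. c i * of_real (\<theta> i))}
       (\<lambda>c c'. lp_norm p (\<lambda>i. (c i - c' i) * of_real (\<theta> i)))"

definition vartheta :: "real \<Rightarrow> real \<Rightarrow> nat ^ 'd::finite \<Rightarrow> real" where
  "vartheta r s \<alpha> = exp (r * real (mi_abs \<alpha>) powr (1 / (2 * s)))"

section \<open>Projective and inductive limits\<close>

text \<open>
  Limits of a monotone family \<open>E r\<close>, \<open>r > 0\<close>, of topological vector spaces of complex families.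
  The projective limit is the coarsest topology on the intersection making all inclusions into
  \<open>E r\<close> continuous.
\<close>

definition proj_lim :: "(real \<Rightarrow> ('i \<Rightarrow> complex) topology) \<Rightarrow> ('i \<Rightarrow> complex) topology" where
  "proj_lim E =
     topology_generated_by
       {U \<inter> (\<Inter>r\<in>{0<..}. topspace (E r)) | U r. 0 < r \<and> openin (E r) U}"

definition abs_convex :: "('i \<Rightarrow> complex) set \<Rightarrow> bool" where
  "abs_convex V \<longleftrightarrow>
     (\<forall>x\<in>V. \<forall>y\<in>V. \<forall>a b. cmod a + cmod b \<le> 1 \<longrightarrow> (\<lambda>i. a * x i + b * y i) \<in> V)"

text \<open>
  The inductive limit is the locally convex one: the finest locally convex topology on the union
  making all inclusions from \<open>E r\<close> continuous. A base of neighbourhoods of \<open>0\<close> is formed by the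
  absolutely convex sets that meet every \<open>E r\<close> in a neighbourhood of \<open>0\<close> in \<open>E r\<close>.
\<close>

definition ind_lim_nhd :: "(real \<Rightarrow> ('i \<Rightarrow> complex) topology) \<Rightarrow> ('i \<Rightarrow> complex) set \<Rightarrow> bool" where
  "ind_lim_nhd E V \<longleftrightarrow>
     abs_convex V \<and> (\<forall>r>0. \<exists>W. openin (E r) W \<and> (\<lambda>i. 0) \<in> W \<and> W \<subseteq> V)"

definition ind_lim :: "(real \<Rightarrow> ('i \<Rightarrow> complex) topology) \<Rightarrow> ('i \<Rightarrow> complex) topology" where
  "ind_lim E =
     topology (\<lambda>U. U \<subseteq> (\<Union>r\<in>{0<..}. topspace (E r)) \<and>
       (\<forall>x\<in>U. \<exists>V. ind_lim_nhd E V \<and> (\<lambda>v i. x i + v i) ` V \<subseteq> U))"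

lemma ind_lim_nhd_Int:
  assumes "ind_lim_nhd E V" "ind_lim_nhd E V'"
  shows "ind_lim_nhd E (V \<inter> V')"
  unfolding ind_lim_nhd_def
proof (intro conjI allI impI)
  show "abs_convex (V \<inter> V')"
    using assms unfolding ind_lim_nhd_def abs_convex_def by blast
next
  fix r :: real
  assume "0 < r"
  then obtain W W' where "openin (E r) W" "(\<lambda>i. 0) \<in> W" "W \<subseteq> V"
    "openin (E r) W'" "(\<lambda>i. 0) \<in> W'" "W' \<subseteq> V'"
    using assms unfolding ind_lim_nhd_def by metis
  then show "\<exists>W. openin (E r) W \<and> (\<lambda>i. 0) \<in> W \<and> W \<subseteq> V \<inter> V'"
    by (intro exI[of _ "W \<inter> W'"]) auto
qed

lemma openin_ind_lim:
  "openin (ind_lim E) U \<longleftrightarrow>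
     U \<subseteq> (\<Union>r\<in>{0<..}. topspace (E r)) \<and>
     (\<forall>x\<in>U. \<exists>V. ind_lim_nhd E V \<and> (\<lambda>v i. x i + v i) ` V \<subseteq> U)"
proof -
  define X where "X = (\<Union>r\<in>{0<..}. topspace (E r))"
  define N where "N x U \<longleftrightarrow> (\<exists>V. ind_lim_nhd E V \<and> (\<lambda>v i. x i + v i) ` V \<subseteq> U)" for x U
  have Int: "N x (S \<inter> T)" if S: "N x S" and T: "N x T" for x S T
  proof -
    obtain V V' where V: "ind_lim_nhd E V" "(\<lambda>v i. x i + v i) ` V \<subseteq> S"
      and V': "ind_lim_nhd E V'" "(\<lambda>v i. x i + v i) ` V' \<subseteq> T"
      using S T unfolding N_def by blast
    have "(\<lambda>v i. x i + v i) ` (V \<inter> V') \<subseteq> S \<inter> T"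
      using V(2) V'(2) by blast
    then show ?thesis
      unfolding N_def using ind_lim_nhd_Int[OF V(1) V'(1)] by blast
  qed
  have mono: "N x T" if "N x S" "S \<subseteq> T" for x S T
    using that unfolding N_def by blast
  have "istopology (\<lambda>U. U \<subseteq> X \<and> (\<forall>x\<in>U. N x U))"
    unfolding istopology_def
  proof (intro conjI allI impI)
    fix S T
    assume S: "S \<subseteq> X \<and> (\<forall>x\<in>S. N x S)" and T: "T \<subseteq> X \<and> (\<forall>x\<in>T. N x T)"
    show "S \<inter> T \<subseteq> X" using S by blast
    show "\<forall>x\<in>S \<inter> T. N x (S \<inter> T)" using S T by (auto intro: Int)
  next
    fix K
    assume K: "\<forall>S\<in>K. S \<subseteq> X \<and> (\<forall>x\<in>S. N x S)"
    show "\<Union>K \<subseteq> X" using K by blast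
    show "\<forall>x\<in>\<Union>K. N x (\<Union>K)"
    proof
      fix x assume "x \<in> \<Union>K"
      then obtain S where "S \<in> K" "x \<in> S" by blast
      then show "N x (\<Union>K)" using K mono[of x S "\<Union>K"] by blast
    qed
  qed
  then show ?thesis
    unfolding ind_lim_def X_def N_def by (rule fun_cong[OF topology_inverse'])
qed

section \<open>The spaces of power series\<close>

definition A0_space :: "ennreal \<Rightarrow> real \<Rightarrow> ('d::finite pseries) topology" where
  "A0_space p s = proj_lim (\<lambda>r. weighted_lp p (vartheta r s))"

definition A_space :: "ennreal \<Rightarrow> real \<Rightarrow> ('d::finite pseries) topology" where
  "A_space p s = ind_lim (\<lambda>r. weighted_lp p (vartheta r s))"

definition A_dual :: "ennreal \<Rightarrow> real \<Rightarrow> ('d::finite pseries) topology" where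
  "A_dual p s = proj_lim (\<lambda>r. weighted_lp p (\<lambda>\<alpha>. 1 / vartheta r s \<alpha>))"

definition A0_dual :: "ennreal \<Rightarrow> real \<Rightarrow> ('d::finite pseries) topology" where
  "A0_dual p s = ind_lim (\<lambda>r. weighted_lp p (\<lambda>\<alpha>. 1 / vartheta r s \<alpha>))"

definition linear_continuous ::
    "('i \<Rightarrow> complex) topology \<Rightarrow> ('j \<Rightarrow> complex) topology \<Rightarrow> (('i \<Rightarrow> complex) \<Rightarrow> ('j \<Rightarrow> complex)) \<Rightarrow> bool" where
  "linear_continuous X Y T \<longleftrightarrow>
     continuous_map X Y T \<and>
     (\<forall>F\<in>topspace X. \<forall>G\<in>topspace X. T (\<lambda>i. F i + G i) = (\<lambda>j. T F j + T G j)) \<and>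
     (\<forall>k. \<forall>F\<in>topspace X. T (\<lambda>i. k * F i) = (\<lambda>j. k * T F j))"

section \<open>Analytic pseudo-differential operators\<close>

text \<open>Entire means complex Frechet differentiable at every point of \<open>C\<^sup>2\<^sup>d\<close>.\<close>

definition entire2 :: "((complex ^ 'd::finite) \<times> (complex ^ 'd) \<Rightarrow> complex) \<Rightarrow> bool" where
  "entire2 f \<longleftrightarrow>
     (\<forall>x. \<exists>D. (f has_derivative D) (at x) \<and>
        (\<forall>k u v. D (k *s u, k *s v) = k * D (u, v)))"

definition cnj_vec :: "complex ^ 'd::finite \<Rightarrow> complex ^ 'd" where
  "cnj_vec w = (\<chi> i. cnj (w $ i))"

definition A_tilde :: "(complex ^ 'd::finite \<Rightarrow> complex ^ 'd \<Rightarrow> complex) set" where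
  "A_tilde = {a. entire2 (\<lambda>(z, w). a z (cnj_vec w))}"

definition herm :: "complex ^ 'd::finite \<Rightarrow> complex ^ 'd \<Rightarrow> complex" where
  "herm z w = (\<Sum>j\<in>UNIV. z $ j * cnj (w $ j))"

definition gauss :: "(complex ^ 'd::finite) measure" where
  "gauss = density lborel (\<lambda>w. ennreal (exp (- (norm w)\<^sup>2) / pi ^ CARD('d)))"

text \<open>The coefficients of \<open>K(z,w) = exp (z,w) a(z,w) = (\<Sum>\<alpha> \<beta>. c\<^sub>K(\<alpha>,\<beta>) e\<^sub>\<alpha>(z) e\<^sub>\<beta>(cnj w))\<close>.\<close>

definition ker_coeff ::
    "(complex ^ 'd::finite \<Rightarrow> complex ^ 'd \<Rightarrow> complex) \<Rightarrow> nat ^ 'd \<Rightarrow> nat ^ 'd \<Rightarrow> complex" where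
  "ker_coeff a =
     (THE c. \<forall>z w. ((\<lambda>(\<alpha>, \<beta>). c \<alpha> \<beta> * e_mono \<alpha> z * e_mono \<beta> (cnj_vec w))
        has_sum exp (herm z w) * a z w) UNIV)"

text \<open>
  The operator is given by the integral; only if the integrand fails to be integrable for some
  \<open>z\<close> it is interpreted by duality, through the coefficients of the kernel.
\<close>

definition Op_V ::
    "(complex ^ 'd::finite \<Rightarrow> complex ^ 'd \<Rightarrow> complex) \<Rightarrow> 'd pseries \<Rightarrow> complex ^ 'd \<Rightarrow> complex" where
  "Op_V a F z =
     (if \<forall>z'. integrable gauss (\<lambda>w. a z' w * ps_eval F w * exp (herm z' w))
      then (LINT w|gauss. a z w * ps_eval F w * exp (herm z w))
      else ps_eval (\<lambda>\<alpha>. \<Sum>\<^sub>\<infinity>\<beta>. ker_coeff a \<alpha> \<beta> * F \<beta>) z)"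

definition represents ::
    "(complex ^ 'd::finite \<Rightarrow> complex ^ 'd \<Rightarrow> complex) \<Rightarrow> 'd pseries topology \<Rightarrow>
     ('d pseries \<Rightarrow> 'd pseries) \<Rightarrow> bool" where
  "represents a X T \<longleftrightarrow> (\<forall>F\<in>topspace X. \<forall>z. ps_eval (T F) z = Op_V a F z)"

end

theory Submission
  imports Defs "HOL-Probability.Probability" "HOL-Complex_Analysis.Complex_Analysis"
    "HOL-Real_Asymp.Real_Asymp"
begin

text \<open>
  Let \<open>c(\<alpha>,\<beta>)\<close> be the \<open>\<alpha>\<close>-th coefficient of \<open>T e\<^sub>\<beta>\<close>. Testing continuity of \<open>T\<close> against weighted
  seminorms shows that \<open>|c(\<alpha>,\<beta>)|\<close> is bounded by a multiple of
  \<open>exp (\<plusminus> r (|\<alpha>|\<^sup>\<sigma> + |\<beta>|\<^sup>\<sigma>))\<close>, \<open>\<sigma> = 1/(2s)\<close>, with the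
  quantifier on \<open>r\<close> dictated by the spaces (nuclearity enters only through the summability of
  quotients of weights). Cauchy-Schwarz and \<open>(\<Sum>\<alpha>. q ^ |\<alpha>| |e\<^sub>\<alpha>(z)|\<^sup>2) = exp (q |z|\<^sup>2)\<close> turn such
  coefficient bounds into the pointwise bounds for \<open>K = (\<Sum>\<alpha> \<beta>. c(\<alpha>,\<beta>) e\<^sub>\<alpha>(z) e\<^sub>\<beta>(cnj w))\<close> and
  hence for \<open>a = exp (- (z,w)) K\<close>. The same bounds make the defining integral of the operator absolutely
  convergent on the whole domain of \<open>T\<close>, so it is evaluated termwise by orthonormality of the \<open>e\<^sub>\<alpha>\<close>.
  Uniqueness follows from the reproducing formula \<open>h(v) = (\<integral> h(w) exp (v,w) d\<mu>(w))\<close>, which is the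
  mean value property for the rotation invariant measure \<open>\<mu>\<close> and also yields the orthonormality.
\<close>

section \<open>Weighted sequence spaces\<close>

text \<open>Continuity into an inductive limit does not by itself single out one step of the union,
  so a common exponent for all kernel entries has to be forced by a diagonal argument. In the other
  direction each exponent comes from one seminorm. The delicate point is the integral. Kernel and
  \<open>F\<close> each contribute exp(|w|^2/2), which together use up the Gaussian density, so
  convergence rests on a strictly negative total coefficient of |w|^(1/s). This can always be
  arranged because one of the two coefficients is still free once the other is fixed. As the
  integral then exists for every z, \<open>Op_V\<close> takes its integral branch and
  \<open>ker_coeff\<close> never has to be evaluated. Uniqueness tests T on the e_\<beta> alone.
  There the cruder bound exp(3/4 |w|^2) for a(z,w) exp (z,w) is enough, 3/4 lying between the
  natural rate 1/2 and the limit of integrability 1. The condition s \<ge> 1/2 means \<sigma> \<le>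
  1, so weights grow at most geometrically in |\<alpha>|. With s > 1/2, |z|^(1/s) is negligible
  against |z|^2, which is what allows exponents to be prescribed arbitrarily in the second pair of
  spaces.\<close>

lemma in_lp_mono:
  assumes "in_lp p c" "\<And>i. cmod (c' i) \<le> K * cmod (c i)"
  shows "in_lp p c'"
proof (cases "p = \<infinity>")
  case True
  then obtain B where B: "\<And>i. cmod (c i) \<le> B"
    using assms(1) by (auto simp: in_lp_def bdd_above_def)
  have "cmod (c' i) \<le> \<bar>K\<bar> * B" for i
  proof -
    have "cmod (c' i) \<le> \<bar>K\<bar> * cmod (c i)"
      using assms(2)[of i] by (smt (verit) mult_right_mono norm_ge_zero)
    also have "\<dots> \<le> \<bar>K\<bar> * B" by (intro mult_left_mono B) auto
    finally show ?thesis .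
  qed
  then show ?thesis using True by (auto simp: in_lp_def bdd_above_def)
next
  case False
  then have "(\<lambda>i. cmod (c i) powr enn2real p) summable_on UNIV"
    using assms(1) by (simp add: in_lp_def)
  then have s: "(\<lambda>i. \<bar>K\<bar> powr enn2real p * cmod (c i) powr enn2real p) summable_on UNIV"
    by (rule summable_on_cmult_right)
  have "(\<lambda>i. cmod (c' i) powr enn2real p) summable_on UNIV"
  proof (rule summable_on_comparison_test[OF s])
    fix i
    have "cmod (c' i) \<le> \<bar>K\<bar> * cmod (c i)"
      using assms(2)[of i] by (smt (verit) mult_right_mono norm_ge_zero)
    then have "cmod (c' i) powr enn2real p \<le> (\<bar>K\<bar> * cmod (c i)) powr enn2real p"
      by (intro powr_mono2) auto
    then show "cmod (c' i) powr enn2real p \<le> \<bar>K\<bar> powr enn2real p * cmod (c i) powr enn2real p"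
      by (simp add: powr_mult)
  qed auto
  then show ?thesis using False by (simp add: in_lp_def)
qed

lemma in_lp_add:
  assumes "in_lp p c" "in_lp p c'"
  shows "in_lp p (\<lambda>i. c i + c' i)"
proof (cases "p = \<infinity>")
  case True
  then obtain B B' where B: "\<And>i. cmod (c i) \<le> B" "\<And>i. cmod (c' i) \<le> B'"
    using assms by (auto simp: in_lp_def bdd_above_def)
  have "cmod (c i + c' i) \<le> B + B'" for i
    by (intro norm_triangle_mono B)
  then show ?thesis using True by (auto simp: in_lp_def bdd_above_def)
next
  case False
  define q where "q = enn2real p"
  have s: "(\<lambda>i. 2 powr q * (cmod (c i) powr q + cmod (c' i) powr q)) summable_on UNIV"
    using assms False unfolding q_def in_lp_def
    by (intro summable_on_cmult_right summable_on_add) auto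
  have "(\<lambda>i. cmod (c i + c' i) powr q) summable_on UNIV"
  proof (rule summable_on_comparison_test[OF s])
    fix i
    let ?m = "max (cmod (c i)) (cmod (c' i))"
    have "cmod (c i + c' i) \<le> 2 * ?m"
      using norm_triangle_ineq[of "c i" "c' i"] by linarith
    then have "cmod (c i + c' i) powr q \<le> (2 * ?m) powr q"
      by (intro powr_mono2) (auto simp: q_def)
    also have "\<dots> = 2 powr q * ?m powr q" by (simp add: powr_mult)
    also have "\<dots> \<le> 2 powr q * (cmod (c i) powr q + cmod (c' i) powr q)"
      by (intro mult_left_mono) (auto simp: max_def)
    finally show "cmod (c i + c' i) powr q \<le> 2 powr q * (cmod (c i) powr q + cmod (c' i) powr q)" .
  qed auto
  then show ?thesis using False by (simp add: in_lp_def q_def)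
qed

lemma lp_norm_nonneg: "0 \<le> lp_norm p c"
  by (simp add: lp_norm_def)

lemma enn2real_ge_1: "1 \<le> p \<Longrightarrow> p \<noteq> \<infinity> \<Longrightarrow> 1 \<le> enn2real p"
  using enn2real_mono[of 1 p] by (simp add: top.not_eq_extremum)

lemma le_lp_norm:
  assumes "1 \<le> p" "in_lp p c"
  shows "cmod (c i) \<le> lp_norm p c"
proof (cases "p = \<infinity>")
  case True
  then obtain B where B: "\<And>i. cmod (c i) \<le> B"
    using assms by (auto simp: in_lp_def bdd_above_def)
  have "(SUP i. ennreal (cmod (c i))) \<le> ennreal B"
    by (intro SUP_least ennreal_leI B)
  then have fin: "(SUP i. ennreal (cmod (c i))) < top"
    using ennreal_less_top le_less_trans by blast
  have "ennreal (cmod (c i)) \<le> (SUP i. ennreal (cmod (c i)))"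
    by (rule SUP_upper) auto
  then have "enn2real (ennreal (cmod (c i))) \<le> enn2real (SUP i. ennreal (cmod (c i)))"
    using fin by (rule enn2real_mono)
  then show ?thesis using True by (simp add: lp_norm_def)
next
  case False
  define q where "q = enn2real p"
  have q: "1 \<le> q" using enn2real_ge_1 assms False by (auto simp: q_def)
  have s: "(\<lambda>i. cmod (c i) powr q) summable_on UNIV"
    using assms False by (simp add: in_lp_def q_def)
  have "cmod (c i) powr q \<le> (\<Sum>\<^sub>\<infinity>i. cmod (c i) powr q)"
    using finite_sum_le_infsum[OF s, of "{i}"] by simp
  then have "(cmod (c i) powr q) powr (1/q) \<le> (\<Sum>\<^sub>\<infinity>i. cmod (c i) powr q) powr (1/q)"
    using q by (intro powr_mono2) auto
  then show ?thesis using False q by (simp add: lp_norm_def q_def powr_powr)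
qed

text \<open>With S the l^1 norm, |c i|^q \<le> S^(q-1) |c i|. Together with
  \<open>le_lp_norm\<close> this places every l^p norm between the sup norm and the l^1 norm, so
  continuity can be tested with l^1 balls in the domain and sup balls in the target, whatever p
  is.\<close>

lemma lp_norm_le_sum:
  assumes "1 \<le> p" "(\<lambda>i. cmod (c i)) summable_on UNIV"
  shows "in_lp p c" "lp_norm p c \<le> (\<Sum>\<^sub>\<infinity>i. cmod (c i))"
proof -
  define S where "S = (\<Sum>\<^sub>\<infinity>i. cmod (c i))"
  have le: "cmod (c i) \<le> S" for i
    using finite_sum_le_infsum[OF assms(2), of "{i}"] by (simp add: S_def)
  have S0: "0 \<le> S" unfolding S_def by (rule infsum_nonneg) auto
  have "in_lp p c \<and> lp_norm p c \<le> S"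
  proof (cases "p = \<infinity>")
    case True
    have "(SUP i. ennreal (cmod (c i))) \<le> ennreal S"
      by (intro SUP_least ennreal_leI le)
    then have "enn2real (SUP i. ennreal (cmod (c i))) \<le> S"
      by (rule enn2real_leI[OF S0])
    then show ?thesis using True le by (auto simp: in_lp_def lp_norm_def bdd_above_def)
  next
    case False
    define q where "q = enn2real p"
    have q: "1 \<le> q" using enn2real_ge_1 assms False by (auto simp: q_def)
    have pw: "cmod (c i) powr q \<le> S powr (q - 1) * cmod (c i)" for i
    proof (cases "c i = 0")
      case False
      then have "cmod (c i) powr q = cmod (c i) powr (q - 1) * cmod (c i) powr 1"
        by (subst powr_add[symmetric]) simp
      also have "\<dots> \<le> S powr (q - 1) * cmod (c i)"
        using q le by (auto intro!: mult_mono powr_mono2)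
      finally show ?thesis .
    qed auto
    have s: "(\<lambda>i. S powr (q - 1) * cmod (c i)) summable_on UNIV"
      by (intro summable_on_cmult_right assms)
    have s': "(\<lambda>i. cmod (c i) powr q) summable_on UNIV"
      by (rule summable_on_comparison_test[OF s]) (use pw in auto)
    have "(\<Sum>\<^sub>\<infinity>i. cmod (c i) powr q) \<le> (\<Sum>\<^sub>\<infinity>i. S powr (q - 1) * cmod (c i))"
      by (intro infsum_mono s s' pw)
    also have "\<dots> = S powr (q - 1) * S powr 1"
      using S0 by (simp add: infsum_cmult_right' S_def)
    also have "\<dots> = S powr q" by (subst powr_add[symmetric]) simp
    finally have "(\<Sum>\<^sub>\<infinity>i. cmod (c i) powr q) powr (1/q) \<le> (S powr q) powr (1/q)"
      using q by (intro powr_mono2 infsum_nonneg) auto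
    then show ?thesis using False q s' S0 by (simp add: lp_norm_def in_lp_def q_def powr_powr)
  qed
  then show "in_lp p c" "lp_norm p c \<le> (\<Sum>\<^sub>\<infinity>i. cmod (c i))" by (auto simp: S_def)
qed

text \<open>On the open half line this is convexity of the power; if x or y vanishes it reduces to
  u^q \<le> u for 0 \<le> u \<le> 1.\<close>

lemma convex_powr_nonneg:
  fixes x y u v :: real
  assumes "1 \<le> q" "0 \<le> x" "0 \<le> y" "0 \<le> u" "0 \<le> v" "u + v = 1"
  shows "(u * x + v * y) powr q \<le> u * x powr q + v * y powr q"
proof -
  have *: "(u * x) powr q \<le> u * x powr q" if "0 \<le> u" "u \<le> 1" "0 \<le> x" for u x :: real
  proof (cases "u = 0")
    case False
    have "u powr q \<le> u powr 1" using that False assms(1) by (intro powr_mono') auto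
    then show ?thesis using that False by (auto simp: powr_mult intro!: mult_right_mono)
  qed auto
  consider "x = 0" | "y = 0" | "x > 0" "y > 0" using assms by linarith
  then show ?thesis
  proof cases
    case 1 then show ?thesis using *[of v y] assms by auto
  next
    case 2 then show ?thesis using *[of u x] assms by auto
  next
    case 3
    have u: "1 - v = u" using assms by simp
    have "((1 - v) *\<^sub>R x + v *\<^sub>R y) powr q \<le> (1 - v) * x powr q + v * y powr q"
      by (rule convex_onD[OF powr_convex[OF assms(1)]]) (use 3 assms in auto)
    then show ?thesis by (simp add: u)
  qed
qed

text \<open>Minkowski's inequality from convexity of x^q: after division by the norms a and b, the
  sum |c| + |c'| is a + b times a convex combination, with weights a/(a+b) and b/(a+b), of two
  families of norm 1. A vanishing norm forces the family itself to vanish.\<close>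

lemma lp_norm_triangle:
  assumes "1 \<le> p" "in_lp p c" "in_lp p c'"
  shows "lp_norm p (\<lambda>i. c i + c' i) \<le> lp_norm p c + lp_norm p c'"
proof (cases "p = \<infinity>")
  case True
  have "cmod (c i + c' i) \<le> lp_norm p c + lp_norm p c'" for i
    by (intro norm_triangle_mono le_lp_norm assms)
  then have "(SUP i. ennreal (cmod (c i + c' i))) \<le> ennreal (lp_norm p c + lp_norm p c')"
    by (intro SUP_least ennreal_leI)
  then have "enn2real (SUP i. ennreal (cmod (c i + c' i))) \<le> lp_norm p c + lp_norm p c'"
    by (rule enn2real_leI[OF add_nonneg_nonneg[OF lp_norm_nonneg lp_norm_nonneg]])
  then show ?thesis using True by (simp add: lp_norm_def)
next
  case False
  define q where "q = enn2real p"
  have q: "1 \<le> q" using enn2real_ge_1 assms False by (auto simp: q_def)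
  define a b where "a = lp_norm p c" and "b = lp_norm p c'"
  have ab: "0 \<le> a" "0 \<le> b" by (auto simp: a_def b_def lp_norm_nonneg)
  have s: "(\<lambda>i. cmod (c i) powr q) summable_on UNIV" "(\<lambda>i. cmod (c' i) powr q) summable_on UNIV"
    using assms False by (auto simp: in_lp_def q_def)
  have sa: "(\<lambda>i. cmod (c i + c' i) powr q) summable_on UNIV"
    using in_lp_add[OF assms(2,3)] False by (auto simp: in_lp_def q_def)
  have aq: "(\<Sum>\<^sub>\<infinity>i. cmod (c i) powr q) = a powr q" "(\<Sum>\<^sub>\<infinity>i. cmod (c' i) powr q) = b powr q"
    using False q by (auto simp: a_def b_def lp_norm_def q_def powr_powr infsum_nonneg)
  consider "a = 0" | "b = 0" | "a > 0" "b > 0" using ab by linarith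
  then show ?thesis
  proof cases
    case 1
    then have "c i = 0" for i using le_lp_norm[OF assms(1,2), of i] by (simp add: a_def)
    then show ?thesis by (simp add: lp_norm_nonneg)
  next
    case 2
    then have "c' i = 0" for i using le_lp_norm[OF assms(1,3), of i] by (simp add: b_def)
    then show ?thesis by (simp add: lp_norm_nonneg)
  next
    case 3
    let ?u = "a / (a + b)" and ?v = "b / (a + b)"
    have uv: "?u + ?v = 1" using 3 by (simp add: add_divide_distrib[symmetric])
    have pw: "cmod (c i + c' i) powr q \<le>
        (a + b) powr q * (?u * a powr - q) * cmod (c i) powr q
        + (a + b) powr q * (?v * b powr - q) * cmod (c' i) powr q" (is "_ \<le> ?f i + ?g i") for i
    proof -
      have "cmod (c i + c' i) \<le> cmod (c i) + cmod (c' i)" by (rule norm_triangle_ineq)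
      also have "\<dots> = (a + b) * (?u * (cmod (c i) / a) + ?v * (cmod (c' i) / b))"
      proof -
        have "?u * (cmod (c i) / a) = cmod (c i) / (a + b)" "?v * (cmod (c' i) / b) = cmod (c' i) / (a + b)"
          using 3 by simp_all
        then have "?u * (cmod (c i) / a) + ?v * (cmod (c' i) / b) = (cmod (c i) + cmod (c' i)) / (a + b)"
          by (simp only: add_divide_distrib)
        then show ?thesis using 3 by simp
      qed
      finally have "cmod (c i + c' i) powr q
          \<le> ((a + b) * (?u * (cmod (c i) / a) + ?v * (cmod (c' i) / b))) powr q"
        using q by (intro powr_mono2) auto
      also have "\<dots> = (a + b) powr q * (?u * (cmod (c i) / a) + ?v * (cmod (c' i) / b)) powr q"
        using 3 by (intro powr_mult) 
      also have "\<dots> \<le> (a + b) powr q * (?u * (cmod (c i) / a) powr q + ?v * (cmod (c' i) / b) powr q)"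
        using 3 q uv by (intro mult_left_mono convex_powr_nonneg) auto
      also have "\<dots> = ?f i + ?g i"
        using 3 by (simp add: powr_divide powr_minus field_simps)
      finally show ?thesis .
    qed
    have sf: "?f summable_on UNIV" "?g summable_on UNIV"
      by (intro summable_on_cmult_right s)+
    have "(\<Sum>\<^sub>\<infinity>i. cmod (c i + c' i) powr q) \<le> (\<Sum>\<^sub>\<infinity>i. ?f i + ?g i)"
      by (intro infsum_mono sa pw summable_on_add sf)
    also have "\<dots> = (\<Sum>\<^sub>\<infinity>i. ?f i) + (\<Sum>\<^sub>\<infinity>i. ?g i)" by (rule infsum_add[OF sf])
    also have "\<dots> = (a + b) powr q * (?u * a powr - q) * a powr q
        + (a + b) powr q * (?v * b powr - q) * b powr q"
      by (simp only: infsum_cmult_right' aq)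
    also have "\<dots> = (a + b) powr q * (?u + ?v)"
    proof -
      have "a powr - q * a powr q = 1" "b powr - q * b powr q = 1"
        using 3 by (simp_all add: powr_minus)
      then show ?thesis by (simp add: mult.assoc distrib_left)
    qed
    also have "\<dots> = (a + b) powr q" using uv by simp
    finally have "(\<Sum>\<^sub>\<infinity>i. cmod (c i + c' i) powr q) powr (1/q) \<le> ((a + b) powr q) powr (1/q)"
      using q by (intro powr_mono2 infsum_nonneg) auto
    then show ?thesis using False q 3 by (simp add: lp_norm_def q_def powr_powr a_def b_def)
  qed
qed

text \<open>\<open>weighted_lp\<close> applies \<open>mtopology\<close> to a bare set and distance,
  so its open sets are described by balls only after the metric axioms are checked. Strict
  positivity of the weight separates points.\<close>

lemma Metric_space_weighted_lp:
  fixes w :: "'i \<Rightarrow> real"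
  assumes p: "1 \<le> p" and w: "\<And>i. w i > 0"
  shows "Metric_space {c. in_lp p (\<lambda>i. c i * of_real (w i))}
       (\<lambda>c c'. lp_norm p (\<lambda>i. (c i - c' i) * of_real (w i)))"
proof
  have d: "in_lp p (\<lambda>i. (c i - c' i) * of_real (w i))"
    if "in_lp p (\<lambda>i. c i * of_real (w i))" "in_lp p (\<lambda>i. c' i * of_real (w i))" for c c'
  proof -
    have "in_lp p (\<lambda>i. c i * of_real (w i) + - (c' i * of_real (w i)))"
      by (intro in_lp_add that in_lp_mono[OF that(2), of _ 1]) auto
    then show ?thesis by (simp add: algebra_simps)
  qed
  fix x y z :: "'i \<Rightarrow> complex"
  show "lp_norm p (\<lambda>i. (x i - y i) * of_real (w i)) = lp_norm p (\<lambda>i. (y i - x i) * of_real (w i))"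
    unfolding lp_norm_def by (simp add: norm_mult norm_minus_commute)
  { assume "x \<in> {c. in_lp p (\<lambda>i. c i * of_real (w i))}" "y \<in> {c. in_lp p (\<lambda>i. c i * of_real (w i))}"
    then have xy: "in_lp p (\<lambda>i. (x i - y i) * of_real (w i))" by (auto intro: d)
    show "lp_norm p (\<lambda>i. (x i - y i) * of_real (w i)) = 0 \<longleftrightarrow> x = y"
    proof
      assume 0: "lp_norm p (\<lambda>i. (x i - y i) * of_real (w i)) = 0"
      show "x = y"
      proof
        fix i
        have "cmod ((x i - y i) * of_real (w i)) \<le> 0"
          using le_lp_norm[OF p xy, of i] 0 by simp
        then show "x i = y i" using w[of i] by (simp add: norm_mult mult_le_0_iff)
      qed
    next
      assume "x = y"
      then show "lp_norm p (\<lambda>i. (x i - y i) * of_real (w i)) = 0"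
        using lp_norm_le_sum(2)[OF p, of "\<lambda>i::'i. 0"] lp_norm_nonneg[of p "\<lambda>i::'i. 0"]
        by (simp add: le_antisym)
    qed }
  assume "x \<in> {c. in_lp p (\<lambda>i. c i * of_real (w i))}" "y \<in> {c. in_lp p (\<lambda>i. c i * of_real (w i))}"
    "z \<in> {c. in_lp p (\<lambda>i. c i * of_real (w i))}"
  then have "lp_norm p (\<lambda>i. (x i - y i) * of_real (w i) + (y i - z i) * of_real (w i))
    \<le> lp_norm p (\<lambda>i. (x i - y i) * of_real (w i)) + lp_norm p (\<lambda>i. (y i - z i) * of_real (w i))"
    by (intro lp_norm_triangle p d) auto
  then show "lp_norm p (\<lambda>i. (x i - z i) * of_real (w i)) 
    \<le> lp_norm p (\<lambda>i. (x i - y i) * of_real (w i)) + lp_norm p (\<lambda>i. (y i - z i) * of_real (w i))"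
    by (simp add: algebra_simps)
qed (simp add: lp_norm_nonneg)

lemma topspace_weighted_lp:
  assumes "1 \<le> p" "\<And>i. w i > 0"
  shows "topspace (weighted_lp p w) = {c. in_lp p (\<lambda>i. c i * of_real (w i))}"
  unfolding weighted_lp_def
  by (rule Metric_space.topspace_mtopology[OF Metric_space_weighted_lp[OF assms]])

lemma openin_weighted_lp:
  assumes "1 \<le> p" "\<And>i. w i > 0"
  shows "openin (weighted_lp p w) U \<longleftrightarrow> U \<subseteq> topspace (weighted_lp p w) \<and>
    (\<forall>x\<in>U. \<exists>e>0. \<forall>y\<in>topspace (weighted_lp p w).
        lp_norm p (\<lambda>i. (x i - y i) * of_real (w i)) < e \<longrightarrow> y \<in> U)"
proof -
  interpret M: Metric_space "{c. in_lp p (\<lambda>i. c i * of_real (w i))}"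
       "(\<lambda>c c'. lp_norm p (\<lambda>i. (c i - c' i) * of_real (w i)))"
    by (rule Metric_space_weighted_lp[OF assms])
  have "(\<exists>e>0. M.mball x e \<subseteq> U) \<longleftrightarrow> (\<exists>e>0. \<forall>y\<in>{c. in_lp p (\<lambda>i. c i * of_real (w i))}.
        lp_norm p (\<lambda>i. (x i - y i) * of_real (w i)) < e \<longrightarrow> y \<in> U)"
    if "U \<subseteq> {c. in_lp p (\<lambda>i. c i * of_real (w i))}" "x \<in> U" for x
    using that unfolding M.mball_def by blast
  then show ?thesis
    unfolding topspace_weighted_lp[OF assms] unfolding weighted_lp_def M.openin_mtopology
    by (intro conj_cong refl) auto
qed

lemma lp_in_topspace_add:
  assumes "1 \<le> p" "\<And>i. w i > 0"
    "x \<in> topspace (weighted_lp p w)" "y \<in> topspace (weighted_lp p w)"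
  shows "(\<lambda>i. a * x i + b * y i) \<in> topspace (weighted_lp p w)"
proof -
  have "in_lp p (\<lambda>i. a * (x i * of_real (w i)) + b * (y i * of_real (w i)))"
  proof (rule in_lp_add)
    show "in_lp p (\<lambda>i. a * (x i * of_real (w i)))"
      by (rule in_lp_mono[of p "\<lambda>i. x i * of_real (w i)" _ "cmod a"])
        (use assms(3) in \<open>simp_all add: topspace_weighted_lp[OF assms(1,2)] norm_mult\<close>)
    show "in_lp p (\<lambda>i. b * (y i * of_real (w i)))"
      by (rule in_lp_mono[of p "\<lambda>i. y i * of_real (w i)" _ "cmod b"])
        (use assms(4) in \<open>simp_all add: topspace_weighted_lp[OF assms(1,2)] norm_mult\<close>)
  qed
  then show ?thesis
    unfolding topspace_weighted_lp[OF assms(1,2)] by (simp add: algebra_simps)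
qed

lemma lp_topspace_mono:
  assumes "1 \<le> p" "\<And>i. w i > 0" "\<And>i. w' i > 0" "\<And>i. w' i \<le> K * w i"
    "x \<in> topspace (weighted_lp p w)"
  shows "x \<in> topspace (weighted_lp p w')"
  using assms(5) unfolding topspace_weighted_lp[OF assms(1,2)] topspace_weighted_lp[OF assms(1,3)] mem_Collect_eq
proof (rule in_lp_mono[where K = K])
  fix i
  have "cmod (x i) * w' i \<le> cmod (x i) * (K * w i)"
    by (intro mult_left_mono assms) auto
  then show "cmod (x i * of_real (w' i)) \<le> K * cmod (x i * of_real (w i))"
    using assms(2,3)[of i] by (simp add: norm_mult mult.left_commute)
qed

lemma lp_in_topspaceI:
  assumes "1 \<le> p" "\<And>i. w i > 0" "(\<lambda>i. cmod (F i) * w i) summable_on UNIV"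
  shows "F \<in> topspace (weighted_lp p w)"
  unfolding topspace_weighted_lp[OF assms(1,2)] mem_Collect_eq
  using assms(2,3) by (intro lp_norm_le_sum(1)[OF assms(1)]) (simp add: norm_mult abs_of_pos)

text \<open>The open unit ball of a weighted sup seminorm: the uniform gap \<open>e\<close> says
  that the supremum is strictly below 1 without forming it. Pointwise strict inequalities alone
  would leave no room for a perturbation.\<close>

abbreviation sup_ball :: "('i \<Rightarrow> complex) topology \<Rightarrow> ('i \<Rightarrow> real) \<Rightarrow> ('i \<Rightarrow> complex) set" where
  "sup_ball X v \<equiv> {F \<in> topspace X. \<exists>e>0. \<forall>i. cmod (F i) * v i \<le> 1 - e}"

lemma openin_weighted_sup:
  assumes p: "1 \<le> p" and w: "\<And>i. w i > 0" and v: "\<And>i. 0 \<le> v i" "\<And>i. v i \<le> C * w i"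
  shows "openin (weighted_lp p w)
    (sup_ball (weighted_lp p w) v)"
  unfolding openin_weighted_lp[OF p w]
proof (intro conjI ballI)
  fix x assume "x \<in> sup_ball (weighted_lp p w) v"
  then obtain e where x: "x \<in> topspace (weighted_lp p w)" and e: "e > 0"
    and xe: "\<And>i. cmod (x i) * v i \<le> 1 - e" by blast
  \<comment> \<open>A perturbation of norm below d moves the seminorm by at most |C| d \<le> e/2,
    half of the gap. The summand 1 keeps the quotient meaningful for C = 0.\<close>
  define d where "d = (e / 2) / (\<bar>C\<bar> + 1)"
  have d: "d > 0" using e by (simp add: d_def)
  have Cd: "\<bar>C\<bar> * d \<le> e / 2"
  proof -
    have "\<bar>C\<bar> * d \<le> (\<bar>C\<bar> + 1) * d" using d by (intro mult_right_mono) auto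
    also have "\<dots> = e / 2"
    proof -
      have "k * (x / k) = x" if "k \<noteq> 0" for k x :: real using that by simp
      from this[of "\<bar>C\<bar> + 1" "e / 2"] show ?thesis unfolding d_def by linarith
    qed
    finally show ?thesis .
  qed
  show "\<exists>d>0. \<forall>y\<in>topspace (weighted_lp p w). lp_norm p (\<lambda>i. (x i - y i) * of_real (w i)) < d \<longrightarrow>
      y \<in> sup_ball (weighted_lp p w) v"
  proof (rule exI[of _ d], intro conjI d ballI impI)
    fix y assume y: "y \<in> topspace (weighted_lp p w)"
      and less: "lp_norm p (\<lambda>i. (x i - y i) * of_real (w i)) < d"
    have "(\<lambda>i. 1 * x i + (-1) * y i) \<in> topspace (weighted_lp p w)"
      by (rule lp_in_topspace_add[OF p w x y])
    then have "in_lp p (\<lambda>i. (x i - y i) * of_real (w i))"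
      by (simp add: topspace_weighted_lp[OF p w])
    then have xy: "cmod (x i - y i) * w i \<le> d" for i
      using le_lp_norm[OF p, of "\<lambda>i. (x i - y i) * of_real (w i)" i] less
      by (simp add: norm_mult abs_of_pos w)
    have "cmod (y i) * v i \<le> 1 - e / 2" for i
    proof -
      have "cmod (y i) \<le> cmod (x i) + cmod (x i - y i)"
        using norm_triangle_ineq4[of "x i" "x i - y i"] by simp
      then have "cmod (y i) * v i \<le> cmod (x i) * v i + cmod (x i - y i) * v i"
        using v(1)[of i] by (metis distrib_right mult_right_mono)
      also have "cmod (x i - y i) * v i \<le> cmod (x i - y i) * (\<bar>C\<bar> * w i)"
        using v(2)[of i] w[of i] by (intro mult_left_mono) (auto intro: order_trans mult_right_mono)
      also have "\<dots> \<le> \<bar>C\<bar> * d" using mult_left_mono[OF xy, of "\<bar>C\<bar>"] by (simp add: mult_ac)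
      finally show ?thesis using xe[of i] Cd by linarith
    qed
    then show "y \<in> sup_ball (weighted_lp p w) v"
      using y e by (auto intro!: exI[of _ "e/2"])
  qed
qed auto

section \<open>Continuous maps between weighted projective and inductive limits\<close>

text \<open>Comparability of any two weights replaces directedness, nuclearity trades a sup bound
  for an l^1 bound at another parameter, and the cofinal sequence feeds the diagonal argument. No
  monotonicity in r is fixed, since the two families to which this is applied run in opposite
  directions. The inductive limit uses \<open>\<theta> r\<close> and the projective limit its
  inverse, so the two are paired.\<close>

locale weights =
  fixes p :: ennreal and \<theta> :: "real \<Rightarrow> 'i \<Rightarrow> real"
  assumes p: "1 \<le> p"
    and pos: "\<And>r i. 0 < \<theta> r i"
    and total: "\<And>r r'. 0 < r \<Longrightarrow> 0 < r' \<Longrightarrow> (\<forall>i. \<theta> r i \<le> \<theta> r' i) \<or> (\<forall>i. \<theta> r' i \<le> \<theta> r i)"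
    and nuclear: "\<And>r. 0 < r \<Longrightarrow> \<exists>r'>0. (\<lambda>i. \<theta> r' i / \<theta> r i) summable_on UNIV"
    and cofinal: "\<exists>\<rho>::nat \<Rightarrow> real. (\<forall>n. 0 < \<rho> n) \<and> (\<forall>r>0. \<exists>N. \<forall>n\<ge>N. \<forall>i. \<theta> (\<rho> n) i \<le> \<theta> r i)"
begin

abbreviation "E r \<equiv> weighted_lp p (\<theta> r)"
abbreviation "E' r \<equiv> weighted_lp p (\<lambda>i. 1 / \<theta> r i)"
abbreviation "UE \<equiv> \<Union>r\<in>{0<..}. topspace (E r)"
abbreviation "IE \<equiv> \<Inter>r\<in>{0<..}. topspace (E' r)"
abbreviation "ind \<equiv> ind_lim E"
abbreviation "proj \<equiv> proj_lim E'"

lemma nonneg: "0 \<le> \<theta> r i" using pos[of r i] by simp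
lemma pos': "0 < 1 / \<theta> r i" using pos[of r i] by simp

section \<open>Elements of the two limits and bounds on their coefficients\<close>

lemma topspace_proj: "topspace proj = IE"
proof -
  have "IE \<subseteq> topspace proj"
    unfolding proj_lim_def topology_generated_by_topspace
  proof
    fix x assume "x \<in> IE"
    then have "x \<in> topspace (E' 1) \<inter>
        IE"
      by (meson IntI INT_D greaterThan_iff zero_less_one)
    moreover have "topspace (E' 1) \<inter>
        IE \<in>
      {U \<inter> IE | U r.
        0 < r \<and> openin (E' r) U}"
      by (rule CollectI, intro exI conjI) (rule refl, rule zero_less_one, rule openin_topspace)
    ultimately show "x \<in> \<Union> {U \<inter> IE | U r.
        0 < r \<and> openin (E' r) U}"
      by (rule UnionI[rotated])
  qed
  then show ?thesis unfolding proj_lim_def topology_generated_by_topspace by blast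
qed

lemma combination_in_proj:
  "F \<in> topspace proj \<Longrightarrow> G \<in> topspace proj \<Longrightarrow> (\<lambda>i. a * F i + b * G i) \<in> topspace proj"
  unfolding topspace_proj INT_iff by (intro ballI lp_in_topspace_add[OF p pos']) auto

lemma combination_in_Union:
  assumes "F \<in> UE"
    "G \<in> UE"
  shows "(\<lambda>i. a * F i + b * G i) \<in> UE"
proof -
  obtain r r' where r: "0 < r" "0 < r'" "F \<in> topspace (E r)"
    "G \<in> topspace (E r')" using assms by auto
  obtain q where "0 < q" "F \<in> topspace (E q)" "G \<in> topspace (E q)"
    using total[OF r(1,2)]
  proof
    assume "\<forall>i. \<theta> r i \<le> \<theta> r' i"
    then have "G \<in> topspace (E r)"
      by (intro lp_topspace_mono[OF p pos pos _ r(4), where K = 1]) auto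
    then show thesis using r that by blast
  next
    assume "\<forall>i. \<theta> r' i \<le> \<theta> r i"
    then have "F \<in> topspace (E r')"
      by (intro lp_topspace_mono[OF p pos pos _ r(3), where K = 1]) auto
    then show thesis using r that by blast
  qed
  then have "(\<lambda>i. a * F i + b * G i) \<in> topspace (E q)"
    by (intro lp_in_topspace_add[OF p pos])
  then show ?thesis using \<open>0 < q\<close> by blast
qed

lemma zero_in_weighted: "(\<lambda>i. 0) \<in> topspace (E r)"
  by (rule lp_in_topspaceI[OF p pos]) simp

lemma topspace_ind: "topspace ind = UE" (is "_ = ?X")
proof
  show "topspace ind \<subseteq> ?X"
    using openin_topspace[of ind] unfolding openin_ind_lim by blast
  have "openin ind ?X"
    unfolding openin_ind_lim
  proof (intro conjI subset_refl ballI exI[of _ ?X])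
    show "ind_lim_nhd E ?X"
      unfolding ind_lim_nhd_def
    proof (intro conjI allI impI)
      show "abs_convex ?X" unfolding abs_convex_def using combination_in_Union by blast
      fix r :: real assume "0 < r"
      then show "\<exists>W. openin (E r) W \<and> (\<lambda>i. 0) \<in> W \<and> W \<subseteq> ?X"
        using zero_in_weighted by (intro exI[of _ "topspace (E r)"]) auto
    qed
    fix x assume "x \<in> ?X"
    then show "(\<lambda>v i. x i + v i) ` ?X \<subseteq> ?X"
      using combination_in_Union[where F = x and a = 1 and b = 1] by auto
  qed
  then show "?X \<subseteq> topspace ind" by (rule openin_subset)
qed

lemma combination_in_ind:
  "F \<in> topspace ind \<Longrightarrow> G \<in> topspace ind \<Longrightarrow> (\<lambda>i. a * F i + b * G i) \<in> topspace ind"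
  unfolding topspace_ind by (rule combination_in_Union)

lemma proj_bound:
  assumes "F \<in> topspace proj" "0 < r"
  shows "\<exists>M\<ge>0. \<forall>i. cmod (F i) \<le> M * \<theta> r i"
proof -
  have "F \<in> topspace (E' r)"
    using assms unfolding topspace_proj by blast
  then have "in_lp p (\<lambda>i. F i * of_real (1 / \<theta> r i))"
    unfolding topspace_weighted_lp[OF p pos'] by (rule CollectD)
  from le_lp_norm[OF p this]
  have "cmod (F i) / \<theta> r i \<le> lp_norm p (\<lambda>i. F i * of_real (1 / \<theta> r i))" for i
    by (simp add: norm_mult norm_divide abs_of_pos pos)
  then have "cmod (F i) \<le> lp_norm p (\<lambda>i. F i * of_real (1 / \<theta> r i)) * \<theta> r i" for i
    by (metis pos divide_le_eq)
  then show ?thesis using lp_norm_nonneg by blast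
qed

lemma ind_bound:
  assumes "F \<in> topspace ind"
  shows "\<exists>r>0. \<exists>M\<ge>0. \<forall>i. cmod (F i) * \<theta> r i \<le> M"
proof -
  obtain r where r: "0 < r" "F \<in> topspace (E r)"
    using assms unfolding topspace_ind by blast
  from r(2) have "in_lp p (\<lambda>i. F i * of_real (\<theta> r i))"
    unfolding topspace_weighted_lp[OF p pos] by (rule CollectD)
  from le_lp_norm[OF p this]
  have "cmod (F i) * \<theta> r i \<le> lp_norm p (\<lambda>i. F i * of_real (\<theta> r i))" for i
    by (simp add: norm_mult abs_of_pos pos)
  then show ?thesis using r lp_norm_nonneg by blast
qed

text \<open>Nuclearity at work: the element satisfies a sup bound for every parameter, in particular
  for the r' whose quotient \<open>\<theta> r' / \<theta> r\<close> is summable. In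
  \<open>ind_l1\<close> the same device costs a change of parameter.\<close>

lemma proj_l1:
  assumes "F \<in> topspace proj" "0 < r"
  shows "(\<lambda>i. cmod (F i) * (1 / \<theta> r i)) summable_on UNIV"
proof -
  obtain r' where r': "0 < r'" "(\<lambda>i. \<theta> r' i / \<theta> r i) summable_on UNIV"
    using nuclear[OF assms(2)] by blast
  obtain M where M: "\<And>i. cmod (F i) \<le> M * \<theta> r' i" using proj_bound[OF assms(1) r'(1)] by blast
  show ?thesis
  proof (rule summable_on_comparison_test[OF summable_on_cmult_right[OF r'(2), of M]])
    fix i show "cmod (F i) * (1 / \<theta> r i) \<le> M * (\<theta> r' i / \<theta> r i)"
      using mult_right_mono[OF M less_imp_le[OF pos'], of i r i] by simp
  qed (simp add: nonneg)
qed

lemma ind_l1: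
  assumes "F \<in> topspace ind"
  shows "\<exists>r>0. (\<lambda>i. cmod (F i) * \<theta> r i) summable_on UNIV"
proof -
  obtain r M where r: "0 < r" and M: "\<And>i. cmod (F i) * \<theta> r i \<le> M" using ind_bound[OF assms] by blast
  obtain r' where r': "0 < r'" "(\<lambda>i. \<theta> r' i / \<theta> r i) summable_on UNIV"
    using nuclear[OF r] by blast
  have "(\<lambda>i. cmod (F i) * \<theta> r' i) summable_on UNIV"
  proof (rule summable_on_comparison_test[OF summable_on_cmult_right[OF r'(2), of M]])
    fix i
    have "cmod (F i) * \<theta> r i * (\<theta> r' i / \<theta> r i) \<le> M * (\<theta> r' i / \<theta> r i)"
      by (intro mult_right_mono M divide_nonneg_nonneg nonneg)
    then show "cmod (F i) * \<theta> r' i \<le> M * (\<theta> r' i / \<theta> r i)"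
      using pos[of r i] by simp
  qed (simp add: nonneg)
  then show ?thesis using r' by blast
qed

text \<open>A finite intersection of basic neighbourhoods involves several parameters, but by
  comparability the l^1 ball for the pointwise smallest \<open>\<theta> r\<close> with the smallest
  radius fits inside all of them. An l^1 ball lies in the l^p ball of the same radius.\<close>

lemma proj_nhd:
  assumes "openin proj U" "x \<in> U"
  shows "\<exists>r>0. \<exists>e>0. \<forall>y\<in>topspace proj.
    (\<lambda>i. cmod (x i - y i) * (1 / \<theta> r i)) summable_on UNIV \<and>
    (\<Sum>\<^sub>\<infinity>i. cmod (x i - y i) * (1 / \<theta> r i)) < e \<longrightarrow> y \<in> U"
proof -
  define S where "S = {U \<inter> IE | U r.
        0 < r \<and> openin (E' r) U}"
  define N where "N r e x = {y \<in> topspace proj. (\<lambda>i. cmod (x i - y i) * (1 / \<theta> r i)) summable_on UNIV \<and>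
    (\<Sum>\<^sub>\<infinity>i. cmod (x i - y i) * (1 / \<theta> r i)) < e}" for r e x
  have Nmono: "N r e x \<subseteq> N r' e' x" if "\<forall>i. \<theta> r i \<le> \<theta> r' i" "e \<le> e'" for r r' e e' x
  proof
    fix y assume y: "y \<in> N r e x"
    then have s: "(\<lambda>i. cmod (x i - y i) * (1 / \<theta> r i)) summable_on UNIV" by (simp add: N_def)
    have le: "cmod (x i - y i) * (1 / \<theta> r' i) \<le> cmod (x i - y i) * (1 / \<theta> r i)" for i
      using that(1) pos by (intro mult_left_mono divide_left_mono) auto
    have s': "(\<lambda>i. cmod (x i - y i) * (1 / \<theta> r' i)) summable_on UNIV"
      by (rule summable_on_comparison_test[OF s le]) (simp add: nonneg)
    have "(\<Sum>\<^sub>\<infinity>i. cmod (x i - y i) * (1 / \<theta> r' i)) \<le> (\<Sum>\<^sub>\<infinity>i. cmod (x i - y i) * (1 / \<theta> r i))"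
      by (intro infsum_mono s s' le)
    then show "y \<in> N r' e' x" using y s' that(2) by (auto simp: N_def)
  qed
  have "generate_topology_on S U"
    using assms(1) unfolding proj_lim_def S_def[symmetric] openin_topology_generated_by_iff .
  then have "\<forall>x\<in>U. \<exists>r>0. \<exists>e>0. N r e x \<subseteq> U"
  proof induction
    case (Int a b)
    show ?case
    proof
      fix x assume "x \<in> a \<inter> b"
      then obtain r e r' e' where *: "0 < r" "0 < e" "N r e x \<subseteq> a" "0 < r'" "0 < e'" "N r' e' x \<subseteq> b"
        using Int.IH by (meson IntD1 IntD2)
      from total[OF *(1,4)] show "\<exists>r>0. \<exists>e>0. N r e x \<subseteq> a \<inter> b"
      proof
        assume "\<forall>i. \<theta> r i \<le> \<theta> r' i"
        then have "N r (min e e') x \<subseteq> a \<inter> b"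
          using Nmono[of r r' "min e e'" e' x] Nmono[of r r "min e e'" e x] * by auto
        then show ?thesis using * by (intro exI[of _ r] exI[of _ "min e e'"] conjI) auto
      next
        assume "\<forall>i. \<theta> r' i \<le> \<theta> r i"
        then have "N r' (min e e') x \<subseteq> a \<inter> b"
          using Nmono[of r' r "min e e'" e x] Nmono[of r' r' "min e e'" e' x] * by auto
        then show ?thesis using * by (intro exI[of _ r'] exI[of _ "min e e'"] conjI) auto
      qed
    qed
  next
    case (UN K) then show ?case by (meson Union_iff Union_upper order_trans)
  next
    case (Basis s)
    then obtain U r where s: "s = U \<inter> topspace proj" "0 < r" and
      U: "openin (E' r) U" unfolding S_def topspace_proj by blast
    show ?case
    proof
      fix x assume "x \<in> s"
      then have xU: "x \<in> U" and xp: "x \<in> topspace proj" using s by auto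
      then obtain e where e: "e > 0" and sub: "\<And>y. y \<in> topspace (E' r) \<Longrightarrow>
        lp_norm p (\<lambda>i. (x i - y i) * of_real (1 / \<theta> r i)) < e \<Longrightarrow> y \<in> U"
        using U unfolding openin_weighted_lp[OF p pos'] by blast
      have "N r e x \<subseteq> s"
      proof
        fix y assume y: "y \<in> N r e x"
        have eq: "(\<lambda>i. cmod ((x i - y i) * of_real (1 / \<theta> r i))) = (\<lambda>i. cmod (x i - y i) * (1 / \<theta> r i))"
          using pos by (simp add: norm_mult norm_divide abs_of_pos)
        have "lp_norm p (\<lambda>i. (x i - y i) * of_real (1 / \<theta> r i)) < e"
          using lp_norm_le_sum(2)[OF p, of "\<lambda>i. (x i - y i) * of_real (1 / \<theta> r i)"] y
          unfolding eq by (simp add: N_def)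
        moreover have "y \<in> topspace (E' r)"
          using y s(2) by (simp add: N_def topspace_proj)
        ultimately show "y \<in> s" using sub y s(1) by (simp add: N_def)
      qed
      then show "\<exists>r>0. \<exists>e>0. N r e x \<subseteq> s" using e s(2) by blast
    qed
  qed auto
  then show ?thesis using assms(2) unfolding N_def by blast
qed

text \<open>In contrast to \<open>proj_nhd\<close>, a ball is available for every parameter, because
  a neighbourhood of 0 meets each step in a neighbourhood of 0.\<close>

lemma ind_nhd:
  assumes "openin ind U" "(\<lambda>i. 0) \<in> U" "0 < r"
  shows "\<exists>e>0. \<forall>y. (\<lambda>i. cmod (y i) * \<theta> r i) summable_on UNIV \<and>
    (\<Sum>\<^sub>\<infinity>i. cmod (y i) * \<theta> r i) < e \<longrightarrow> y \<in> U"
proof -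
  obtain V where V: "ind_lim_nhd E V" "(\<lambda>v i. (\<lambda>i. 0) i + v i) ` V \<subseteq> U"
    using assms(1,2) unfolding openin_ind_lim by meson
  then have "V \<subseteq> U" by simp
  moreover obtain W where W: "openin (E r) W" "(\<lambda>i. 0) \<in> W" "W \<subseteq> V"
    using V(1) assms(3) unfolding ind_lim_nhd_def by blast
  obtain e where e: "e > 0" and sub: "\<And>y. y \<in> topspace (E r) \<Longrightarrow>
        lp_norm p (\<lambda>i. ((\<lambda>i. 0) i - y i) * of_real (\<theta> r i)) < e \<Longrightarrow> y \<in> W"
    using W unfolding openin_weighted_lp[OF p pos] by meson
  have "y \<in> W" if y: "(\<lambda>i. cmod (y i) * \<theta> r i) summable_on UNIV"
      "(\<Sum>\<^sub>\<infinity>i. cmod (y i) * \<theta> r i) < e" for y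
  proof (rule sub)
    show "y \<in> topspace (E r)" by (rule lp_in_topspaceI[OF p pos y(1)])
    have eq: "(\<lambda>i. cmod ((0 - y i) * of_real (\<theta> r i))) = (\<lambda>i. cmod (y i) * \<theta> r i)"
      using pos by (simp add: norm_mult abs_of_pos)
    show "lp_norm p (\<lambda>i. (0 - y i) * of_real (\<theta> r i)) < e"
      using lp_norm_le_sum(2)[OF p, of "\<lambda>i. (0 - y i) * of_real (\<theta> r i)"] y
      unfolding eq by simp
  qed
  ultimately show ?thesis using W e by blast
qed

lemma proj_open_sup:
  assumes "0 < r"
  shows "openin proj (sup_ball proj (\<lambda>i. 1 / \<theta> r i))"
proof -
  let ?W = "sup_ball (E' r) (\<lambda>i. 1 / \<theta> r i)"
  have "openin (E' r) ?W"
    by (rule openin_weighted_sup[OF p pos', where C = 1]) (simp_all add: nonneg)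
  then have "openin proj (?W \<inter> IE)"
    unfolding proj_lim_def by (intro topology_generated_by_Basis) (use assms in blast)
  also have "?W \<inter> IE =
      sup_ball proj (\<lambda>i. 1 / \<theta> r i)"
    unfolding topspace_proj using assms by blast
  finally show ?thesis .
qed

text \<open>A weight dominated by a multiple of every \<open>\<theta> r\<close> defines a seminorm
  that is continuous on each step, hence on the locally convex inductive limit. Such weights may
  vanish at some indices, which both later uses exploit.\<close>

lemma ind_open_sup:
  assumes v: "\<And>i. 0 \<le> v i" "\<And>r. 0 < r \<Longrightarrow> \<exists>C. \<forall>i. v i \<le> C * \<theta> r i"
  shows "openin ind (sup_ball ind v)"
  unfolding openin_ind_lim
proof (intro conjI ballI)
  show "sup_ball ind v \<subseteq> UE"
    unfolding topspace_ind by blast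
  fix x assume "x \<in> sup_ball ind v"
  then obtain e where x: "x \<in> topspace ind" and e: "e > 0"
    and xe: "\<And>i. cmod (x i) * v i \<le> 1 - e" by blast
  \<comment> \<open>Half of the gap of x is spent on V, so every point of x + V keeps the gap
    e/2.\<close>
  define V where "V = {F \<in> topspace ind. \<forall>i. cmod (F i) * v i \<le> e / 2}"
  have "ind_lim_nhd E V"
    unfolding ind_lim_nhd_def
  proof (intro conjI allI impI)
    show "abs_convex V"
      unfolding abs_convex_def
    proof (intro ballI allI impI)
      fix F G and a b :: complex assume F: "F \<in> V" and G: "G \<in> V" and ab: "cmod a + cmod b \<le> 1"
      have "cmod (a * F i + b * G i) * v i \<le> e / 2" for i
      proof -
        have "cmod (a * F i + b * G i) * v i \<le> (cmod a * cmod (F i) + cmod b * cmod (G i)) * v i"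
          by (intro mult_right_mono v) (metis norm_mult norm_triangle_ineq)
        also have "\<dots> = cmod a * (cmod (F i) * v i) + cmod b * (cmod (G i) * v i)"
          by (simp add: algebra_simps)
        also have "\<dots> \<le> cmod a * (e / 2) + cmod b * (e / 2)"
          using F G by (intro add_mono mult_left_mono) (auto simp: V_def)
        also have "\<dots> = (cmod a + cmod b) * (e / 2)" by (simp add: algebra_simps)
        also have "\<dots> \<le> 1 * (e / 2)" using ab e by (intro mult_right_mono) auto
        finally show ?thesis by simp
      qed
      then show "(\<lambda>i. a * F i + b * G i) \<in> V"
        using F G combination_in_ind by (simp add: V_def)
    qed
    fix r :: real assume r: "0 < r"
    obtain C where C: "\<And>i. v i \<le> C * \<theta> r i" using v(2)[OF r] by blast
    \<comment> \<open>The factor 2/e rescales radius e/2 to the unit radius of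
      \<open>openin_weighted_sup\<close>.\<close>
    let ?W = "{F \<in> topspace (E r). \<exists>d>0. \<forall>i. cmod (F i) * (2 / e * v i) \<le> 1 - d}"
    have "openin (E r) ?W"
      by (rule openin_weighted_sup[OF p pos, where C = "2 / e * C"])
        (use v(1) C e in \<open>auto simp: mult.assoc intro!: mult_left_mono divide_right_mono\<close>)
    moreover have "(\<lambda>i. 0) \<in> ?W" using zero_in_weighted by (auto intro!: exI[of _ 1])
    moreover have "?W \<subseteq> V"
    proof
      fix F assume "F \<in> ?W"
      then obtain d where F: "F \<in> topspace (E r)" and "d > 0"
        "\<And>i. cmod (F i) * (2 / e * v i) \<le> 1 - d" by blast
      then have "cmod (F i) * (2 / e * v i) \<le> 1" for i by (smt (verit))
      then have "cmod (F i) * v i \<le> e / 2" for i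
        using e by (simp add: field_simps)
      then show "F \<in> V" using F r by (auto simp: V_def topspace_ind)
    qed
    ultimately show "\<exists>W. openin (E r) W \<and> (\<lambda>i. 0) \<in> W \<and> W \<subseteq> V" by blast
  qed
  moreover have "(\<lambda>v i. x i + v i) ` V \<subseteq> sup_ball ind v"
  proof clarify
    fix y assume y: "y \<in> V"
    have "(\<lambda>i. x i + y i) \<in> topspace ind"
      using combination_in_ind[where F = x and G = y and a = 1 and b = 1] x y by (simp add: V_def)
    moreover have "cmod (x i + y i) * v i \<le> 1 - e / 2" for i
    proof -
      have "cmod (x i + y i) * v i \<le> (cmod (x i) + cmod (y i)) * v i"
        by (intro mult_right_mono v norm_triangle_ineq)
      also have "\<dots> = cmod (x i) * v i + cmod (y i) * v i" by (simp add: algebra_simps)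
      also have "\<dots> \<le> (1 - e) + e / 2" using xe y by (intro add_mono) (auto simp: V_def)
      finally show ?thesis by simp
    qed
    ultimately show "(\<lambda>i. x i + y i) \<in> topspace ind \<and> (\<exists>e>0. \<forall>i. cmod (x i + y i) * v i \<le> 1 - e)"
      using e by (intro conjI exI[of _ "e/2"]) auto
  qed
  ultimately show "\<exists>V. ind_lim_nhd E V \<and>
      (\<lambda>v i. x i + v i) ` V \<subseteq> sup_ball ind v" by blast
qed

end

section \<open>Matrix entries of a map and the expansion of its values\<close>

definition delta :: "'i \<Rightarrow> 'i \<Rightarrow> complex" where
  "delta j = (\<lambda>i. if i = j then 1 else 0)"

lemma has_sum_delta: "((\<lambda>i. cmod (delta j i) * w i) has_sum w j) UNIV"
proof -
  have "((\<lambda>i. cmod (delta j i) * w i) has_sum (\<Sum>i\<in>{j}. cmod (delta j i) * w i)) UNIV"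
    by (rule has_sum_finite_neutralI[of "{j}"]) (auto simp: delta_def)
  then show ?thesis by (simp add: delta_def)
qed

lemmas summable_delta = has_sum_imp_summable[OF has_sum_delta]
lemmas infsum_delta = infsumI[OF has_sum_delta]

text \<open>The algebraic half of \<open>linear_continuous\<close>, shared by the two kinds of
  domain. Continuity enters separately, as a bound of one coordinate of T on an l^1 ball.\<close>

locale linear_on =
  fixes S :: "('i \<Rightarrow> complex) set" and T :: "('i \<Rightarrow> complex) \<Rightarrow> ('j \<Rightarrow> complex)"
  assumes comb: "\<And>F G a b. F \<in> S \<Longrightarrow> G \<in> S \<Longrightarrow> (\<lambda>i. a * F i + b * G i) \<in> S"
    and delta: "\<And>j. delta j \<in> S"
    and add: "\<And>F G. F \<in> S \<Longrightarrow> G \<in> S \<Longrightarrow> T (\<lambda>i. F i + G i) = (\<lambda>j. T F j + T G j)"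
    and scale: "\<And>k F. F \<in> S \<Longrightarrow> T (\<lambda>i. k * F i) = (\<lambda>j. k * T F j)"
begin

lemma scale_mem: "F \<in> S \<Longrightarrow> (\<lambda>i. k * F i) \<in> S"
  using comb[of F F k 0] by simp

lemma zero_mem: "(\<lambda>i. 0) \<in> S"
  using scale_mem[OF delta, of 0] by simp

lemma map_zero: "T (\<lambda>i. 0) = (\<lambda>j. 0)"
  using scale[OF zero_mem, of 0] by simp

lemma map_bound:
  assumes e: "0 < e" and c: "\<And>G. G \<in> S \<Longrightarrow> (\<lambda>i. cmod (G i) * w i) summable_on UNIV \<Longrightarrow>
      (\<Sum>\<^sub>\<infinity>i. cmod (G i) * w i) < e \<Longrightarrow> cmod (T G k) \<le> 1"
    and G: "G \<in> S" "(\<lambda>i. cmod (G i) * w i) summable_on UNIV" and w: "\<And>i. 0 \<le> w i"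
  shows "cmod (T G k) \<le> (\<Sum>\<^sub>\<infinity>i. cmod (G i) * w i) / e"
\<comment> \<open>Scaling G by 1/u for every u strictly above the claimed bound also covers the case
  of norm 0, where normalising G is impossible.\<close>
proof (rule dense_ge)
  fix u assume u: "(\<Sum>\<^sub>\<infinity>i. cmod (G i) * w i) / e < u"
  have N: "0 \<le> (\<Sum>\<^sub>\<infinity>i. cmod (G i) * w i)" using w by (intro infsum_nonneg) auto
  then have u0: "0 < u" using u e by (smt (verit) divide_nonneg_pos)
  have eq: "cmod (complex_of_real (1 / u) * G i) * w i = 1 / u * (cmod (G i) * w i)" for i
    using u0 by (simp add: norm_mult norm_divide)
  have s: "(\<lambda>i. cmod (complex_of_real (1 / u) * G i) * w i) summable_on UNIV"
    unfolding eq by (intro summable_on_cmult_right G)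
  have "(\<Sum>\<^sub>\<infinity>i. cmod (complex_of_real (1 / u) * G i) * w i) = 1 / u * (\<Sum>\<^sub>\<infinity>i. cmod (G i) * w i)"
    unfolding eq by (rule infsum_cmult_right')
  also have "\<dots> < e" using u u0 e by (simp add: field_simps)
  finally have "cmod (T (\<lambda>i. complex_of_real (1 / u) * G i) k) \<le> 1"
    by (intro c scale_mem G s)
  then have "cmod (T G k) / u \<le> 1"
    using u0 unfolding scale[OF G(1)] by (simp add: norm_mult norm_divide)
  then show "cmod (T G k) \<le> u" using u0 by simp
qed

lemma map_sum:
  assumes "finite B"
  shows "(\<lambda>i. \<Sum>j\<in>B. c j * delta j i) \<in> S \<and>
    T (\<lambda>i. \<Sum>j\<in>B. c j * delta j i) = (\<lambda>k. \<Sum>j\<in>B. c j * T (delta j) k)"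
  using assms
proof induction
  case empty then show ?case by (simp add: zero_mem map_zero)
next
  case (insert j B)
  have "(\<lambda>i. \<Sum>j\<in>insert j B. c j * delta j i) = (\<lambda>i. c j * delta j i + (\<Sum>j\<in>B. c j * delta j i))"
    using insert.hyps by simp
  moreover have "(\<lambda>i. c j * delta j i + 1 * (\<Sum>j\<in>B. c j * delta j i)) \<in> S"
    using insert.IH by (intro comb delta) auto
  moreover have "T (\<lambda>i. c j * delta j i + (\<Sum>j\<in>B. c j * delta j i))
    = (\<lambda>k. c j * T (delta j) k + (\<Sum>j\<in>B. c j * T (delta j) k))"
    using insert.IH by (subst add) (auto intro: scale_mem delta simp: scale[OF delta])
  ultimately show ?case using insert.hyps by simp
qed

text \<open>Finite truncations P of F leave a remainder R whose weighted l^1 norm is the tail of a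
  convergent sum. By \<open>map_bound\<close> the k-th coordinate of T R tends to 0 along the finite
  index sets, which is unordered convergence.\<close>

lemma expansion:
  assumes e: "0 < e" and c: "\<And>G. G \<in> S \<Longrightarrow> (\<lambda>i. cmod (G i) * w i) summable_on UNIV \<Longrightarrow>
      (\<Sum>\<^sub>\<infinity>i. cmod (G i) * w i) < e \<Longrightarrow> cmod (T G k) \<le> 1"
    and F: "F \<in> S" "(\<lambda>i. cmod (F i) * w i) summable_on UNIV" and w: "\<And>i. 0 \<le> w i"
  shows "((\<lambda>j. T (delta j) k * F j) has_sum T F k) UNIV"
proof -
  define N where "N = (\<Sum>\<^sub>\<infinity>i. cmod (F i) * w i)"
  have bound: "cmod ((\<Sum>j\<in>B. T (delta j) k * F j) - T F k) \<le> (N - (\<Sum>j\<in>B. cmod (F j) * w j)) / e"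
    if B: "finite B" for B
  proof -
    define P where "P = (\<lambda>i. \<Sum>j\<in>B. F j * delta j i)"
    have P: "P \<in> S" "T P k = (\<Sum>j\<in>B. T (delta j) k * F j)"
      using map_sum[OF B, of F] by (simp_all add: P_def mult.commute)
    have P_eq: "P i = (if i \<in> B then F i else 0)" for i
    proof -
      have "P i = (\<Sum>j\<in>B. if i = j then F j else 0)"
        unfolding P_def by (intro sum.cong refl) (simp add: delta_def)
      then show ?thesis using B by simp
    qed
    define R where "R = (\<lambda>i. 1 * F i + (-1) * P i)"
    have R: "R \<in> S" unfolding R_def by (intro comb F P)
    have R_eq: "cmod (R i) * w i = (if i \<in> - B then cmod (F i) * w i else 0)" for i
      by (simp add: R_def P_eq)
    have sB: "(\<lambda>i. cmod (F i) * w i) summable_on (- B)"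
      by (rule summable_on_subset_banach[OF F(2)]) auto
    have sR: "(\<lambda>i. cmod (R i) * w i) summable_on UNIV"
      unfolding R_eq using sB by (subst summable_on_cong_neutral[where T = "- B" and g = "\<lambda>i. cmod (F i) * w i"]) auto
    have "(\<Sum>\<^sub>\<infinity>i. cmod (R i) * w i) = (\<Sum>\<^sub>\<infinity>i\<in>-B. cmod (F i) * w i)"
      unfolding R_eq by (rule infsum_cong_neutral) auto
    also have "\<dots> = N - (\<Sum>j\<in>B. cmod (F j) * w j)"
      unfolding N_def using infsum_Un_disjoint[OF summable_on_finite[OF B] sB] B by simp
    finally have "cmod (T R k) \<le> (N - (\<Sum>j\<in>B. cmod (F j) * w j)) / e"
      using map_bound[OF e c R sR w] by simp
    moreover have "F = (\<lambda>i. P i + R i)" by (simp add: R_def)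
    then have "T F k = T P k + T R k" using add[OF P(1) R] by simp
    ultimately show ?thesis using P(2) by (simp add: norm_minus_commute)
  qed
  have "((\<lambda>i. cmod (F i) * w i) has_sum N) UNIV" unfolding N_def by (rule has_sum_infsum[OF F(2)])
  then have lim: "((\<lambda>B. (N - (\<Sum>j\<in>B. cmod (F j) * w j)) / e) \<longlongrightarrow> (N - N) / e) (finite_subsets_at_top UNIV)"
    unfolding has_sum_def by (intro tendsto_intros) (use e in auto)
  have "((\<lambda>B. (\<Sum>j\<in>B. T (delta j) k * F j) - T F k) \<longlongrightarrow> 0) (finite_subsets_at_top UNIV)"
    by (rule Lim_null_comparison[OF eventually_finite_subsets_at_top_weakI])
      (use bound lim in auto)
  then show ?thesis unfolding has_sum_def by (rule LIM_zero_cancel)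
qed

end

section \<open>Kernel bounds from continuity\<close>

context weights
begin

lemma delta_in_proj: "delta j \<in> topspace proj"
  unfolding topspace_proj
  by (intro INT_I lp_in_topspaceI[OF p pos'] summable_delta)

lemma delta_in_ind: "delta j \<in> topspace ind"
  unfolding topspace_ind
  by (rule UN_I[of 1]) (auto intro!: lp_in_topspaceI[OF p pos] summable_delta)

lemma linear_on_proj: "linear_continuous proj Y T \<Longrightarrow> linear_on (topspace proj) T"
  unfolding linear_continuous_def
  by unfold_locales (auto intro: combination_in_proj delta_in_proj)

lemma linear_on_ind: "linear_continuous ind Y T \<Longrightarrow> linear_on (topspace ind) T"
  unfolding linear_continuous_def
  by unfold_locales (auto intro: combination_in_ind delta_in_ind)

lemma proj_preimage:
  assumes T: "linear_continuous proj Y T" and W: "openin Y W" "(\<lambda>i. 0) \<in> W"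
  shows "\<exists>r>0. \<exists>e>0. \<forall>G\<in>topspace proj. (\<lambda>i. cmod (G i) * (1 / \<theta> r i)) summable_on UNIV \<longrightarrow>
     (\<Sum>\<^sub>\<infinity>i. cmod (G i) * (1 / \<theta> r i)) < e \<longrightarrow> T G \<in> W"
proof -
  interpret linear_on "topspace proj" T by (rule linear_on_proj[OF T])
  have "openin proj {x \<in> topspace proj. T x \<in> W}"
    using T W(1) unfolding linear_continuous_def continuous_map_def by blast
  moreover have "(\<lambda>i. 0) \<in> {x \<in> topspace proj. T x \<in> W}"
    using zero_mem map_zero W(2) by simp
  ultimately show ?thesis using proj_nhd[of "{x \<in> topspace proj. T x \<in> W}" "\<lambda>i. 0"]
    by simp blast
qed

lemma ind_preimage:
  assumes T: "linear_continuous ind Y T" and W: "openin Y W" "(\<lambda>i. 0) \<in> W" and r: "0 < r"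
  shows "\<exists>e>0. \<forall>G. (\<lambda>i. cmod (G i) * \<theta> r i) summable_on UNIV \<longrightarrow>
     (\<Sum>\<^sub>\<infinity>i. cmod (G i) * \<theta> r i) < e \<longrightarrow> T G \<in> W"
proof -
  interpret linear_on "topspace ind" T by (rule linear_on_ind[OF T])
  have "openin ind {x \<in> topspace ind. T x \<in> W}"
    using T W(1) unfolding linear_continuous_def continuous_map_def by blast
  moreover have "(\<lambda>i. 0) \<in> {x \<in> topspace ind. T x \<in> W}"
    using zero_mem map_zero W(2) by simp
  ultimately show ?thesis using ind_nhd[OF _ _ r, of "{x \<in> topspace ind. T x \<in> W}"]
    by simp blast
qed

lemma ind_seminorm_ball:
  assumes v: "\<And>i. 0 \<le> v i" "\<And>r. 0 < r \<Longrightarrow> \<exists>C. \<forall>i. v i \<le> C * \<theta> r i"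
  obtains W where "openin ind W" "(\<lambda>i. 0) \<in> W" "\<And>F i. F \<in> W \<Longrightarrow> cmod (F i) * v i \<le> 1"
proof
  show "openin ind (sup_ball ind v)"
    by (rule ind_open_sup[OF v])
  show "(\<lambda>i. 0) \<in> sup_ball ind v"
    unfolding topspace_ind using zero_in_weighted[of 1] by (auto intro!: exI[of _ "1::real"] bexI[of _ "1::real"])
  fix F i assume "F \<in> sup_ball ind v"
  then obtain e where "e > 0" "cmod (F i) * v i \<le> 1 - e" by blast
  then show "cmod (F i) * v i \<le> 1" by simp
qed

lemma proj_seminorm_ball:
  assumes r: "0 < r"
  obtains W where "openin proj W" "(\<lambda>i. 0) \<in> W" "\<And>F i. F \<in> W \<Longrightarrow> cmod (F i) \<le> \<theta> r i"
proof
  show "openin proj (sup_ball proj (\<lambda>i. 1 / \<theta> r i))"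
    by (rule proj_open_sup[OF r])
  show "(\<lambda>i. 0) \<in> sup_ball proj (\<lambda>i. 1 / \<theta> r i)"
    using combination_in_proj[OF delta_in_proj delta_in_proj, of 0 undefined 0 undefined]
    by (auto intro!: exI[of _ "1::real"])
  fix F i assume "F \<in> sup_ball proj (\<lambda>i. 1 / \<theta> r i)"
  then obtain e where "e > 0" "cmod (F i) * (1 / \<theta> r i) \<le> 1 - e" by blast
  then have "cmod (F i) / \<theta> r i \<le> 1" by simp
  then show "cmod (F i) \<le> \<theta> r i" using pos[of r i] by simp
qed

lemma proj_to_ind_expansion:
  assumes T: "linear_continuous proj ind T" and F: "F \<in> topspace proj"
  shows "((\<lambda>j. T (delta j) k * F j) has_sum T F k) UNIV"
proof -
  interpret linear_on "topspace proj" T by (rule linear_on_proj[OF T])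
  \<comment> \<open>The weight supported at the single index k is dominated by every
    \<open>\<theta> r\<close>, so the k-th coordinate is a continuous functional on the inductive
    limit.\<close>
  have "\<exists>C. \<forall>i. (if i = k then 1 else 0) \<le> C * \<theta> r i" if "0 < r" for r
    using pos[of r k] nonneg[of r] by (intro exI[of _ "1 / \<theta> r k"]) auto
  moreover have "0 \<le> (if i = k then 1 else (0::real))" for i by simp
  ultimately obtain W where W: "openin ind W" "(\<lambda>i. 0) \<in> W"
      "\<And>F i. F \<in> W \<Longrightarrow> cmod (F i) * (if i = k then 1 else 0) \<le> 1"
    using ind_seminorm_ball[of "\<lambda>i. if i = k then 1 else 0"] by blast
  obtain r e where re: "0 < r" "0 < e" "\<And>G. G \<in> topspace proj \<Longrightarrow>
      (\<lambda>i. cmod (G i) * (1 / \<theta> r i)) summable_on UNIV \<Longrightarrow>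
      (\<Sum>\<^sub>\<infinity>i. cmod (G i) * (1 / \<theta> r i)) < e \<Longrightarrow> T G \<in> W"
    using proj_preimage[OF T W(1,2)] by blast
  have "cmod (T G k) \<le> 1" if "G \<in> topspace proj" "(\<lambda>i. cmod (G i) * (1 / \<theta> r i)) summable_on UNIV"
      "(\<Sum>\<^sub>\<infinity>i. cmod (G i) * (1 / \<theta> r i)) < e" for G
    using W(3)[OF re(3)[OF that], of k] by simp
  from expansion[OF re(2) this F proj_l1[OF F re(1)] less_imp_le[OF pos']] show ?thesis .
qed

lemma ind_to_proj_expansion:
  assumes T: "linear_continuous ind proj T" and F: "F \<in> topspace ind"
  shows "((\<lambda>j. T (delta j) k * F j) has_sum T F k) UNIV"
proof -
  interpret linear_on "topspace ind" T by (rule linear_on_ind[OF T])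
  obtain r where r: "0 < r" and sF: "(\<lambda>i. cmod (F i) * \<theta> r i) summable_on UNIV"
    using ind_l1[OF F] by blast
  obtain W where W: "openin proj W" "(\<lambda>i. 0) \<in> W" "\<And>F i. F \<in> W \<Longrightarrow> cmod (F i) \<le> \<theta> r i"
    using proj_seminorm_ball[OF r] by blast
  obtain e where e: "0 < e" "\<And>G. (\<lambda>i. cmod (G i) * \<theta> r i) summable_on UNIV \<Longrightarrow>
      (\<Sum>\<^sub>\<infinity>i. cmod (G i) * \<theta> r i) < e \<Longrightarrow> T G \<in> W"
    using ind_preimage[OF T W(1,2) r] by blast
  \<comment> \<open>On W the k-th coordinate is bounded by \<open>\<theta> r k\<close> instead of 1;
    dividing the radius by this number normalises it.\<close>
  have "cmod (T G k) \<le> 1" if G: "G \<in> topspace ind" "(\<lambda>i. cmod (G i) * \<theta> r i) summable_on UNIV"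
      "(\<Sum>\<^sub>\<infinity>i. cmod (G i) * \<theta> r i) < e / \<theta> r k" for G
  proof -
    let ?G = "\<lambda>i. complex_of_real (\<theta> r k) * G i"
    have eq: "(\<lambda>i. cmod (?G i) * \<theta> r i) = (\<lambda>i. \<theta> r k * (cmod (G i) * \<theta> r i))"
      using pos by (simp add: norm_mult abs_of_pos mult.assoc)
    have "(\<lambda>i. cmod (?G i) * \<theta> r i) summable_on UNIV"
      unfolding eq by (intro summable_on_cmult_right G)
    moreover have "(\<Sum>\<^sub>\<infinity>i. cmod (?G i) * \<theta> r i) < e"
      unfolding eq infsum_cmult_right' using G(3) pos[of r k] by (simp add: field_simps)
    ultimately have "cmod (T ?G k) \<le> \<theta> r k" by (intro W(3) e(2))
    then show ?thesis using pos[of r k] by (simp add: scale[OF G(1)] norm_mult)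
  qed
  from expansion[OF divide_pos_pos[OF e(1) pos] this F sF nonneg] show ?thesis .
qed

text \<open>The seminorm of the target and the ball of the domain are both at disposal for every
  parameter, so one r can serve rows and columns at once.\<close>

lemma ind_to_proj_kernel:
  assumes T: "linear_continuous ind proj T" and r: "0 < r"
  shows "\<exists>C. \<forall>i j. cmod (T (delta j) i) \<le> C * \<theta> r i * \<theta> r j"
proof -
  interpret linear_on "topspace ind" T by (rule linear_on_ind[OF T])
  obtain W where W: "openin proj W" "(\<lambda>i. 0) \<in> W" "\<And>F i. F \<in> W \<Longrightarrow> cmod (F i) \<le> \<theta> r i"
    using proj_seminorm_ball[OF r] by blast
  obtain e where e: "0 < e" "\<And>G. (\<lambda>i. cmod (G i) * \<theta> r i) summable_on UNIV \<Longrightarrow>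
      (\<Sum>\<^sub>\<infinity>i. cmod (G i) * \<theta> r i) < e \<Longrightarrow> T G \<in> W"
    using ind_preimage[OF T W(1,2) r] by blast
  have "cmod (T (delta j) i) \<le> 2 / e * \<theta> r i * \<theta> r j" for i j
  proof -
    \<comment> \<open>Chosen so that the test element t e_j has weighted norm e/2, safely inside the
      ball.\<close>
    define t where "t = e / (2 * \<theta> r j)"
    have t: "t > 0" using e(1) pos by (simp add: t_def)
    let ?G = "\<lambda>i. complex_of_real t * delta j i"
    have eq: "(\<lambda>i. cmod (?G i) * \<theta> r i) = (\<lambda>i. t * (cmod (delta j i) * \<theta> r i))"
      using t by (simp add: norm_mult mult.assoc)
    have "(\<lambda>i. cmod (?G i) * \<theta> r i) summable_on UNIV"
      unfolding eq by (intro summable_on_cmult_right summable_delta)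
    moreover have "(\<Sum>\<^sub>\<infinity>i. cmod (?G i) * \<theta> r i) < e"
      unfolding eq infsum_cmult_right' infsum_delta using pos[of r j] e(1) by (simp add: t_def)
    ultimately have "cmod (T ?G i) \<le> \<theta> r i" by (intro W(3) e(2))
    then have "t * cmod (T (delta j) i) \<le> \<theta> r i"
      using t by (simp add: scale[OF delta] norm_mult)
    then show ?thesis using e(1) pos[of r j] by (simp add: t_def field_simps)
  qed
  then show ?thesis by blast
qed

text \<open>If no single \<open>r\<close> works, pick violating pairs \<open>(a n, b n)\<close> along the cofinal sequence; the
  weight \<open>v\<close> supported on the \<open>a n\<close> is dominated by every \<open>\<theta> r\<close>, so its unit ball is a
  neighbourhood of \<open>0\<close> in the inductive limit, whose preimage yields a contradiction.\<close>

lemma proj_to_ind_kernel: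
  assumes T: "linear_continuous proj ind T"
  shows "\<exists>r>0. \<exists>C. \<forall>i j. cmod (T (delta j) i) * \<theta> r i * \<theta> r j \<le> C"
proof (rule ccontr)
  assume no: "\<not> ?thesis"
  interpret linear_on "topspace proj" T by (rule linear_on_proj[OF T])
  obtain \<rho> where \<rho>: "\<And>n::nat. 0 < \<rho> n" "\<And>r. 0 < r \<Longrightarrow> \<exists>N. \<forall>n\<ge>N. \<forall>i. \<theta> (\<rho> n) i \<le> \<theta> r i"
    using cofinal by auto
  have "\<exists>i j. real n < cmod (T (delta j) i) * \<theta> (\<rho> n) i * \<theta> (\<rho> n) j" for n
    using no \<rho>(1)[of n] by (meson not_le)
  then obtain a b where ab: "\<And>n. real n < cmod (T (delta (b n)) (a n)) * \<theta> (\<rho> n) (a n) * \<theta> (\<rho> n) (b n)"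
    by metis
  obtain N0 where N0: "\<And>n i. n \<ge> N0 \<Longrightarrow> \<theta> (\<rho> n) i \<le> \<theta> 1 i" using \<rho>(2)[of 1] by auto
  \<comment> \<open>Several n may share the same first index, hence the supremum over the fibre of
    \<open>a\<close>. Discarding n < N0 bounds all weights in it by \<open>\<theta> 1 i\<close>, so
    the supremum is finite.\<close>
  define B where "B i = {n. n \<ge> N0 \<and> a n = i}" for i
  define v where "v i = (if B i = {} then 0 else SUP n\<in>B i. \<theta> (\<rho> n) i)" for i
  have bdd: "bdd_above ((\<lambda>n. \<theta> (\<rho> n) i) ` B i)" for i
    using N0 by (auto simp: B_def bdd_above_def)
  have v0: "0 \<le> v i" for i
  proof (cases "B i = {}")
    case False
    then obtain n where "n \<in> B i" by blast
    then have "\<theta> (\<rho> n) i \<le> v i" using False cSUP_upper[OF _ bdd] by (simp add: v_def)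
    then show ?thesis using nonneg order_trans by blast
  qed (simp add: v_def)
  have vC: "\<exists>C. \<forall>i. v i \<le> C * \<theta> r i" if r: "0 < r" for r
  proof -
    obtain N where N: "\<And>n i. n \<ge> N \<Longrightarrow> \<theta> (\<rho> n) i \<le> \<theta> r i" using \<rho>(2)[OF r] by auto
    \<comment> \<open>For n \<ge> N the weight already lies below \<open>\<theta> r\<close>; the
      finitely many earlier n are absorbed into the constant, each at its single index
      \<open>a n\<close>.\<close>
    define C where "C = 1 + (\<Sum>n<N. \<theta> (\<rho> n) (a n) / \<theta> r (a n))"
    have C1: "1 \<le> C" unfolding C_def by (simp add: sum_nonneg nonneg)
    have "v i \<le> C * \<theta> r i" for i
    proof (cases "B i = {}")
      case True then show ?thesis using C1 nonneg[of r i] by (simp add: v_def)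
    next
      case False
      have "\<theta> (\<rho> n) i \<le> C * \<theta> r i" if "n \<in> B i" for n
      proof (cases "n < N")
        case True
        have "\<theta> (\<rho> n) (a n) / \<theta> r (a n) \<le> C"
          unfolding C_def using True
          by (intro add_increasing member_le_sum[of n "{..<N}" "\<lambda>n. \<theta> (\<rho> n) (a n) / \<theta> r (a n)"])
            (auto simp: nonneg)
        then show ?thesis using that pos[of r "a n"] by (simp add: B_def field_simps)
      next
        case False
        then have "\<theta> (\<rho> n) i \<le> \<theta> r i" by (intro N) simp
        also have "\<dots> \<le> C * \<theta> r i" using mult_right_mono[OF C1 nonneg, of r i] by simp
        finally show ?thesis .
      qed
      then show ?thesis using False by (auto simp: v_def intro!: cSUP_least)
    qed
    then show ?thesis by blast
  qed
  obtain W where W: "openin ind W" "(\<lambda>i. 0) \<in> W" "\<And>F i. F \<in> W \<Longrightarrow> cmod (F i) * v i \<le> 1"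
    using ind_seminorm_ball[OF v0 vC] by blast
  obtain r e where re: "0 < r" "0 < e" "\<And>G. G \<in> topspace proj \<Longrightarrow>
      (\<lambda>i. cmod (G i) * (1 / \<theta> r i)) summable_on UNIV \<Longrightarrow>
      (\<Sum>\<^sub>\<infinity>i. cmod (G i) * (1 / \<theta> r i)) < e \<Longrightarrow> T G \<in> W"
    using proj_preimage[OF T W(1,2)] by blast
  have bound: "cmod (T (delta j) i) * v i * \<theta> r j \<le> 2 / e" for i j
  proof -
    \<comment> \<open>The domain now carries the inverse weight, so this t makes the norm of t e_j
      equal to e/2.\<close>
    define t where "t = e / 2 * \<theta> r j"
    have t: "t > 0" using re(2) pos by (simp add: t_def)
    let ?G = "\<lambda>i. complex_of_real t * delta j i"
    have eq: "(\<lambda>i. cmod (?G i) * (1 / \<theta> r i)) = (\<lambda>i. t * (cmod (delta j i) * (1 / \<theta> r i)))"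
      using t by (simp add: norm_mult mult.assoc)
    have "(\<lambda>i. cmod (?G i) * (1 / \<theta> r i)) summable_on UNIV"
      unfolding eq by (intro summable_on_cmult_right summable_delta)
    moreover have "(\<Sum>\<^sub>\<infinity>i. cmod (?G i) * (1 / \<theta> r i)) < e"
      unfolding eq infsum_cmult_right' infsum_delta using pos[of r j] re(2) by (simp add: t_def)
    ultimately have "cmod (T ?G i) * v i \<le> 1" by (intro W(3) re(3) scale_mem delta)
    then have "t * cmod (T (delta j) i) * v i \<le> 1"
      using t by (simp add: scale[OF delta] norm_mult)
    then show ?thesis using re(2) by (simp add: t_def field_simps)
  qed
  obtain N where N: "\<And>n i. n \<ge> N \<Longrightarrow> \<theta> (\<rho> n) i \<le> \<theta> r i" using \<rho>(2)[OF re(1)] by auto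
  \<comment> \<open>Beyond N the weight at \<open>b n\<close> may be replaced by
    \<open>\<theta> r\<close>, beyond N0 the weight at \<open>a n\<close> is at most
    \<open>v\<close>, and n > 2/e contradicts the uniform bound.\<close>
  obtain n where n: "n \<ge> N" "n \<ge> N0" "real n > 2 / e"
  proof -
    obtain m where "real m > 2 / e" using reals_Archimedean2 by blast
    then show thesis by (intro that[of "max m (max N N0)"]) auto
  qed
  have mem: "n \<in> B (a n)" using n by (simp add: B_def)
  then have va: "\<theta> (\<rho> n) (a n) \<le> v (a n)" using cSUP_upper[OF _ bdd, of n "a n"] by (auto simp: v_def)
  have "real n < cmod (T (delta (b n)) (a n)) * \<theta> (\<rho> n) (a n) * \<theta> (\<rho> n) (b n)" by (rule ab)
  also have "\<dots> \<le> cmod (T (delta (b n)) (a n)) * v (a n) * \<theta> r (b n)"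
    by (intro mult_mono va N n mult_nonneg_nonneg nonneg v0) auto
  also have "\<dots> \<le> 2 / e" by (rule bound)
  finally show False using n(3) by simp
qed

end

section \<open>Sums over multi-indices\<close>

lemma has_sum_prod_vec:
  fixes f :: "'d::finite \<Rightarrow> 'b::countable \<Rightarrow> 'c::{real_normed_field,banach,second_countable_topology}"
  assumes f: "\<And>j. (\<lambda>n. norm (f j n)) summable_on UNIV"
  shows summable_prod_vec: "(\<lambda>\<alpha>::'b^'d. norm (\<Prod>j\<in>UNIV. f j (\<alpha> $ j))) summable_on UNIV"
    and "((\<lambda>\<alpha>::'b^'d. \<Prod>j\<in>UNIV. f j (\<alpha> $ j)) has_sum (\<Prod>j\<in>UNIV. infsum (f j) UNIV)) UNIV"
proof -
  have P: "PiE (UNIV::'d set) (\<lambda>_. UNIV :: 'b set) = UNIV" by auto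
  have bij: "bij_betw vec_lambda (UNIV :: ('d \<Rightarrow> 'b) set) UNIV"
    by (rule bij_betwI[where g = vec_nth]) auto
  have s: "(\<lambda>g. norm (\<Prod>j\<in>UNIV. f j (g j))) summable_on (UNIV :: ('d \<Rightarrow> 'b) set)"
  proof -
    have "Infinite_Set_Sum.abs_summable_on (\<lambda>g. \<Prod>j\<in>UNIV. f j (g j)) (PiE (UNIV::'d set) (\<lambda>_. UNIV :: 'b set))"
      using f by (intro abs_summable_on_prod_PiE) (auto simp: abs_summable_equivalent[symmetric])
    then show ?thesis unfolding P abs_summable_equivalent[symmetric] .
  qed
  then show sv: "(\<lambda>\<alpha>::'b^'d. norm (\<Prod>j\<in>UNIV. f j (\<alpha> $ j))) summable_on UNIV"
    using summable_on_reindex_bij_betw[OF bij, of "\<lambda>\<alpha>. norm (\<Prod>j\<in>UNIV. f j (\<alpha> $ j))"] by simp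
  have "infsum (\<lambda>g. \<Prod>j\<in>UNIV. f j (g j)) UNIV = (\<Prod>j\<in>UNIV. infsum (f j) UNIV)"
    using infsum_prod_PiE_abs[of "UNIV :: 'd set" f "\<lambda>_. UNIV"] f unfolding P by simp
  then have "infsum (\<lambda>\<alpha>::'b^'d. \<Prod>j\<in>UNIV. f j (\<alpha> $ j)) UNIV = (\<Prod>j\<in>UNIV. infsum (f j) UNIV)"
    using infsum_reindex_bij_betw[OF bij, of "\<lambda>\<alpha>. (\<Prod>j\<in>UNIV. f j (\<alpha> $ j))"] by simp
  with has_sum_infsum[OF abs_summable_summable[OF sv]]
  show "((\<lambda>\<alpha>::'b^'d. \<Prod>j\<in>UNIV. f j (\<alpha> $ j)) has_sum (\<Prod>j\<in>UNIV. infsum (f j) UNIV)) UNIV" by simp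
qed

lemma exp_has_sum:
  fixes x :: "'c::{real_normed_field,banach}"
  shows "((\<lambda>n. x ^ n / fact n) has_sum exp x) UNIV"
  using norm_summable_imp_has_sum[OF summable_norm_exp[of x] exp_converges[of x]]
  by (simp add: scaleR_conv_of_real divide_inverse mult.commute of_real_inverse)

lemma has_sum_exp_sum:
  fixes x :: "'d::finite \<Rightarrow> 'c::{real_normed_field,banach,second_countable_topology}"
  shows "((\<lambda>\<alpha>::nat^'d. \<Prod>j\<in>UNIV. x j ^ (\<alpha> $ j) / fact (\<alpha> $ j)) has_sum exp (\<Sum>j\<in>UNIV. x j)) UNIV"
proof -
  have "(\<lambda>n. norm (x j ^ n / fact n)) summable_on UNIV" for j
    using has_sum_imp_summable[OF exp_has_sum[of "norm (x j)"]]
    by (simp add: norm_divide norm_power)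
  from has_sum_prod_vec(2)[of "\<lambda>j n. x j ^ n / fact n", OF this]
  show ?thesis by (simp add: infsumI[OF exp_has_sum] exp_sum)
qed

lemma power_mi_abs: "(q::'c::comm_monoid_mult) ^ mi_abs \<alpha> = (\<Prod>j\<in>UNIV. q ^ (\<alpha> $ j))"
  by (simp add: mi_abs_def power_sum)

lemma norm_e_mono: "cmod (e_mono \<alpha> z) = (\<Prod>j\<in>UNIV. cmod (z $ j) ^ (\<alpha> $ j)) / sqrt (mi_fact \<alpha>)"
  by (simp add: e_mono_def norm_divide norm_power prod_norm[symmetric])

lemma norm_e_mono_sq:
  "(cmod (e_mono \<alpha> z))\<^sup>2 = (\<Prod>j\<in>UNIV. ((cmod (z $ j))\<^sup>2) ^ (\<alpha> $ j) / fact (\<alpha> $ j))"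
proof -
  have "(sqrt (mi_fact \<alpha>))\<^sup>2 = (\<Prod>j\<in>UNIV. fact (\<alpha> $ j))"
    by (simp add: mi_fact_def prod_nonneg)
  then show ?thesis
    unfolding norm_e_mono power_divide
    by (simp add: prod_dividef prod_power_distrib power_mult[symmetric] mult.commute)
qed

lemma norm_vec_sq: "(norm (z :: complex^'d))\<^sup>2 = (\<Sum>j\<in>UNIV. (cmod (z $ j))\<^sup>2)"
  by (simp add: norm_vec_def L2_set_def sum_nonneg)

lemma has_sum_e_mono_sq:
  "((\<lambda>\<alpha>. q ^ mi_abs \<alpha> * (cmod (e_mono \<alpha> z))\<^sup>2) has_sum exp (q * (norm z)\<^sup>2)) UNIV"
proof -
  have "q ^ mi_abs \<alpha> * (cmod (e_mono \<alpha> z))\<^sup>2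
     = (\<Prod>j\<in>UNIV. (q * (cmod (z $ j))\<^sup>2) ^ (\<alpha> $ j) / fact (\<alpha> $ j))" for \<alpha>
    by (simp add: power_mi_abs norm_e_mono_sq prod.distrib[symmetric] power_mult_distrib)
  then show ?thesis
    using has_sum_exp_sum[of "\<lambda>j. q * (cmod (z $ j))\<^sup>2"]
    by (simp add: norm_vec_sq sum_distrib_left)
qed

lemma Cauchy_Schwarz_infsum:
  fixes f g :: "'i \<Rightarrow> real"
  assumes "\<And>i. 0 \<le> f i" "\<And>i. 0 \<le> g i"
    and f: "(\<lambda>i. (f i)\<^sup>2) summable_on UNIV" and g: "(\<lambda>i. (g i)\<^sup>2) summable_on UNIV"
  shows "(\<lambda>i. f i * g i) summable_on UNIV"
    and "(\<Sum>\<^sub>\<infinity>i. f i * g i)\<^sup>2 \<le> (\<Sum>\<^sub>\<infinity>i. (f i)\<^sup>2) * (\<Sum>\<^sub>\<infinity>i. (g i)\<^sup>2)"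
proof -
  let ?A = "(\<Sum>\<^sub>\<infinity>i. (f i)\<^sup>2)" and ?B = "(\<Sum>\<^sub>\<infinity>i. (g i)\<^sup>2)"
  have fin: "(\<Sum>i\<in>F. f i * g i) \<le> sqrt (?A * ?B)" if "finite F" for F
  proof -
    have "(\<Sum>i\<in>F. f i * g i)\<^sup>2 \<le> (\<Sum>i\<in>F. (f i)\<^sup>2) * (\<Sum>i\<in>F. (g i)\<^sup>2)"
      by (rule Cauchy_Schwarz_ineq_sum)
    also have "\<dots> \<le> ?A * ?B"
      using that by (intro mult_mono finite_sum_le_infsum f g sum_nonneg infsum_nonneg) auto
    finally show ?thesis by (rule real_le_rsqrt)
  qed
  show s: "(\<lambda>i. f i * g i) summable_on UNIV"
    by (rule nonneg_bdd_above_summable_on) (use assms fin in \<open>auto simp: bdd_above_def\<close>)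
  have "(\<Sum>\<^sub>\<infinity>i. f i * g i) \<le> sqrt (?A * ?B)"
    by (rule infsum_le_finite_sums[OF s]) (use fin in auto)
  then have "(\<Sum>\<^sub>\<infinity>i. f i * g i)\<^sup>2 \<le> (sqrt (?A * ?B))\<^sup>2"
    by (intro power_mono infsum_nonneg) (use assms in auto)
  then show "(\<Sum>\<^sub>\<infinity>i. f i * g i)\<^sup>2 \<le> ?A * ?B"
    by (simp add: infsum_nonneg)
qed

lemma nat_le_mi_abs: "\<alpha> $ j \<le> mi_abs \<alpha>"
  unfolding mi_abs_def by (rule member_le_sum) auto

lemma vartheta_pos: "0 < vartheta r s \<alpha>" by (simp add: vartheta_def)

text \<open>A negative exponent times any positive power of |\<alpha>| beats every polynomial, so
  the weight is dominated by a product of one-dimensional summable factors.\<close>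

lemma vartheta_summable:
  assumes "r < 0" "0 < s"
  shows "(vartheta r s :: nat ^ 'd::finite \<Rightarrow> real) summable_on UNIV"
proof -
  define \<sigma> where "\<sigma> = 1 / (2 * s)"
  have \<sigma>: "0 < \<sigma>" using assms by (simp add: \<sigma>_def)
  \<comment> \<open>Each of the d factors (1 + \<alpha>_j)^2 is at most (1 + |\<alpha>|)^2, which
    gives the exponent 2d.\<close>
  define k where "k = 2 * real CARD('d)"
  have "(\<lambda>n::nat. exp (r * real n powr \<sigma>) * (1 + real n) powr k) \<longlonglongrightarrow> 0"
    using assms(1) \<sigma> by real_asymp
  then have "Bseq (\<lambda>n::nat. exp (r * real n powr \<sigma>) * (1 + real n) powr k)"
    by (intro convergent_imp_Bseq convergentI)
  then obtain C where C: "0 < C" "\<And>n::nat. exp (r * real n powr \<sigma>) * (1 + real n) powr k \<le> C"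
    unfolding Bseq_def by auto
  have le: "vartheta r s \<alpha> \<le> C * (\<Prod>j\<in>UNIV. 1 / (1 + real (\<alpha> $ j))\<^sup>2)" for \<alpha> :: "nat^'d"
  proof -
    let ?n = "mi_abs \<alpha>"
    have "(\<Prod>j\<in>UNIV. (1 + real (\<alpha> $ j))\<^sup>2) \<le> (\<Prod>j\<in>(UNIV::'d set). (1 + real ?n)\<^sup>2)"
      using nat_le_mi_abs[of \<alpha>] by (intro prod_mono) (auto intro!: power_mono)
    also have "\<dots> = (1 + real ?n) powr k"
      using powr_realpow[of "1 + real ?n" "2 * CARD('d)"] by (simp add: k_def power_mult)
    finally have "vartheta r s \<alpha> * (\<Prod>j\<in>UNIV. (1 + real (\<alpha> $ j))\<^sup>2)
       \<le> vartheta r s \<alpha> * (1 + real ?n) powr k"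
      by (intro mult_left_mono) (auto simp: vartheta_def)
    also have "\<dots> \<le> C" using C(2)[of ?n] by (simp add: vartheta_def \<sigma>_def)
    finally show ?thesis
      by (simp add: prod_dividef field_simps prod_pos)
  qed
  have "(\<lambda>n. norm (1 / (1 + real n)\<^sup>2)) summable_on UNIV"
  proof -
    have "summable (\<lambda>n. 1 / (1 + real n)\<^sup>2)"
      using summable_Suc_iff[THEN iffD2, OF inverse_power_summable[of 2, where 'a = real]]
      by (simp add: inverse_eq_divide)
    then show ?thesis by (intro summable_on_UNIV_nonneg_real_iff[THEN iffD2]) auto
  qed
  from summable_on_cmult_right[OF summable_prod_vec[of "\<lambda>_::'d. \<lambda>n. 1 / (1 + real n)\<^sup>2", OF this], of C]
  have "(\<lambda>\<alpha>::nat^'d. C * (\<Prod>j\<in>UNIV. 1 / (1 + real (\<alpha> $ j))\<^sup>2)) summable_on UNIV"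
    by (simp add: abs_of_nonneg prod_nonneg)
  then show ?thesis
    by (rule summable_on_comparison_test) (use le vartheta_pos[of r s] in \<open>auto intro: less_imp_le\<close>)
qed

section \<open>Growth of weighted sums of the basis functions\<close>

definition wsum :: "real \<Rightarrow> real \<Rightarrow> complex ^ 'd::finite \<Rightarrow> real" where
  "wsum r s z = (\<Sum>\<^sub>\<infinity>\<alpha>. vartheta r s \<alpha> * cmod (e_mono \<alpha> z))"

abbreviation wsum_sq :: "real \<Rightarrow> real \<Rightarrow> complex ^ 'd::finite \<Rightarrow> real" where
  "wsum_sq r s z \<equiv> (\<Sum>\<^sub>\<infinity>\<alpha>. vartheta r s \<alpha> * (cmod (e_mono \<alpha> z))\<^sup>2)"

abbreviation gauss_weight :: "real \<Rightarrow> real \<Rightarrow> complex ^ 'd::finite \<Rightarrow> real" where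
  "gauss_weight s x z \<equiv> exp ((norm z)\<^sup>2 / 2 + x * norm z powr (1 / s))"

text \<open>A dictionary entry: coefficients of size \<open>vartheta r s\<close> produce growth of
  order exp(|z|^2/2 + x |z|^(1/s)). The \<open>itself\<close> argument fixes the dimension, which
  otherwise occurs only in a bound variable.\<close>

definition growth_le :: "'d::finite itself \<Rightarrow> real \<Rightarrow> real \<Rightarrow> real \<Rightarrow> bool" where
  "growth_le (t :: 'd itself) s r x \<longleftrightarrow>
     (\<exists>C. \<forall>z::complex^'d. wsum r s z \<le> C * gauss_weight s x z)"

lemma powr_le_one_plus: "x powr \<sigma> \<le> 1 + x" if "0 \<le> x" "0 < \<sigma>" "\<sigma> \<le> 1" for x \<sigma> :: real
proof (cases "x \<le> 1")
  case True
  then have "x powr \<sigma> \<le> 1 powr \<sigma>" using that by (intro powr_mono2) auto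
  then show ?thesis using that by simp
next
  case False
  then have "x powr \<sigma> \<le> x powr 1" using that by (intro powr_mono) auto
  then show ?thesis using False by simp
qed

text \<open>Used with \<sigma> = 1/(2s) < 1 and t either |z|^2 or a degree |\<alpha>|: an arbitrary
  multiple of t^\<sigma> is absorbed by an arbitrarily small multiple of t.\<close>

lemma powr_sublinear:
  fixes \<sigma> k e :: real
  assumes "0 < \<sigma>" "\<sigma> < 1" "0 < e"
  shows "\<exists>C\<ge>0. \<forall>t\<ge>0. k * t powr \<sigma> \<le> e * t + C"
proof -
  \<comment> \<open>Replacing k, whose sign is arbitrary, by a strictly positive majorant settles
    the asymptotics uniformly.\<close>
  define K where "K = \<bar>k\<bar> + 1"
  have "0 < K" by (simp add: K_def)
  then have "\<forall>\<^sub>F t in at_top. K * t powr \<sigma> - e * t \<le> 1"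
    using assms by real_asymp
  then obtain T where T: "\<And>t. t \<ge> T \<Longrightarrow> K * t powr \<sigma> - e * t \<le> 1"
    unfolding eventually_at_top_linorder by blast
  have "k * t powr \<sigma> \<le> e * t + (1 + K * \<bar>T\<bar> powr \<sigma>)" if "0 \<le> t" for t
  proof -
    have k: "k * t powr \<sigma> \<le> K * t powr \<sigma>" by (intro mult_right_mono) (auto simp: K_def)
    show ?thesis
    proof (cases "t \<ge> T")
      case True
      then show ?thesis using T[of t] k \<open>0 < K\<close> by (smt (verit) mult_nonneg_nonneg powr_ge_zero)
    next
      case False
      then have "t powr \<sigma> \<le> \<bar>T\<bar> powr \<sigma>" using that assms by (intro powr_mono2) auto
      then have "K * t powr \<sigma> \<le> K * \<bar>T\<bar> powr \<sigma>" by (intro mult_left_mono) (auto simp: K_def)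
      then show ?thesis using k that assms by (smt (verit) mult_nonneg_nonneg)
    qed
  qed
  then show ?thesis by (intro exI[of _ "1 + K * \<bar>T\<bar> powr \<sigma>"]) (use \<open>0 < K\<close> in auto)
qed

lemma norm_sq_powr: "(norm z)\<^sup>2 powr (1 / (2 * s)) = norm z powr (1 / s)" if "0 < s"
proof -
  have "(norm z)\<^sup>2 = norm z powr 2" by (cases "z = 0") simp_all
  then have "(norm z)\<^sup>2 powr (1 / (2 * s)) = norm z powr (2 * (1 / (2 * s)))" by (simp only: powr_powr)
  then show ?thesis using that by simp
qed

section \<open>Growth exponents for s at least 1/2\<close>

context
  fixes s :: real
  assumes s: "1 / 2 \<le> s"
begin

lemma s0: "0 < s" using s by simp
lemma sigma: "0 < 1 / (2 * s)" "1 / (2 * s) \<le> 1" using s by (auto simp: field_simps)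

text \<open>Since \<sigma> \<le> 1, n^\<sigma> \<le> 1 + n, so the weight is at most a constant
  times q^|\<alpha>| with q = exp |r|.\<close>

lemma vartheta_sq_summable:
  "(\<lambda>\<alpha>. vartheta r s \<alpha> * (cmod (e_mono \<alpha> z))\<^sup>2) summable_on UNIV"
proof (rule summable_on_comparison_test)
  show "(\<lambda>\<alpha>. exp \<bar>r\<bar> * (exp \<bar>r\<bar> ^ mi_abs \<alpha> * (cmod (e_mono \<alpha> z))\<^sup>2)) summable_on UNIV"
    by (intro summable_on_cmult_right has_sum_imp_summable[OF has_sum_e_mono_sq])
  fix \<alpha> :: "nat^'a"
  have "r * real (mi_abs \<alpha>) powr (1 / (2 * s)) \<le> \<bar>r\<bar> * (1 + real (mi_abs \<alpha>))"
    using sigma by (intro mult_mono powr_le_one_plus) auto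
  then have "vartheta r s \<alpha> \<le> exp (\<bar>r\<bar> + real (mi_abs \<alpha>) * \<bar>r\<bar>)"
    by (simp add: vartheta_def algebra_simps)
  then have "vartheta r s \<alpha> \<le> exp \<bar>r\<bar> * exp \<bar>r\<bar> ^ mi_abs \<alpha>"
    by (simp only: exp_add exp_of_nat_mult)
  then show "vartheta r s \<alpha> * (cmod (e_mono \<alpha> z))\<^sup>2
      \<le> exp \<bar>r\<bar> * (exp \<bar>r\<bar> ^ mi_abs \<alpha> * (cmod (e_mono \<alpha> z))\<^sup>2)"
    unfolding mult.assoc[symmetric] by (rule mult_right_mono) simp
qed (simp add: vartheta_def)

text \<open>Cauchy-Schwarz for the splitting of the exponent r into -t and r + t. The first factor
  is square summable for every t > 0, so t can be matched to the estimate available for the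
  second.\<close>

lemma
  fixes z :: "complex^'d::finite"
  shows wsum_summable: "(\<lambda>\<alpha>. vartheta r s \<alpha> * cmod (e_mono \<alpha> z)) summable_on UNIV"
    and wsum_sq_le: "0 < t \<Longrightarrow> (wsum r s z)\<^sup>2 \<le>
      (\<Sum>\<^sub>\<infinity>\<alpha>::nat^'d. vartheta (- (2 * t)) s \<alpha>) * wsum_sq (2 * r + 2 * t) s z"
proof -
  have *: "(\<lambda>\<alpha>. vartheta r s \<alpha> * cmod (e_mono \<alpha> z)) summable_on UNIV \<and> (wsum r s z)\<^sup>2 \<le>
      (\<Sum>\<^sub>\<infinity>\<alpha>::nat^'d. vartheta (- (2 * t)) s \<alpha>) * wsum_sq (2 * r + 2 * t) s z"
    if t: "0 < t" for t
  proof -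
    let ?f = "\<lambda>\<alpha>::nat^'d. vartheta (-t) s \<alpha>" and ?g = "\<lambda>\<alpha>. vartheta (r + t) s \<alpha> * cmod (e_mono \<alpha> z)"
    have f: "(?f \<alpha>)\<^sup>2 = vartheta (- (2 * t)) s \<alpha>" for \<alpha>
      by (simp add: vartheta_def exp_double[symmetric] mult.assoc)
    have g: "(?g \<alpha>)\<^sup>2 = vartheta (2 * r + 2 * t) s \<alpha> * (cmod (e_mono \<alpha> z))\<^sup>2" for \<alpha>
      by (simp add: vartheta_def exp_double[symmetric] power_mult_distrib mult.assoc[symmetric] distrib_left)
    have fg: "?f \<alpha> * ?g \<alpha> = vartheta r s \<alpha> * cmod (e_mono \<alpha> z)" for \<alpha>
      by (simp add: vartheta_def exp_add[symmetric] mult.assoc[symmetric] distrib_right)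
    have sf: "(\<lambda>\<alpha>. (?f \<alpha>)\<^sup>2) summable_on UNIV"
      unfolding f using vartheta_summable[of "- (2 * t)" s] t s0 by simp
    have sg: "(\<lambda>\<alpha>. (?g \<alpha>)\<^sup>2) summable_on UNIV"
      unfolding g by (rule vartheta_sq_summable)
    have n: "0 \<le> ?f \<alpha>" "0 \<le> ?g \<alpha>" for \<alpha> by (simp_all add: vartheta_def)
    show ?thesis
      using Cauchy_Schwarz_infsum[of ?f ?g, OF n sf sg] unfolding f g fg wsum_def by blast
  qed
  show "(\<lambda>\<alpha>. vartheta r s \<alpha> * cmod (e_mono \<alpha> z)) summable_on UNIV" using *[of 1] by simp
  show "0 < t \<Longrightarrow> (wsum r s z)\<^sup>2 \<le>
      (\<Sum>\<^sub>\<infinity>\<alpha>::nat^'d. vartheta (- (2 * t)) s \<alpha>) * wsum_sq (2 * r + 2 * t) s z"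
    using * by blast
qed

lemma wsum_nonneg: "0 \<le> wsum r s z"
  unfolding wsum_def by (intro infsum_nonneg) (simp add: vartheta_def)

text \<open>Passing from the square sum to \<open>wsum\<close> takes a square root, which halves
  |z|^2 and the coefficient 2x.\<close>

lemma growth_leI:
  assumes "0 < t" "0 \<le> C"
    and "\<And>z::complex^'d::finite. wsum_sq (2 * r + 2 * t) s z
      \<le> C * exp ((norm z)\<^sup>2 + 2 * x * norm z powr (1 / s))"
  shows "growth_le TYPE('d) s r x"
proof -
  define A where "A = (\<Sum>\<^sub>\<infinity>\<alpha>::nat^'d. vartheta (- (2 * t)) s \<alpha>)"
  have A: "0 \<le> A" unfolding A_def by (intro infsum_nonneg) (simp add: vartheta_def)
  have "wsum r s z \<le> sqrt (A * C) * gauss_weight s x z" for z :: "complex^'d"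
  proof (rule power2_le_imp_le)
    have "(wsum r s z)\<^sup>2 \<le> A * (C * exp ((norm z)\<^sup>2 + 2 * x * norm z powr (1 / s)))"
      unfolding A_def using A
      by (intro order_trans[OF wsum_sq_le[OF assms(1)]] mult_left_mono assms(3)) (simp add: A_def)
    also have "\<dots> = (sqrt (A * C) * gauss_weight s x z)\<^sup>2"
      using A assms(2) by (simp add: power_mult_distrib exp_double[symmetric] distrib_left mult.assoc)
    finally show "(wsum r s z)\<^sup>2 \<le> (sqrt (A * C) * gauss_weight s x z)\<^sup>2" .
    show "0 \<le> sqrt (A * C) * gauss_weight s x z"
      using A assms(2) by simp
  qed
  then show ?thesis unfolding growth_le_def by blast
qed

text \<open>A constant plus a geometric term sums in closed form. The two estimates below cut the
  indices at a multiple of |z|^2 and let each term handle one range.\<close>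

lemma wsum_sq_leI:
  fixes z :: "complex^'d::finite"
  assumes "\<And>\<alpha>::nat^'d. vartheta r s \<alpha> \<le> A + B * q ^ mi_abs \<alpha>"
  shows "wsum_sq r s z \<le> A * exp ((norm z)\<^sup>2) + B * exp (q * (norm z)\<^sup>2)"
proof (rule has_sum_mono[OF has_sum_infsum[OF vartheta_sq_summable]])
  show "((\<lambda>\<alpha>. A * (1 ^ mi_abs \<alpha> * (cmod (e_mono \<alpha> z))\<^sup>2) +
        B * (q ^ mi_abs \<alpha> * (cmod (e_mono \<alpha> z))\<^sup>2)) has_sum
      A * exp ((norm z)\<^sup>2) + B * exp (q * (norm z)\<^sup>2)) UNIV"
    using has_sum_e_mono_sq[of 1 z]
    by (intro has_sum_add has_sum_cmult_right has_sum_e_mono_sq) simp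
  show "vartheta r s \<alpha> * (cmod (e_mono \<alpha> z))\<^sup>2 \<le> A * (1 ^ mi_abs \<alpha> * (cmod (e_mono \<alpha> z))\<^sup>2) +
      B * (q ^ mi_abs \<alpha> * (cmod (e_mono \<alpha> z))\<^sup>2)" for \<alpha>
    using mult_right_mono[OF assms, of "(cmod (e_mono \<alpha> z))\<^sup>2" \<alpha>] by (simp add: algebra_simps)
qed

text \<open>Indices with \<open>2 |\<alpha>| \<ge> |z|\<^sup>2\<close> carry a weight at most \<open>exp (r (|z|\<^sup>2 / 2)\<^sup>\<sigma>)\<close>; the others
  contribute only \<open>exp ((1 + ln 2) / 2 |z|\<^sup>2)\<close>, because \<open>1 \<le> 2 powr (|z|\<^sup>2 / 2 - |\<alpha>|)\<close> there.\<close>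

lemma sq_sum_decay:
  fixes z :: "complex^'d::finite"
  assumes "r \<le> 0"
  shows "wsum_sq r s z \<le>
    exp ((norm z)\<^sup>2 + r * (1 / 2) powr (1 / (2 * s)) * norm z powr (1 / s)) + exp ((1 + ln 2) / 2 * (norm z)\<^sup>2)"
proof -
  define t where "t = (norm z)\<^sup>2"
  have t: "0 \<le> t" by (simp add: t_def)
  define E where "E = exp (r * (t / 2) powr (1 / (2 * s)))"
  have le: "vartheta r s \<alpha> \<le> E + 2 powr (t / 2) * (1 / 2) ^ mi_abs \<alpha>" for \<alpha> :: "nat^'d"
  proof (cases "t / 2 \<le> real (mi_abs \<alpha>)")
    case True
    then have "(t / 2) powr (1 / (2 * s)) \<le> real (mi_abs \<alpha>) powr (1 / (2 * s))"
      using t sigma by (intro powr_mono2) auto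
    then have "vartheta r s \<alpha> \<le> E"
      using assms by (simp add: vartheta_def E_def mult_left_mono_neg)
    then show ?thesis by (simp add: add_increasing2)
  next
    case False
    have "vartheta r s \<alpha> \<le> 1" using assms by (simp add: vartheta_def mult_nonpos_nonneg)
    also have "1 \<le> 2 powr (t / 2 - real (mi_abs \<alpha>))" using False by (intro ge_one_powr_ge_zero) auto
    also have "\<dots> = 2 powr (t / 2) * (1 / 2) ^ mi_abs \<alpha>"
      by (simp only: powr_diff) (simp add: powr_realpow power_one_over)
    finally show ?thesis by (simp add: E_def add_increasing)
  qed
  have "wsum_sq r s z \<le> E * exp t + 2 powr (t / 2) * exp (1 / 2 * t)"
    unfolding t_def by (rule wsum_sq_leI[OF le[unfolded t_def]])
  also have "E * exp t = exp (t + r * (1 / 2) powr (1 / (2 * s)) * norm z powr (1 / s))"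
  proof -
    have "(t / 2) powr (1 / (2 * s)) = (1 / 2) powr (1 / (2 * s)) * norm z powr (1 / s)"
      using powr_mult[of "1/2" t "1 / (2 * s)"] norm_sq_powr[OF s0, of z] t by (simp add: t_def)
    then show ?thesis by (simp add: E_def exp_add[symmetric] mult.assoc add.commute)
  qed
  also have "2 powr (t / 2) * exp (1 / 2 * t) = exp ((1 + ln 2) / 2 * t)"
    by (simp add: powr_def exp_add[symmetric] field_simps)
  finally show ?thesis by (simp add: t_def)
qed

text \<open>For |\<alpha>| \<le> 8 |z|^2 the weight is at most its value at 8 |z|^2. Beyond, C
  2^|\<alpha>| is multiplied by 2 powr (|\<alpha>| - 8 |z|^2) \<ge> 1, and the resulting sum is C
  exp((4 - 8 ln 2) |z|^2) \<le> C. The multiple 8 makes 4 - 8 ln 2 negative.\<close>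

lemma sq_sum_growth:
  fixes z :: "complex^'d::finite"
  assumes "0 \<le> r" and C: "\<And>n::nat. exp (r * real n powr (1 / (2 * s))) \<le> C * 2 ^ n"
  shows "wsum_sq r s z \<le>
    (1 + C) * exp ((norm z)\<^sup>2 + r * 8 powr (1 / (2 * s)) * norm z powr (1 / s))"
proof -
  define t where "t = (norm z)\<^sup>2"
  have t: "0 \<le> t" by (simp add: t_def)
  have C0: "0 \<le> C" using order_trans[OF less_imp_le[OF exp_gt_zero] C[of 0]] by simp
  define E where "E = exp (r * (8 * t) powr (1 / (2 * s)))"
  have le: "vartheta r s \<alpha> \<le> E + C * 2 powr (- (8 * t)) * 4 ^ mi_abs \<alpha>" for \<alpha> :: "nat^'d"
  proof (cases "real (mi_abs \<alpha>) \<le> 8 * t")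
    case True
    then have "real (mi_abs \<alpha>) powr (1 / (2 * s)) \<le> (8 * t) powr (1 / (2 * s))"
      using t sigma by (intro powr_mono2) auto
    then have "vartheta r s \<alpha> \<le> E"
      using assms by (simp add: vartheta_def E_def mult_left_mono)
    then show ?thesis using C0 by (simp add: add_increasing2)
  next
    case False
    have "vartheta r s \<alpha> \<le> C * 2 ^ mi_abs \<alpha> * 1" using C by (simp add: vartheta_def)
    also have "1 \<le> 2 powr (real (mi_abs \<alpha>) - 8 * t)" using False by (intro ge_one_powr_ge_zero) auto
    also have "C * 2 ^ mi_abs \<alpha> * 2 powr (real (mi_abs \<alpha>) - 8 * t) = C * 2 powr (- (8 * t)) * 4 ^ mi_abs \<alpha>"
    proof -
      have "2 powr (real (mi_abs \<alpha>) - 8 * t) = 2 ^ mi_abs \<alpha> * 2 powr (- (8 * t))"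
        using powr_add[of 2 "real (mi_abs \<alpha>)" "- (8 * t)"] by (simp add: powr_realpow)
      moreover have "(4::real) ^ mi_abs \<alpha> = 2 ^ mi_abs \<alpha> * 2 ^ mi_abs \<alpha>"
        by (simp add: power_mult_distrib[symmetric])
      ultimately show ?thesis by simp
    qed
    finally show ?thesis using C0 by (simp add: E_def add_increasing mult_left_mono)
  qed
  have "wsum_sq r s z \<le> E * exp t + C * 2 powr (- (8 * t)) * exp (4 * t)"
    unfolding t_def by (rule wsum_sq_leI[OF le[unfolded t_def]])
  also have "E * exp t = exp (t + r * 8 powr (1 / (2 * s)) * norm z powr (1 / s))" (is "_ = ?R")
  proof -
    have "(8 * t) powr (1 / (2 * s)) = 8 powr (1 / (2 * s)) * norm z powr (1 / s)"
      using powr_mult[of 8 t "1 / (2 * s)"] norm_sq_powr[OF s0, of z] t by (simp add: t_def)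
    then show ?thesis by (simp add: E_def exp_add[symmetric] mult.assoc add.commute)
  qed
  also have "C * 2 powr (- (8 * t)) * exp (4 * t) \<le> C * ?R"
  proof -
    have "4 * t - 8 * t * ln 2 \<le> 0"
    proof -
      have "(1::real) / 2 \<le> ln 2" using ln2_ge_two_thirds by simp
      then have "8 * t * (1 / 2) \<le> 8 * t * ln 2" using t by (intro mult_left_mono) auto
      then show ?thesis by simp
    qed
    then have "2 powr (- (8 * t)) * exp (4 * t) \<le> 1"
      by (simp add: powr_def exp_add[symmetric] algebra_simps)
    also have "1 \<le> ?R" using t assms(1) by simp
    finally show ?thesis using C0 unfolding mult.assoc by (intro mult_left_mono)
  qed
  finally show ?thesis by (simp add: t_def algebra_simps)
qed

lemma growth_le_neg:
  assumes "r < 0"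
  shows "\<exists>x<0. growth_le TYPE('d::finite) s r x"
proof -
  define c where "c = (1 + ln 2) / (2::real)"
  have c: "c < 1" using ln_2_less_1 by (simp add: c_def)
  \<comment> \<open>The first entry is the decay on the large indices; the second is what exp(c
    |z|^2) can afford, since (1 - c) |z|^(1/s) \<le> (1 - c)(1 + |z|^2).\<close>
  define y where "y = min (- r * (1 / 2) powr (1 / (2 * s))) (1 - c)"
  have y: "0 < y" using assms c by (simp add: y_def mult_neg_pos)
  have "growth_le TYPE('d) s r (- y / 2)"
  \<comment> \<open>With t = -r/2 the weight parameter 2r + 2t is r again, still negative.\<close>
  proof (rule growth_leI[of "- r / 2" "2 * exp (1 - c)"])
    fix z :: "complex^'d"
    let ?u = "norm z powr (1 / s)"
    have u: "?u \<le> 1 + (norm z)\<^sup>2"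
      using powr_le_one_plus[of "(norm z)\<^sup>2" "1 / (2 * s)"] sigma norm_sq_powr[OF s0, of z] by simp
    have "wsum_sq (2 * r + 2 * (- r / 2)) s z
      \<le> exp ((norm z)\<^sup>2 + r * (1 / 2) powr (1 / (2 * s)) * ?u) + exp (c * (norm z)\<^sup>2)"
      using sq_sum_decay[of r z] assms by (simp add: c_def)
    also have "exp ((norm z)\<^sup>2 + r * (1 / 2) powr (1 / (2 * s)) * ?u) \<le> exp (1 - c) * exp ((norm z)\<^sup>2 - y * ?u)"
    proof -
      have "y * ?u \<le> (- r * (1 / 2) powr (1 / (2 * s))) * ?u" by (intro mult_right_mono) (auto simp: y_def)
      then show ?thesis using c by (simp add: exp_add[symmetric])
    qed
    also have "exp (c * (norm z)\<^sup>2) \<le> exp (1 - c) * exp ((norm z)\<^sup>2 - y * ?u)"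
    proof -
      have "y * ?u \<le> (1 - c) * (1 + (norm z)\<^sup>2)" using u y c by (intro mult_mono) (auto simp: y_def)
      then show ?thesis by (simp add: exp_add[symmetric] algebra_simps)
    qed
    finally show "wsum_sq (2 * r + 2 * (- r / 2)) s z
      \<le> 2 * exp (1 - c) * exp ((norm z)\<^sup>2 + 2 * (- y / 2) * ?u)" by simp
  qed (use assms in auto)
  then show ?thesis using y by (intro exI[of _ "- y / 2"]) auto
qed

text \<open>Here the growth exponent is prescribed. The contribution exp(c |z|^2) of the small
  indices would limit it at s = 1/2; for \<sigma> < 1 any multiple of |z|^(1/s) fits into the spare
  (1 - c) |z|^2.\<close>

lemma growth_le_neg':
  assumes "1 / 2 < s" "x < 0"
  shows "\<exists>r<0. growth_le TYPE('d::finite) s r x"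
proof -
  define c where "c = (1 + ln 2) / (2::real)"
  have c: "c < 1" using ln_2_less_1 by (simp add: c_def)
  \<comment> \<open>Solves r (1/2)^\<sigma> = 2x, the exponent that \<open>growth_leI\<close> asks
    for.\<close>
  define r where "r = 2 * x / (1 / 2) powr (1 / (2 * s))"
  have r: "r < 0" using assms(2) by (simp add: r_def divide_neg_pos)
  have \<sigma>: "1 / (2 * s) < 1" using assms(1) by (simp add: field_simps)
  obtain D where D: "0 \<le> D" "\<And>t. 0 \<le> t \<Longrightarrow> - (2 * x) * t powr (1 / (2 * s)) \<le> (1 - c) * t + D"
    using powr_sublinear[OF sigma(1) \<sigma>, of "1 - c" "- (2 * x)"] c by auto
  have "growth_le TYPE('d) s r x"
  proof (rule growth_leI[of "- r / 2" "2 * exp D"])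
    fix z :: "complex^'d"
    let ?u = "norm z powr (1 / s)"
    have "wsum_sq (2 * r + 2 * (- r / 2)) s z
      \<le> exp ((norm z)\<^sup>2 + r * (1 / 2) powr (1 / (2 * s)) * ?u) + exp (c * (norm z)\<^sup>2)"
      using sq_sum_decay[of r z] r by (simp add: c_def)
    also have "exp ((norm z)\<^sup>2 + r * (1 / 2) powr (1 / (2 * s)) * ?u) \<le> exp D * exp ((norm z)\<^sup>2 + 2 * x * ?u)"
      using D(1) by (simp add: r_def exp_add[symmetric])
    also have "exp (c * (norm z)\<^sup>2) \<le> exp D * exp ((norm z)\<^sup>2 + 2 * x * ?u)"
      using D(2)[of "(norm z)\<^sup>2"] norm_sq_powr[OF s0, of z] by (simp add: exp_add[symmetric] algebra_simps)
    finally show "wsum_sq (2 * r + 2 * (- r / 2)) s z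
      \<le> 2 * exp D * exp ((norm z)\<^sup>2 + 2 * x * ?u)" by simp
  qed (use r in auto)
  then show ?thesis using r by (intro exI[of _ r]) auto
qed

lemma growth_le_pos_aux:
  assumes r: "0 < r" and C: "\<And>n::nat. exp (4 * r * real n powr (1 / (2 * s))) \<le> C * 2 ^ n"
  shows "growth_le TYPE('d::finite) s r (2 * r * 8 powr (1 / (2 * s)))"
proof (rule growth_leI[of r "1 + C"])
  show "0 \<le> 1 + C" using order_trans[OF less_imp_le[OF exp_gt_zero] C[of 0]] by simp
  fix z :: "complex^'d"
  show "wsum_sq (2 * r + 2 * r) s z \<le>
     (1 + C) * exp ((norm z)\<^sup>2 + 2 * (2 * r * 8 powr (1 / (2 * s))) * norm z powr (1 / s))"
    using sq_sum_growth[of "4 * r" C z] r C by (simp add: mult.assoc)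
qed (rule r)

lemma growth_le_pos:
  assumes "0 < x"
  shows "\<exists>r>0. growth_le TYPE('d::finite) s r x"
proof -
  \<comment> \<open>The first bound gives exp(4 r n^\<sigma>) \<le> 2 * 2^n through n^\<sigma> \<le>
    1 + n; the second keeps the growth exponent 2 r 8^\<sigma> below x.\<close>
  define r where "r = min (ln 2 / 4) (x / (2 * 8 powr (1 / (2 * s))))"
  have r: "0 < r" using assms by (simp add: r_def)
  have "exp (4 * r * real n powr (1 / (2 * s))) \<le> 2 * 2 ^ n" for n
  proof -
    have "4 * r * real n powr (1 / (2 * s)) \<le> ln 2 * (1 + real n)"
      using sigma r by (intro mult_mono powr_le_one_plus) (auto simp: r_def)
    then have "exp (4 * r * real n powr (1 / (2 * s))) \<le> exp (ln 2 * (1 + real n))" by simp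
    also have "\<dots> = 2 powr (1 + real n)" by (simp add: powr_def mult.commute)
    also have "\<dots> = 2 * 2 ^ n" by (simp add: powr_add powr_realpow)
    finally show ?thesis .
  qed
  from growth_le_pos_aux[OF r this, where 'd = 'd] obtain C where C: "\<And>z::complex^'d.
      wsum r s z \<le> C * exp ((norm z)\<^sup>2 / 2 + 2 * r * 8 powr (1 / (2 * s)) * norm z powr (1 / s))"
    unfolding growth_le_def by blast
  have "wsum r s z \<le> \<bar>C\<bar> * gauss_weight s x z" for z :: "complex^'d"
  proof -
    have "r \<le> x / (2 * 8 powr (1 / (2 * s)))" by (simp add: r_def)
    then have "2 * r * 8 powr (1 / (2 * s)) \<le> x" by (simp add: field_simps)
    then show ?thesis
      by (intro order_trans[OF C] mult_mono) (auto simp: mult_right_mono)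
  qed
  then show ?thesis using r unfolding growth_le_def by blast
qed

lemma growth_le_pos':
  assumes "1 / 2 < s" "0 < r"
  shows "\<exists>x>0. growth_le TYPE('d::finite) s r x"
proof -
  have \<sigma>: "1 / (2 * s) < 1" using assms(1) by (simp add: field_simps)
  obtain D where D: "\<And>t. 0 \<le> t \<Longrightarrow> 4 * r * t powr (1 / (2 * s)) \<le> ln 2 * t + D"
    using powr_sublinear[OF sigma(1) \<sigma>, of "ln 2" "4 * r"] by auto
  have "exp (4 * r * real n powr (1 / (2 * s))) \<le> exp D * 2 ^ n" for n
  proof -
    have "exp (4 * r * real n powr (1 / (2 * s))) \<le> exp (ln 2 * real n + D)" using D[of "real n"] by simp
    also have "\<dots> = exp D * 2 powr real n" by (simp add: powr_def exp_add mult.commute)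
    also have "\<dots> = exp D * 2 ^ n" by (simp add: powr_realpow)
    finally show ?thesis .
  qed
  from growth_le_pos_aux[OF assms(2) this] show ?thesis
    using assms(2) by (intro exI[of _ "2 * r * 8 powr (1 / (2 * s))"]) auto
qed

end

section \<open>The Gaussian measure\<close>

text \<open>Uniqueness of Haar measure, specialised to the comparison of \<open>lborel\<close> with its image under
  an isometry: integrate \<open>f (R x + y)\<close> against the indicator of the unit ball in \<open>y\<close>.\<close>

lemma lborel_distr_isometry:
  fixes R Q :: "'a::euclidean_space \<Rightarrow> 'a"
  assumes R: "linear R" "\<And>x. norm (R x) = norm x" "\<And>x. R (Q x) = x"
  shows "distr lborel lborel R = lborel"
proof (rule measure_eqI)
  have [measurable]: "R \<in> borel_measurable borel"
    by (intro borel_measurable_continuous_onI linear_continuous_on linear_conv_bounded_linear[THEN iffD1] R)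
  fix A assume "A \<in> sets (distr lborel lborel R)"
  then have [measurable]: "A \<in> sets borel" by simp
  define f :: "'a \<Rightarrow> ennreal" where "f = indicator A"
  define g :: "'a \<Rightarrow> ennreal" where "g = indicator (ball 0 1)"
  define V where "V = (\<integral>\<^sup>+x. g x \<partial>lborel)"
  have [measurable]: "f \<in> borel_measurable borel" "g \<in> borel_measurable borel"
    by (auto simp: f_def g_def intro!: borel_measurable_indicator)
  have V: "V \<noteq> 0" "V \<noteq> top"
    using emeasure_lborel_ball_finite[of "0::'a" 1] emeasure_ball[of 1 "0::'a"] less_imp_neq[OF unit_ball_vol_pos[of "real DIM('a)"]]
    by (auto simp: V_def g_def)
  have shift: "(\<integral>\<^sup>+x. h (c + x) \<partial>lborel) = (\<integral>\<^sup>+x. h x \<partial>lborel)"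
    if [measurable]: "h \<in> borel_measurable borel" for h :: "'a \<Rightarrow> ennreal" and c
  proof -
    have "(\<integral>\<^sup>+x. h x \<partial>lborel) = (\<integral>\<^sup>+x. h x \<partial>distr lborel borel ((+) c))"
      by (simp add: lborel_distr_plus)
    also have "\<dots> = (\<integral>\<^sup>+x. h (c + x) \<partial>lborel)"
      by (rule nn_integral_distr) auto
    finally show ?thesis by simp
  qed
  have Rinv: "(\<integral>\<^sup>+x. f (R x + y) \<partial>lborel) = (\<integral>\<^sup>+x. f (R x) \<partial>lborel)" for y
    using shift[of "\<lambda>x. f (R x)" "Q y"] by (simp add: linear_add[OF R(1)] R(3) add.commute)
  have ball: "(\<integral>\<^sup>+x. g (y - R x) \<partial>lborel) = V" for y
  proof -
    have "g (y - R x) = g (- Q y + x)" for x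
    proof -
      have "norm (y - R x) = norm (R (Q y - x))" by (simp add: linear_diff[OF R(1)] R(3))
      also have "\<dots> = norm (- Q y + x)" by (simp add: R(2) norm_minus_commute)
      finally show ?thesis by (simp add: g_def indicator_def)
    qed
    then show ?thesis using shift[of g "- Q y"] by (simp add: V_def)
  qed
  have "(\<integral>\<^sup>+x. f (R x) \<partial>lborel) * V = (\<integral>\<^sup>+y. g y * (\<integral>\<^sup>+x. f (R x + y) \<partial>lborel) \<partial>lborel)"
    unfolding V_def Rinv by (simp add: nn_integral_multc mult.commute)
  also have "\<dots> = (\<integral>\<^sup>+y. (\<integral>\<^sup>+x. g y * f (R x + y) \<partial>lborel) \<partial>lborel)"
    by (intro nn_integral_cong) (simp add: nn_integral_cmult)
  also have "\<dots> = (\<integral>\<^sup>+x. (\<integral>\<^sup>+y. g y * f (R x + y) \<partial>lborel) \<partial>lborel)"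
    by (rule lborel_pair.Fubini') measurable
  also have "\<dots> = (\<integral>\<^sup>+x. (\<integral>\<^sup>+y. g (y - R x) * f y \<partial>lborel) \<partial>lborel)"
  proof (rule nn_integral_cong)
    fix x
    show "(\<integral>\<^sup>+y. g y * f (R x + y) \<partial>lborel) = (\<integral>\<^sup>+y. g (y - R x) * f y \<partial>lborel)"
      using shift[of "\<lambda>y. g (y - R x) * f y" "R x"] by simp
  qed
  also have "\<dots> = (\<integral>\<^sup>+y. (\<integral>\<^sup>+x. g (y - R x) * f y \<partial>lborel) \<partial>lborel)"
    by (rule lborel_pair.Fubini') measurable
  also have "\<dots> = (\<integral>\<^sup>+y. V * f y \<partial>lborel)"
    by (intro nn_integral_cong) (simp add: nn_integral_multc ball)
  also have "\<dots> = (\<integral>\<^sup>+y. f y \<partial>lborel) * V" by (simp add: nn_integral_cmult mult.commute)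
  finally have "(\<integral>\<^sup>+x. f (R x) \<partial>lborel) = (\<integral>\<^sup>+y. f y \<partial>lborel)"
    using V by (metis mult_divide_eq_ennreal)
  moreover have "(\<integral>\<^sup>+x. f (R x) \<partial>lborel) = (\<integral>\<^sup>+x. f x \<partial>distr lborel lborel R)"
    by (subst nn_integral_distr) auto
  ultimately show "emeasure (distr lborel lborel R) A = emeasure lborel A"
    by (simp add: f_def)
qed simp

text \<open>However small \<tau> is, the exponential beats (1 + |x|^2)^D, D the real dimension. This
  leaves a product of the integrable functions 1/(1 + t^2), one per coordinate.\<close>

lemma nn_integral_lborel_exp_power_finite:
  assumes "0 < \<tau>" "0 < \<kappa>"
  shows "(\<integral>\<^sup>+(x::'a::euclidean_space). ennreal (exp (- \<kappa> * norm x powr \<tau>)) \<partial>lborel) < \<infinity>"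
proof -
  let ?D = "DIM('a)"
  have "((\<lambda>t. exp (- \<kappa> * t powr \<tau>) * (1 + t\<^sup>2) powr real ?D) \<longlongrightarrow> 0) at_top"
    using assms by real_asymp
  then have "\<forall>\<^sub>F t in at_top. exp (- \<kappa> * t powr \<tau>) * (1 + t\<^sup>2) powr real ?D < 1"
    by (rule order_tendstoD) simp
  then obtain T where T: "\<And>t. t \<ge> T \<Longrightarrow> exp (- \<kappa> * t powr \<tau>) * (1 + t\<^sup>2) powr real ?D < 1"
    unfolding eventually_at_top_linorder by blast
  define C where "C = 1 + (1 + T\<^sup>2) powr real ?D"
  have C: "exp (- \<kappa> * t powr \<tau>) * (1 + t\<^sup>2) powr real ?D \<le> C" if "0 \<le> t" for t
  proof (cases "t \<ge> T")
    case True
    then show ?thesis using T[of t] by (simp add: C_def add_increasing2)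
  next
    case False
    have "exp (- \<kappa> * t powr \<tau>) * (1 + t\<^sup>2) powr real ?D \<le> 1 * (1 + T\<^sup>2) powr real ?D"
      using assms that False by (intro mult_mono powr_mono2) (auto intro!: power_mono add_pos_nonneg)
    then show ?thesis by (simp add: C_def)
  qed
  have "ennreal (exp (- \<kappa> * norm x powr \<tau>)) \<le> ennreal C * (\<Prod>b\<in>Basis. ennreal (inverse (1 + (x \<bullet> b)\<^sup>2)))" for x :: 'a
  proof -
    have "(\<Prod>b\<in>Basis. 1 + (x \<bullet> b)\<^sup>2) \<le> (\<Prod>b\<in>(Basis::'a set). 1 + (norm x)\<^sup>2)"
      by (intro prod_mono) (auto simp: power2_eq_square abs_le_square_iff[symmetric] Basis_le_norm
           intro!: add_nonneg_nonneg simp flip: power2_eq_square)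
    also have "\<dots> = (1 + (norm x)\<^sup>2) powr real ?D"
      by (simp add: powr_realpow add_pos_nonneg)
    finally have "exp (- \<kappa> * norm x powr \<tau>) * (\<Prod>b\<in>Basis. 1 + (x \<bullet> b)\<^sup>2)
       \<le> exp (- \<kappa> * norm x powr \<tau>) * (1 + (norm x)\<^sup>2) powr real ?D" by (intro mult_left_mono) auto
    also have "\<dots> \<le> C" by (rule C) simp
    finally have le: "exp (- \<kappa> * norm x powr \<tau>) * (\<Prod>b\<in>Basis. 1 + (x \<bullet> b)\<^sup>2) \<le> C" .
    have "exp (- \<kappa> * norm x powr \<tau>) \<le> C * (\<Prod>b\<in>Basis. inverse (1 + (x \<bullet> b)\<^sup>2))"
    proof -
      have P: "0 < (\<Prod>b\<in>Basis. 1 + (x \<bullet> b)\<^sup>2)" by (intro prod_pos) (auto intro: add_pos_nonneg)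
      have "(\<Prod>b\<in>Basis. inverse (1 + (x \<bullet> b)\<^sup>2)) = inverse (\<Prod>b\<in>Basis. 1 + (x \<bullet> b)\<^sup>2)"
        using prod_inversef[of "\<lambda>b. 1 + (x \<bullet> b)\<^sup>2" Basis] by (simp add: o_def)
      with le P show ?thesis by (simp add: divide_inverse[symmetric] pos_le_divide_eq)
    qed
    then have "ennreal (exp (- \<kappa> * norm x powr \<tau>)) \<le> ennreal (C * (\<Prod>b\<in>Basis. inverse (1 + (x \<bullet> b)\<^sup>2)))"
      by (rule ennreal_leI)
    also have "\<dots> = ennreal C * (\<Prod>b\<in>Basis. ennreal (inverse (1 + (x \<bullet> b)\<^sup>2)))"
      by (subst ennreal_mult'') (auto intro!: prod_nonneg simp: prod_ennreal)
    finally show ?thesis .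
  qed
  then have "(\<integral>\<^sup>+(x::'a). ennreal (exp (- \<kappa> * norm x powr \<tau>)) \<partial>lborel) \<le>
      (\<integral>\<^sup>+(x::'a). ennreal C * (\<Prod>b\<in>Basis. ennreal (inverse (1 + (x \<bullet> b)\<^sup>2))) \<partial>lborel)"
    by (rule nn_integral_mono)
  also have "\<dots> = ennreal C * (\<Prod>b\<in>(Basis::'a set). (\<integral>\<^sup>+(t::real). ennreal (inverse (1 + t\<^sup>2)) \<partial>lborel))"
    by (subst nn_integral_cmult) (simp_all add: nn_integral_lborel_prod[of "\<lambda>_ t. ennreal (inverse (1 + t\<^sup>2))"])
  also have "\<dots> < \<infinity>"
  proof -
    have "integrable lborel (\<lambda>t::real. inverse (1 + t\<^sup>2))"
      using integrable_inverse_1_plus_square by (simp add: set_integrable_def)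
    then have "(\<integral>\<^sup>+(t::real). ennreal (inverse (1 + t\<^sup>2)) \<partial>lborel) < top"
      by (subst nn_integral_eq_integral) auto
    then show ?thesis by (simp add: ennreal_mult_less_top power_less_top_ennreal)
  qed
  finally show ?thesis .
qed

lemma nn_integral_gauss_const: "(\<integral>\<^sup>+(x::complex^'d::finite). ennreal (exp (- (norm x)\<^sup>2)) \<partial>lborel) = ennreal (pi ^ CARD('d))"
proof -
  have one: "(\<integral>\<^sup>+(t::real). ennreal (exp (- t\<^sup>2)) \<partial>lborel) = ennreal (sqrt pi)"
  proof -
    have "has_bochner_integral lborel (\<lambda>x::real. exp (- x\<^sup>2)) (2 * (sqrt pi / 2))"
      using has_bochner_integral_even_function[OF gaussian_moment_0] by (simp add: scaleR_2)
    then show ?thesis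
      by (subst nn_integral_eq_integral) (auto simp: has_bochner_integral_iff)
  qed
  have "(\<integral>\<^sup>+(x::complex^'d). ennreal (exp (- (norm x)\<^sup>2)) \<partial>lborel)
      = (\<integral>\<^sup>+(x::complex^'d). (\<Prod>b\<in>Basis. ennreal (exp (- (x \<bullet> b)\<^sup>2))) \<partial>lborel)"
  proof (intro nn_integral_cong)
    fix x :: "complex^'d"
    have "(norm x)\<^sup>2 = (\<Sum>b\<in>Basis. (x \<bullet> b)\<^sup>2)"
      unfolding power2_norm_eq_inner using euclidean_inner[of x x] by (simp only: power2_eq_square)
    then show "ennreal (exp (- (norm x)\<^sup>2)) = (\<Prod>b\<in>Basis. ennreal (exp (- (x \<bullet> b)\<^sup>2)))"
      by (simp add: prod_ennreal exp_sum[symmetric] sum_negf)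
  qed
  also have "\<dots> = ennreal (sqrt pi) ^ DIM(complex^'d)"
    by (subst nn_integral_lborel_prod[of "\<lambda>_ t. ennreal (exp (- t\<^sup>2))"]) (simp_all add: one)
  also have "\<dots> = ennreal ((sqrt pi ^ 2) ^ CARD('d))"
    by (simp add: ennreal_power power_mult mult.commute[of "CARD('d)"] del: real_sqrt_pow2_iff real_sqrt_pow2)
  also have "\<dots> = ennreal (pi ^ CARD('d))" by simp
  finally show ?thesis .
qed

section \<open>Integration against the Gaussian measure\<close>

lemma sets_gauss [measurable_cong, simp]: "sets gauss = sets borel"
  by (simp add: gauss_def)

lemma space_gauss [simp]: "space gauss = UNIV"
  by (simp add: gauss_def)

lemma nn_integral_gauss:
  fixes f :: "complex^'d::finite \<Rightarrow> ennreal"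
  assumes [measurable]: "f \<in> borel_measurable borel"
  shows "(\<integral>\<^sup>+w. f w \<partial>gauss) = (\<integral>\<^sup>+w. ennreal (exp (- (norm w)\<^sup>2) / pi ^ CARD('d)) * f w \<partial>lborel)"
  unfolding gauss_def by (rule nn_integral_density) auto

lemma prob_space_gauss: "prob_space (gauss :: (complex^'d::finite) measure)"
proof
  have "emeasure (gauss :: (complex^'d) measure) UNIV = (\<integral>\<^sup>+w. 1 \<partial>(gauss :: (complex^'d) measure))"
    by simp
  also have "\<dots> = (\<integral>\<^sup>+(w::complex^'d). ennreal (1 / pi ^ CARD('d)) * ennreal (exp (- (norm w)\<^sup>2)) \<partial>lborel)"
    by (subst nn_integral_gauss) (auto intro!: nn_integral_cong simp: ennreal_mult[symmetric])
  also have "\<dots> = ennreal (1 / pi ^ CARD('d)) * ennreal (pi ^ CARD('d))"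
    by (simp add: nn_integral_cmult nn_integral_gauss_const)
  also have "\<dots> = 1" by (subst ennreal_mult[symmetric]) auto
  finally show "emeasure (gauss :: (complex^'d) measure) (space gauss) = 1" by simp
qed

text \<open>The borderline case: the permitted growth exp(|w|^2) cancels the density completely, and
  only the fractional power is left to secure convergence. The operator integral needs exactly this
  form.\<close>

lemma integrable_gaussI:
  fixes f :: "complex^'d::finite \<Rightarrow> complex"
  assumes [measurable]: "f \<in> borel_measurable borel" and "0 < \<tau>" "0 < \<kappa>"
    and f: "\<And>w. cmod (f w) \<le> C * exp ((norm w)\<^sup>2 - \<kappa> * norm w powr \<tau>)"
  shows "integrable gauss f"
proof (rule integrableI_bounded)
  have C: "0 \<le> C" using order_trans[OF norm_ge_zero f[of 0]] by (simp add: zero_le_mult_iff)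
  let ?c = "C / pi ^ CARD('d)"
  have "(\<integral>\<^sup>+w. ennreal (cmod (f w)) \<partial>gauss) = (\<integral>\<^sup>+w. ennreal (exp (- (norm w)\<^sup>2) / pi ^ CARD('d)) * ennreal (cmod (f w)) \<partial>lborel)"
    by (rule nn_integral_gauss) simp
  also have "\<dots> \<le> (\<integral>\<^sup>+(w::complex^'d). ennreal ?c * ennreal (exp (- \<kappa> * norm w powr \<tau>)) \<partial>lborel)"
  proof (rule nn_integral_mono)
    fix w :: "complex^'d"
    have "exp (- (norm w)\<^sup>2) / pi ^ CARD('d) * cmod (f w) \<le>
       exp (- (norm w)\<^sup>2) / pi ^ CARD('d) * (C * exp ((norm w)\<^sup>2 - \<kappa> * norm w powr \<tau>))"
      by (intro mult_left_mono f) simp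
    also have "\<dots> = ?c * exp (- \<kappa> * norm w powr \<tau>)"
      by (simp add: exp_diff exp_minus field_simps)
    finally show "ennreal (exp (- (norm w)\<^sup>2) / pi ^ CARD('d)) * ennreal (cmod (f w)) \<le>
       ennreal ?c * ennreal (exp (- \<kappa> * norm w powr \<tau>))"
      using C by (simp add: ennreal_mult[symmetric] ennreal_leI)
  qed
  also have "\<dots> = ennreal ?c * (\<integral>\<^sup>+(w::complex^'d). ennreal (exp (- \<kappa> * norm w powr \<tau>)) \<partial>lborel)"
    by (rule nn_integral_cmult) simp
  also have "\<dots> < \<infinity>"
    using nn_integral_lborel_exp_power_finite[where 'a = "complex^'d", OF assms(2,3)]
    by (simp add: ennreal_mult_less_top)
  finally show "(\<integral>\<^sup>+w. ennreal (cmod (f w)) \<partial>gauss) < \<infinity>" .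
qed simp

lemma integrable_gauss_sq:
  fixes f :: "complex^'d::finite \<Rightarrow> complex"
  assumes "f \<in> borel_measurable borel" "c < 1" "\<And>w. cmod (f w) \<le> C * exp (c * (norm w)\<^sup>2)"
  shows "integrable gauss f"
proof (rule integrable_gaussI[OF assms(1), of 2 "1 - c" C])
  fix w :: "complex^'d"
  have "norm w powr 2 = (norm w)\<^sup>2" by (cases "w = 0") simp_all
  then show "cmod (f w) \<le> C * exp ((norm w)\<^sup>2 - (1 - c) * norm w powr 2)"
    using assms(3)[of w] by (simp add: algebra_simps)
qed (use assms(2) in auto)

text \<open>Real linearity suffices, so besides unitary rotations the lemma covers complex
  conjugation, which the uniqueness proof needs.\<close>

lemma gauss_isometry:
  fixes R Q :: "complex^'d::finite \<Rightarrow> complex^'d"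
  assumes R: "linear R" "\<And>x. norm (R x) = norm x" "\<And>x. R (Q x) = x"
    and f: "f \<in> borel_measurable borel"
  shows "(LINT w|gauss. f (R w)) = (LINT w|gauss. (f w :: complex))"
proof -
  have [measurable]: "R \<in> borel_measurable borel" "f \<in> borel_measurable borel"
    by (intro f borel_measurable_continuous_onI linear_continuous_on linear_conv_bounded_linear[THEN iffD1] R)+
  have "(LINT w|gauss. f w) = (LINT w|lborel. (exp (- (norm w)\<^sup>2) / pi ^ CARD('d)) *\<^sub>R f w)"
    unfolding gauss_def by (rule integral_density) auto
  also have "\<dots> = (LINT w|distr lborel lborel R. (exp (- (norm w)\<^sup>2) / pi ^ CARD('d)) *\<^sub>R f w)"
    by (simp add: lborel_distr_isometry[OF R])
  also have "\<dots> = (LINT w|lborel. (exp (- (norm w)\<^sup>2) / pi ^ CARD('d)) *\<^sub>R f (R w))"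
    by (subst integral_distr) (auto simp: R(2))
  also have "\<dots> = (LINT w|gauss. f (R w))"
    unfolding gauss_def by (rule integral_density[symmetric]) auto
  finally show ?thesis by simp
qed

lemma gauss_translate:
  fixes f :: "complex^'d::finite \<Rightarrow> complex"
  assumes [measurable]: "f \<in> borel_measurable borel"
  shows "(LINT w|gauss. f w) = (LINT u|gauss. exp ((norm u)\<^sup>2 - (norm (v + u))\<^sup>2) *\<^sub>R f (v + u))"
proof -
  have "(LINT w|gauss. f w) = (LINT w|lborel. (exp (- (norm w)\<^sup>2) / pi ^ CARD('d)) *\<^sub>R f w)"
    unfolding gauss_def by (rule integral_density) auto
  also have "\<dots> = (LINT w|distr lborel borel ((+) v). (exp (- (norm w)\<^sup>2) / pi ^ CARD('d)) *\<^sub>R f w)"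
    by (simp add: lborel_distr_plus)
  also have "\<dots> = (LINT u|lborel. (exp (- (norm (v + u))\<^sup>2) / pi ^ CARD('d)) *\<^sub>R f (v + u))"
    by (rule integral_distr) auto
  also have "\<dots> = (LINT u|lborel. (exp (- (norm u)\<^sup>2) / pi ^ CARD('d)) *\<^sub>R (exp ((norm u)\<^sup>2 - (norm (v + u))\<^sup>2) *\<^sub>R f (v + u)))"
    by (simp add: exp_diff exp_minus field_simps)
  also have "\<dots> = (LINT u|gauss. exp ((norm u)\<^sup>2 - (norm (v + u))\<^sup>2) *\<^sub>R f (v + u))"
    unfolding gauss_def by (rule integral_density[symmetric]) auto
  finally show ?thesis .
qed

section \<open>Exhaustion of countable index sets and termwise integration\<close>

lemma finite_to_nat_less: "finite {i::'i::countable. to_nat i < N}"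
  by (rule finite_subset[OF _ finite_vimageI[of "{..<N}" to_nat]]) auto

text \<open>Turns unordered convergence into convergence of a sequence, to which dominated
  convergence and differentiation of limits apply.\<close>

lemma filterlim_to_nat_sets:
  "filterlim (\<lambda>N. {i::'i::countable. to_nat i < N}) (finite_subsets_at_top UNIV) sequentially"
  unfolding filterlim_finite_subsets_at_top
proof (intro allI impI)
  fix X :: "'i set" assume X: "finite X \<and> X \<subseteq> UNIV"
  obtain m where m: "\<And>i. i \<in> X \<Longrightarrow> to_nat i < m"
    using finite_nat_set_iff_bounded[of "to_nat ` X"] X by auto
  show "\<forall>\<^sub>F N in sequentially. finite {i::'i. to_nat i < N} \<and> X \<subseteq> {i. to_nat i < N} \<and> {i. to_nat i < N} \<subseteq> UNIV"
    using eventually_ge_at_top[of m]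
    by eventually_elim (use m in \<open>auto intro: less_le_trans finite_to_nat_less\<close>)
qed

lemma has_sum_LIMSEQ:
  fixes f :: "'i::countable \<Rightarrow> 'a::{comm_monoid_add,topological_space}"
  assumes "(f has_sum S) UNIV"
  shows "(\<lambda>N. \<Sum>i | to_nat i < N. f i) \<longlonglongrightarrow> S"
  using filterlim_compose[OF assms[unfolded has_sum_def] filterlim_to_nat_sets] .

text \<open>Dominated convergence along the exhaustion gives the value of the sum; unordered
  convergence of the integrals follows separately, since their absolute values have partial sums
  bounded by the integral of g.\<close>

lemma
  fixes f :: "'i::countable \<Rightarrow> 'a \<Rightarrow> complex"
  assumes f: "\<And>i. integrable M (f i)" and g: "integrable M g"
    and s: "\<And>x. (\<lambda>i. cmod (f i x)) summable_on UNIV" "\<And>x. (\<Sum>\<^sub>\<infinity>i. cmod (f i x)) \<le> g x"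
  shows integrable_infsum: "integrable M (\<lambda>x. \<Sum>\<^sub>\<infinity>i. f i x)"
    and has_sum_integral: "((\<lambda>i. LINT x|M. f i x) has_sum (LINT x|M. (\<Sum>\<^sub>\<infinity>i. f i x))) UNIV"
proof -
  define B where "B N = {i::'i. to_nat i < N}" for N
  define P where "P N x = (\<Sum>i\<in>B N. f i x)" for N x
  have fin: "finite (B N)" for N
    unfolding B_def by (rule finite_to_nat_less)
  have lim: "(\<lambda>N. P N x) \<longlonglongrightarrow> (\<Sum>\<^sub>\<infinity>i. f i x)" for x
    unfolding P_def B_def
    by (rule has_sum_LIMSEQ[OF has_sum_infsum[OF abs_summable_summable[OF s(1)]]])
  have bound: "cmod (\<Sum>i\<in>F. f i x) \<le> g x" "(\<Sum>i\<in>F. cmod (f i x)) \<le> g x" if "finite F" for F x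
  proof -
    show *: "(\<Sum>i\<in>F. cmod (f i x)) \<le> g x"
      using finite_sum_le_infsum[OF s(1) that, of x] s(2)[of x] by auto
    show "cmod (\<Sum>i\<in>F. f i x) \<le> g x" using * norm_sum[of "\<lambda>i. f i x" F] by linarith
  qed
  have iP: "integrable M (P N)" for N unfolding P_def by (intro Bochner_Integration.integrable_sum f)
  have m[measurable]: "P N \<in> borel_measurable M" for N using iP by auto
  have m': "(\<lambda>x. \<Sum>\<^sub>\<infinity>i. f i x) \<in> borel_measurable M"
    by (rule borel_measurable_LIMSEQ_metric[OF m lim])
  show "integrable M (\<lambda>x. \<Sum>\<^sub>\<infinity>i. f i x)"
    by (rule integrable_dominated_convergence[where s = P and w = g, OF m' m g])
      (use lim bound(1) fin in \<open>auto simp: P_def\<close>)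
  have c: "(\<lambda>N. integral\<^sup>L M (P N)) \<longlonglongrightarrow> (LINT x|M. (\<Sum>\<^sub>\<infinity>i. f i x))"
    by (rule integral_dominated_convergence[where s = P and w = g, OF m' m g])
      (use lim bound(1) fin in \<open>auto simp: P_def\<close>)
  have "(\<lambda>i. cmod (LINT x|M. f i x)) summable_on UNIV"
  proof (rule nonneg_bdd_above_summable_on)
    have "(\<Sum>i\<in>F. cmod (LINT x|M. f i x)) \<le> integral\<^sup>L M g" if "finite F" for F
    proof -
      have "(\<Sum>i\<in>F. cmod (LINT x|M. f i x)) \<le> (\<Sum>i\<in>F. LINT x|M. cmod (f i x))"
        by (intro sum_mono integral_norm_bound)
      also have "\<dots> = (LINT x|M. (\<Sum>i\<in>F. cmod (f i x)))"
        by (rule Bochner_Integration.integral_sum[symmetric]) (use f in auto)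
      also have "\<dots> \<le> integral\<^sup>L M g"
        by (rule integral_mono) (use f g bound(2)[OF that] in auto)
      finally show ?thesis .
    qed
    then show "bdd_above (sum (\<lambda>i. cmod (LINT x|M. f i x)) ` {F. F \<subseteq> UNIV \<and> finite F})"
      by (auto simp: bdd_above_def)
  qed auto
  from has_sum_infsum[OF abs_summable_summable[OF this]]
  have h: "((\<lambda>i. LINT x|M. f i x) has_sum (\<Sum>\<^sub>\<infinity>i. LINT x|M. f i x)) UNIV" .
  have "integral\<^sup>L M (P N) = (\<Sum>i\<in>B N. LINT x|M. f i x)" for N
    unfolding P_def by (rule Bochner_Integration.integral_sum) (rule f)
  then have "(\<Sum>\<^sub>\<infinity>i. LINT x|M. f i x) = (LINT x|M. (\<Sum>\<^sub>\<infinity>i. f i x))"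
    using LIMSEQ_unique[OF has_sum_LIMSEQ[OF h]] c unfolding B_def by simp
  with h show "((\<lambda>i. LINT x|M. f i x) has_sum (LINT x|M. (\<Sum>\<^sub>\<infinity>i. f i x))) UNIV" by simp
qed

section \<open>The mean value property\<close>

lemma sum_root_unity_powers:
  fixes N n :: nat
  assumes "0 < n" "n < N"
  shows "(\<Sum>k<N. cis (2 * pi * real k / real N) ^ n) = 0"
proof -
  define \<zeta> where "\<zeta> = cis (2 * pi * real n / real N)"
  have N: "0 < N" using assms by simp
  have "\<zeta> \<noteq> 1"
  proof
    assume "\<zeta> = 1"
    then have "cos (2 * pi * real n / real N) = 1"
      by (simp add: \<zeta>_def complex_eq_iff)
    then obtain m :: int where "2 * pi * real n / real N = real_of_int m * 2 * pi"
      using cos_one_2pi_int by auto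
    then have "real n = real_of_int m * real N" using N by (simp add: field_simps)
    then have "int n = m * int N" by (metis of_int_eq_iff of_int_mult of_int_of_nat_eq)
    then have "int N dvd int n" by simp
    then show False using assms by (auto dest: dvd_imp_le)
  qed
  moreover have "\<zeta> ^ N = 1"
  proof -
    have "\<zeta> ^ N = cis (real N * (2 * pi * real n / real N))" unfolding \<zeta>_def by (rule Complex.DeMoivre)
    also have "\<dots> = cis (2 * pi * real n)" using N by simp
    also have "\<dots> = 1" by (rule cis_multiple_2pi) auto
    finally show ?thesis .
  qed
  moreover have "cis (2 * pi * real k / real N) ^ n = \<zeta> ^ k" for k
  proof -
    have "cis (2 * pi * real k / real N) ^ n = cis (real n * (2 * pi * real k / real N))"
      by (rule Complex.DeMoivre)
    also have "\<dots> = cis (real k * (2 * pi * real n / real N))" by (simp add: mult_ac)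
    also have "\<dots> = \<zeta> ^ k" unfolding \<zeta>_def by (rule Complex.DeMoivre[symmetric])
    finally show ?thesis .
  qed
  ultimately show ?thesis by (simp add: geometric_sum)
qed

text \<open>Averaging over the N-th roots of unity kills the Taylor coefficients of degree 1 to N-1,
  so each fixed positive degree disappears eventually. Tannery's theorem, with the majorant |a_n|,
  exchanges limit and series.\<close>

lemma roots_of_unity_average:
  assumes "f holomorphic_on UNIV"
  shows "(\<lambda>N. (\<Sum>k<N. f (cis (2 * pi * real k / real N))) / of_nat N) \<longlonglongrightarrow> f 0"
proof -
  define a where "a n = (deriv ^^ n) f 0 / fact n" for n
  have sums: "(\<lambda>n. a n * z ^ n) sums f z" for z
    using holomorphic_power_series[of f 0 "norm z + 1" z] holomorphic_on_subset[OF assms]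
    by (simp add: a_def)
  \<comment> \<open>Convergence at the point 2 gives absolute convergence at radius 1.\<close>
  have abs: "summable (\<lambda>n. norm (a n))"
    using powser_insidea[OF sums_summable[OF sums[of 2]], of 1] by simp
  define A where "A n N = (\<Sum>k<N. a n * cis (2 * pi * real k / real N) ^ n) / of_nat N" for n N
  have A_sums: "(\<lambda>n. A n N) sums ((\<Sum>k<N. f (cis (2 * pi * real k / real N))) / of_nat N)" for N
    unfolding A_def by (intro sums_divide sums_sum sums)
  have A_bound: "norm (A n N) \<le> norm (a n)" for n N
  proof (cases "N = 0")
    case False
    have "norm (\<Sum>k<N. a n * cis (2 * pi * real k / real N) ^ n) \<le> (\<Sum>k<N. norm (a n))"
      by (rule sum_norm_le) (simp add: norm_mult norm_power)
    then show ?thesis using False by (simp add: A_def norm_divide field_simps)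
  qed (simp add: A_def)
  have A_lim: "(\<lambda>N. A n N) \<longlonglongrightarrow> (if n = 0 then a 0 else 0)" for n
  proof (rule tendsto_eventually)
    show "\<forall>\<^sub>F N in sequentially. A n N = (if n = 0 then a 0 else 0)"
      using eventually_gt_at_top[of n]
    proof eventually_elim
      case (elim N)
      then show ?case
        by (cases "n = 0") (auto simp: A_def sum_distrib_left[symmetric] sum_root_unity_powers)
    qed
  qed
  have "(\<lambda>N. suminf (\<lambda>n. A n N)) \<longlonglongrightarrow> suminf (\<lambda>n. if n = 0 then a 0 else 0)"
    using tannerys_theorem[of A "\<lambda>n. if n = 0 then a 0 else 0" sequentially "\<lambda>n. norm (a n)", OF A_lim _ abs]
      A_bound by (simp add: case_prod_unfold)
  moreover have "suminf (\<lambda>n. A n N) = (\<Sum>k<N. f (cis (2 * pi * real k / real N))) / of_nat N" for N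
    using A_sums sums_unique by metis
  moreover have "suminf (\<lambda>n. if n = 0 then a 0 else 0) = a 0"
    using sums_unique[OF sums_single[of 0 "\<lambda>_. a 0"]] by simp
  moreover have "a 0 = f 0" by (simp add: a_def)
  ultimately show ?thesis by simp
qed

lemma norm_vec_scale: "norm (c *s (u::complex^'d)) = cmod c * norm u"
proof -
  have "(norm (c *s u))\<^sup>2 = (cmod c * norm u)\<^sup>2"
    unfolding norm_vec_sq power_mult_distrib by (simp add: norm_mult power_mult_distrib sum_distrib_left)
  then show ?thesis by (rule power2_eq_imp_eq) auto
qed

lemma linear_scale: "linear (\<lambda>u::complex^'d. c *s u)"
  by (rule linearI) (auto simp: vec_eq_iff algebra_simps scaleR_conv_of_real)

text \<open>Finite averages over roots of unity stand in for a circle integral: each rotation leaves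
  the Gaussian integral unchanged, and the averages converge pointwise to H 0 under a common
  integrable bound.\<close>

lemma gauss_mean_value:
  fixes H :: "complex^'d::finite \<Rightarrow> complex"
  assumes cont: "continuous_on UNIV H" and holo: "\<And>u. (\<lambda>t. H (t *s u)) holomorphic_on UNIV"
    and bound: "\<And>u. cmod (H u) \<le> C * exp (c * (norm u)\<^sup>2)" and c: "c < 1"
  shows "(LINT u|gauss. H u) = H 0"
proof -
  have m[measurable]: "H \<in> borel_measurable borel" by (rule borel_measurable_continuous_onI[OF cont])
  have C: "0 \<le> C" using order_trans[OF norm_ge_zero bound[of 0]] by simp
  define \<omega> where "\<omega> N k = cis (2 * pi * real k / real N)" for N k :: nat
  have mR: "(\<lambda>u. H (z *s u)) \<in> borel_measurable borel" for z
    by (intro borel_measurable_continuous_onI continuous_on_compose2[OF cont] linear_continuous_on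
        linear_conv_bounded_linear[THEN iffD1] linear_scale) auto
  have boundR: "cmod (H (\<omega> N k *s u)) \<le> C * exp (c * (norm u)\<^sup>2)" for N k u
    using bound[of "\<omega> N k *s u"] by (simp add: norm_vec_scale \<omega>_def)
  have intR: "integrable gauss (\<lambda>u. H (\<omega> N k *s u))" for N k
    by (rule integrable_gauss_sq[OF mR c boundR])
  define A where "A N u = (\<Sum>k<N. H (\<omega> N k *s u)) / of_nat N" for N u
  have rot: "(LINT u|gauss. H (\<omega> N k *s u)) = (LINT u|gauss. H u)" for N k
    by (rule gauss_isometry[where Q = "\<lambda>u. cnj (\<omega> N k) *s u", OF linear_scale])
      (auto simp: norm_vec_scale \<omega>_def vec_eq_iff mult.assoc[symmetric] cis_cnj cis_mult m)
  have intA: "(LINT u|gauss. A N u) = (LINT u|gauss. H u)" if "0 < N" for N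
  proof -
    have "(LINT u|gauss. A N u) = (\<Sum>k<N. LINT u|gauss. H (\<omega> N k *s u)) / of_nat N"
      unfolding A_def by (simp add: intR)
    then show ?thesis using that by (simp add: rot)
  qed
  have limA: "(\<lambda>N. A N u) \<longlonglongrightarrow> H 0" for u
    using roots_of_unity_average[OF holo[of u]] by (simp add: A_def \<omega>_def)
  have boundA: "cmod (A N u) \<le> C * exp (c * (norm u)\<^sup>2)" for N u
  proof (cases "N = 0")
    case False
    have "cmod (\<Sum>k<N. H (\<omega> N k *s u)) \<le> (\<Sum>k<N. C * exp (c * (norm u)\<^sup>2))"
      by (intro sum_norm_le boundR)
    then show ?thesis using False by (simp add: A_def norm_divide field_simps)
  qed (simp add: A_def C)
  have dom: "integrable gauss (\<lambda>u::complex^'d. C * exp (c * (norm u)\<^sup>2))"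
  proof -
    have "integrable gauss (\<lambda>u::complex^'d. complex_of_real (C * exp (c * (norm u)\<^sup>2)))"
      by (rule integrable_gauss_sq[OF _ c, of _ C]) (use C in \<open>auto simp: norm_mult\<close>)
    then show ?thesis by (simp only: complex_of_real_integrable_eq)
  qed
  have mA: "A N \<in> borel_measurable gauss" for N
    unfolding A_def using mR by (intro borel_measurable_divide borel_measurable_sum) auto
  have "(\<lambda>N. LINT u|gauss. A N u) \<longlonglongrightarrow> (LINT u|(gauss :: (complex^'d) measure). H 0)"
    by (rule integral_dominated_convergence[where s = A, OF _ mA dom]) (use limA boundA in auto)
  moreover have "(LINT u|(gauss :: (complex^'d) measure). H 0) = H 0"
  proof -
    have "measure (gauss :: (complex^'d) measure) UNIV = 1"
      using prob_space.prob_space[OF prob_space_gauss] by simp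
    then show ?thesis by simp
  qed
  moreover have "(\<lambda>N. LINT u|gauss. A N u) \<longlonglongrightarrow> (LINT u|gauss. H u)"
    by (rule tendsto_eventually, rule eventually_mono[OF eventually_gt_at_top[of 0]]) (rule intA)
  ultimately show ?thesis using LIMSEQ_unique by metis
qed

section \<open>The reproducing formula\<close>

lemma norm_herm_le: "cmod (herm v w) \<le> norm v * norm w"
proof -
  have "cmod (herm v w) \<le> (\<Sum>j\<in>UNIV. \<bar>cmod (v $ j)\<bar> * \<bar>cmod (w $ j)\<bar>)"
    unfolding herm_def by (rule sum_norm_le) (simp add: norm_mult)
  also have "\<dots> \<le> norm v * norm w"
    unfolding norm_vec_def by (rule L2_set_mult_ineq)
  finally show ?thesis .
qed

lemma herm_self: "herm w w = complex_of_real ((norm w)\<^sup>2)"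
  by (simp add: herm_def norm_vec_sq complex_norm_square[symmetric])

lemma herm_simps:
  "herm (u + v) w = herm u w + herm v w" "herm u (v + w) = herm u v + herm u w"
  "herm (t *s u) v = t * herm u v" "herm u (t *s v) = cnj t * herm u v" "herm 0 w = 0" "herm w 0 = 0"
  by (simp_all add: herm_def algebra_simps sum.distrib sum_distrib_left)

lemma continuous_on_herm [continuous_intros]:
  "continuous_on S f \<Longrightarrow> continuous_on S g \<Longrightarrow> continuous_on S (\<lambda>x. herm (f x) (g x))"
  unfolding herm_def by (intro continuous_intros continuous_on_component)

text \<open>Substituting \<open>w = v + u\<close> turns the integrand into the mean value situation, because
  \<open>(v, w) - |w|\<^sup>2 = - (u, v) - |u|\<^sup>2\<close>.\<close>

lemma gauss_reproducing:
  fixes h :: "complex^'d::finite \<Rightarrow> complex"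
  assumes cont: "continuous_on UNIV h" and holo: "\<And>v u. (\<lambda>t. h (v + t *s u)) holomorphic_on UNIV"
    and bound: "\<And>w. cmod (h w) \<le> C * exp (c * (norm w)\<^sup>2)" and c: "0 \<le> c" "c < 1"
  shows "(LINT w|gauss. h w * exp (herm v w)) = h v"
proof -
  define H where "H u = h (v + u) * exp (- herm u v)" for u
  have C: "0 \<le> C" using order_trans[OF norm_ge_zero bound[of 0]] by simp
  have m: "(\<lambda>w. h w * exp (herm v w)) \<in> borel_measurable borel"
    by (intro borel_measurable_continuous_onI continuous_intros cont)
  have "(LINT w|gauss. h w * exp (herm v w)) = (LINT u|gauss. H u)"
    unfolding gauss_translate[OF m, of v]
  proof (rule Bochner_Integration.integral_cong[OF refl])
    fix u :: "complex^'d"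
    have "complex_of_real ((norm u)\<^sup>2 - (norm (v + u))\<^sup>2) + herm v (v + u) = - herm u v"
      unfolding of_real_diff herm_self[symmetric] by (simp add: herm_simps)
    then have "exp (complex_of_real ((norm u)\<^sup>2 - (norm (v + u))\<^sup>2)) * exp (herm v (v + u)) = exp (- herm u v)"
      by (simp only: exp_add[symmetric])
    then show "exp ((norm u)\<^sup>2 - (norm (v + u))\<^sup>2) *\<^sub>R (h (v + u) * exp (herm v (v + u))) = H u"
      unfolding scaleR_conv_of_real exp_of_real[symmetric] H_def by (metis mult.assoc mult.commute)
  qed
  also have "\<dots> = H 0"
  proof (rule gauss_mean_value)
    show "continuous_on UNIV H"
      unfolding H_def by (intro continuous_intros continuous_on_compose2[OF cont]) auto
    show "(\<lambda>t. H (t *s u)) holomorphic_on UNIV" for u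
      unfolding H_def herm_simps by (intro holomorphic_intros holo)
    \<comment> \<open>A rate strictly between c and 1; the surplus c' - c absorbs the terms linear
      in |u|.\<close>
    define c' where "c' = (1 + c) / 2"
    have c': "c < c'" "c' < 1" using c by (auto simp: c'_def)
    then show "c' < 1" by simp
    \<comment> \<open>Collects the linear coefficients: 2 c |v| from c (|v| + |u|)^2 and |v| from
      |(u, v)| \<le> |u| |v|. Completing the square produces the last summand of D.\<close>
    define m where "m = (2 * c + 1) * norm v"
    define D where "D = c * (norm v)\<^sup>2 + m\<^sup>2 / (4 * (c' - c))"
    show "cmod (H u) \<le> (C * exp D) * exp (c' * (norm u)\<^sup>2)" for u
    proof -
      have "m * norm u \<le> (c' - c) * (norm u)\<^sup>2 + m\<^sup>2 / (4 * (c' - c))"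
      proof -
        have "0 \<le> (2 * (c' - c) * norm u - m)\<^sup>2" by simp
        then have "4 * (c' - c) * (m * norm u) \<le> 4 * (c' - c) * ((c' - c) * (norm u)\<^sup>2) + m\<^sup>2"
          by (simp add: power2_eq_square algebra_simps)
        also have "\<dots> = 4 * (c' - c) * ((c' - c) * (norm u)\<^sup>2 + m\<^sup>2 / (4 * (c' - c)))"
          using c' by (simp add: distrib_left)
        finally show ?thesis using c' by (subst (asm) mult_le_cancel_left_pos) auto
      qed
      moreover have "(norm (v + u))\<^sup>2 \<le> (norm v + norm u)\<^sup>2"
        by (intro power_mono norm_triangle_ineq) auto
      then have "c * (norm (v + u))\<^sup>2 \<le> c * (norm v + norm u)\<^sup>2" using c by (intro mult_left_mono)
      ultimately have e: "c * (norm (v + u))\<^sup>2 + norm u * norm v \<le> D + c' * (norm u)\<^sup>2"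
        unfolding D_def by (simp add: m_def power2_sum algebra_simps)
      have "cmod (H u) \<le> (C * exp (c * (norm (v + u))\<^sup>2)) * exp (norm u * norm v)"
        unfolding H_def norm_mult
      proof (intro mult_mono bound)
        have "cmod (exp (- herm u v)) \<le> exp (cmod (- herm u v))" by (rule norm_exp)
        also have "\<dots> \<le> exp (norm u * norm v)" using norm_herm_le[of u v] by simp
        finally show "cmod (exp (- herm u v)) \<le> exp (norm u * norm v)" .
      qed (use C in auto)
      also have "\<dots> = C * exp (c * (norm (v + u))\<^sup>2 + norm u * norm v)" by (simp add: exp_add)
      also have "\<dots> \<le> C * exp (D + c' * (norm u)\<^sup>2)" using e C by (intro mult_left_mono) auto
      finally show ?thesis by (simp add: exp_add)
    qed
  qed
  also have "H 0 = h v" by (simp add: H_def herm_simps)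
  finally show ?thesis .
qed

section \<open>Expansion in the basis functions and orthonormality\<close>

lemma cnj_e_mono: "cnj (e_mono \<alpha> z) = e_mono \<alpha> (cnj_vec z)"
  by (simp add: e_mono_def cnj_vec_def)

lemma norm_cnj_vec: "norm (cnj_vec w) = norm w"
  by (simp add: norm_vec_def cnj_vec_def L2_set_def)

lemma cnj_vec_cnj_vec [simp]: "cnj_vec (cnj_vec w) = w"
  by (simp add: cnj_vec_def vec_eq_iff)

lemma linear_cnj_vec: "linear cnj_vec"
  by (rule linearI) (auto simp: vec_eq_iff cnj_vec_def)

lemma continuous_on_cnj_vec [continuous_intros]:
  "continuous_on S f \<Longrightarrow> continuous_on S (\<lambda>x. cnj_vec (f x))"
  unfolding cnj_vec_def by (intro continuous_intros continuous_on_component)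

lemma continuous_on_e_mono [continuous_intros]:
  "continuous_on S f \<Longrightarrow> continuous_on S (\<lambda>x. e_mono \<alpha> (f x))"
  unfolding e_mono_def divide_inverse by (intro continuous_intros continuous_on_component)

lemma e_mono_mult_cnj:
  "e_mono \<alpha> v * cnj (e_mono \<alpha> w) = (\<Prod>j\<in>UNIV. (v $ j * cnj (w $ j)) ^ (\<alpha> $ j) / fact (\<alpha> $ j))"
proof -
  have "complex_of_real (sqrt (mi_fact \<alpha>)) * complex_of_real (sqrt (mi_fact \<alpha>)) = of_nat (mi_fact \<alpha>)"
    by (metis abs_of_nat of_real_mult of_real_of_nat_eq real_sqrt_mult_self)
  then show ?thesis
    by (simp add: e_mono_def mi_fact_def prod_dividef prod.distrib power_mult_distrib)
qed

lemma has_sum_exp_herm: "((\<lambda>\<alpha>. e_mono \<alpha> v * cnj (e_mono \<alpha> w)) has_sum exp (herm v w)) UNIV"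
  unfolding e_mono_mult_cnj herm_def by (rule has_sum_exp_sum)

lemma abs_sum_exp_herm:
  fixes v w :: "complex^'d::finite"
  shows "(\<lambda>\<alpha>. cmod (e_mono \<alpha> v * cnj (e_mono \<alpha> w))) summable_on UNIV"
    and "(\<Sum>\<^sub>\<infinity>\<alpha>. cmod (e_mono \<alpha> v * cnj (e_mono \<alpha> w))) \<le> exp (norm v * norm w)"
proof -
  have h: "((\<lambda>\<alpha>. cmod (e_mono \<alpha> v * cnj (e_mono \<alpha> w))) has_sum exp (\<Sum>j\<in>UNIV. cmod (v $ j) * cmod (w $ j))) UNIV"
    using has_sum_exp_sum[of "\<lambda>j. cmod (v $ j) * cmod (w $ j)"]
    unfolding e_mono_mult_cnj by (simp add: prod_norm[symmetric] norm_divide norm_power norm_mult)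
  then show "(\<lambda>\<alpha>. cmod (e_mono \<alpha> v * cnj (e_mono \<alpha> w))) summable_on UNIV" by (rule has_sum_imp_summable)
  have "(\<Sum>j\<in>UNIV. cmod (v $ j) * cmod (w $ j)) \<le> norm v * norm w"
    using L2_set_mult_ineq[of "\<lambda>j. cmod (v $ j)" "\<lambda>j. cmod (w $ j)" UNIV] by (simp add: norm_vec_def)
  then show "(\<Sum>\<^sub>\<infinity>\<alpha>. cmod (e_mono \<alpha> v * cnj (e_mono \<alpha> w))) \<le> exp (norm v * norm w)"
    using infsumI[OF h] by simp
qed

text \<open>One term of the sum with q = 1/4 is at most the whole sum. The small rate 1/8 matters:
  added to 3/4 it gives 7/8 < 1.\<close>

lemma norm_e_mono_le: "cmod (e_mono \<alpha> w) \<le> sqrt (4 ^ mi_abs \<alpha>) * exp ((norm w)\<^sup>2 / 8)"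
proof (rule power2_le_imp_le)
  have "(1 / 4) ^ mi_abs \<alpha> * (cmod (e_mono \<alpha> w))\<^sup>2 \<le> exp (1 / 4 * (norm w)\<^sup>2)"
    using finite_sum_le_infsum[OF has_sum_imp_summable[OF has_sum_e_mono_sq[of "1/4" w]], of "{\<alpha>}"]
    by (simp add: infsumI[OF has_sum_e_mono_sq[of "1/4" w]])
  then have "(cmod (e_mono \<alpha> w))\<^sup>2 \<le> 4 ^ mi_abs \<alpha> * exp (1 / 4 * (norm w)\<^sup>2)"
    by (simp add: power_one_over field_simps)
  also have "\<dots> = (sqrt (4 ^ mi_abs \<alpha>) * exp ((norm w)\<^sup>2 / 8))\<^sup>2"
    by (simp add: power_mult_distrib exp_double[symmetric])
  finally show "(cmod (e_mono \<alpha> w))\<^sup>2 \<le> (sqrt (4 ^ mi_abs \<alpha>) * exp ((norm w)\<^sup>2 / 8))\<^sup>2" .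
qed simp

lemma integrable_mult_e_mono:
  fixes h :: "complex^'d::finite \<Rightarrow> complex"
  assumes "h \<in> borel_measurable borel" and bound: "\<And>w. cmod (h w) \<le> C * exp (3 / 4 * (norm w)\<^sup>2)"
  shows "integrable gauss (\<lambda>w. h w * e_mono \<beta> w)"
proof (rule integrable_gauss_sq[where c = "7 / 8"])
  have [measurable]: "h \<in> borel_measurable borel" by fact
  have [measurable]: "e_mono \<beta> \<in> borel_measurable borel"
    using borel_measurable_continuous_onI[OF continuous_on_e_mono[OF continuous_on_id]] .
  show "(\<lambda>w. h w * e_mono \<beta> w) \<in> borel_measurable borel" by measurable
  have C: "0 \<le> C" using order_trans[OF norm_ge_zero bound[of 0]] by simp
  fix w :: "complex^'d"
  have "cmod (h w * e_mono \<beta> w) \<le> (C * exp (3 / 4 * (norm w)\<^sup>2)) * (sqrt (4 ^ mi_abs \<beta>) * exp ((norm w)\<^sup>2 / 8))"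
    unfolding norm_mult by (intro mult_mono bound norm_e_mono_le) (use C in auto)
  also have "\<dots> = (C * sqrt (4 ^ mi_abs \<beta>)) * exp (7 / 8 * (norm w)\<^sup>2)"
    by (simp add: exp_add[symmetric] field_simps)
  finally show "cmod (h w * e_mono \<beta> w) \<le> (C * sqrt (4 ^ mi_abs \<beta>)) * exp (7 / 8 * (norm w)\<^sup>2)" .
qed simp

text \<open>Expand exp (v,w) in the reproducing formula into basis functions and integrate term by
  term.\<close>

lemma gauss_coefficients_has_sum:
  fixes h :: "complex^'d::finite \<Rightarrow> complex"
  assumes cont: "continuous_on UNIV h" and holo: "\<And>v u. (\<lambda>t. h (v + t *s u)) holomorphic_on UNIV"
    and bound: "\<And>w. cmod (h w) \<le> C * exp (3 / 4 * (norm w)\<^sup>2)"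
  shows "((\<lambda>\<beta>. e_mono \<beta> v * (LINT w|gauss. h w * cnj (e_mono \<beta> w))) has_sum h v) UNIV"
proof -
  have m[measurable]: "h \<in> borel_measurable borel" by (rule borel_measurable_continuous_onI[OF cont])
  have C: "0 \<le> C" using order_trans[OF norm_ge_zero bound[of 0]] by simp
  let ?f = "\<lambda>\<beta> w. h w * (e_mono \<beta> v * cnj (e_mono \<beta> w))"
  let ?g = "\<lambda>w::complex^'d. C * exp (3 / 4 * (norm w)\<^sup>2) * exp (norm v * norm w)"
  have int: "integrable gauss (\<lambda>w. h w * cnj (e_mono \<beta> w))" for \<beta>
  proof -
    have "integrable gauss (\<lambda>w. cnj (h w) * e_mono \<beta> w)"
      by (rule integrable_mult_e_mono)
        (use bound in \<open>auto intro!: borel_measurable_continuous_onI continuous_on_cnj cont\<close>)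
    then have "integrable gauss (\<lambda>w. cnj (cnj (h w) * e_mono \<beta> w))" by (rule integrable_cnj)
    then show ?thesis by simp
  qed
  have g: "integrable gauss ?g"
  proof -
    have "integrable gauss (\<lambda>w. complex_of_real (?g w))"
    proof (rule integrable_gauss_sq[where c = "7 / 8" and C = "C * exp (2 * (norm v)\<^sup>2)"])
      fix w :: "complex^'d"
      \<comment> \<open>This splitting raises the rate from 3/4 to 7/8 at the price of a factor
        depending on v only.\<close>
      have "norm v * norm w \<le> (norm w)\<^sup>2 / 8 + 2 * (norm v)\<^sup>2"
        using zero_le_power2[of "norm w - 4 * norm v"] by (simp add: power2_eq_square algebra_simps)
      then have "exp (3 / 4 * (norm w)\<^sup>2) * exp (norm v * norm w) \<le> exp (2 * (norm v)\<^sup>2) * exp (7 / 8 * (norm w)\<^sup>2)"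
        by (simp add: exp_add[symmetric])
      then show "cmod (complex_of_real (?g w)) \<le> (C * exp (2 * (norm v)\<^sup>2)) * exp (7 / 8 * (norm w)\<^sup>2)"
        using C by (simp add: norm_mult mult.assoc mult_left_mono del: of_real_mult)
    qed auto
    then show ?thesis by (simp only: complex_of_real_integrable_eq)
  qed
  have "((\<lambda>\<beta>. LINT w|gauss. ?f \<beta> w) has_sum (LINT w|gauss. (\<Sum>\<^sub>\<infinity>\<beta>. ?f \<beta> w))) UNIV"
  proof (rule has_sum_integral[OF _ g])
    show "integrable gauss (?f \<beta>)" for \<beta>
      using integrable_mult_right[OF int, of "e_mono \<beta> v" \<beta>] by (simp add: mult_ac)
    have eq: "cmod (?f \<beta> w) = cmod (h w) * cmod (e_mono \<beta> v * cnj (e_mono \<beta> w))" for \<beta> w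
      by (simp only: norm_mult)
    show "(\<lambda>\<beta>. cmod (?f \<beta> w)) summable_on UNIV" for w
      unfolding eq by (intro summable_on_cmult_right abs_sum_exp_herm)
    show "(\<Sum>\<^sub>\<infinity>\<beta>. cmod (?f \<beta> w)) \<le> ?g w" for w
      unfolding eq infsum_cmult_right'
      by (intro mult_mono bound abs_sum_exp_herm) (use C in \<open>auto intro: infsum_nonneg\<close>)
  qed
  moreover have "(\<Sum>\<^sub>\<infinity>\<beta>. ?f \<beta> w) = h w * exp (herm v w)" for w
    using infsumI[OF has_sum_exp_herm[of v w]] by (simp add: infsum_cmult_right')
  moreover have "(LINT w|gauss. h w * exp (herm v w)) = h v"
    by (rule gauss_reproducing[OF cont holo bound]) auto
  moreover have "(LINT w|gauss. ?f \<beta> w) = e_mono \<beta> v * (LINT w|gauss. h w * cnj (e_mono \<beta> w))" for \<beta>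
    using integral_mult_right_zero[of gauss "e_mono \<beta> v" "\<lambda>w. h w * cnj (e_mono \<beta> w)"]
    by (simp add: mult_ac)
  ultimately show ?thesis by simp
qed

text \<open>Rotating one coordinate maps an off-diagonal integral to its negative. With these gone,
  the expansion of e_\<gamma> itself collapses to e_\<gamma>(v) J \<gamma> = e_\<gamma>(v), and a
  point where e_\<gamma> does not vanish gives the diagonal value, so no Gaussian moment is
  computed.\<close>

lemma gauss_orthonormal:
  fixes \<beta> \<gamma> :: "nat^'d::finite"
  shows "(LINT w|gauss. e_mono \<gamma> w * cnj (e_mono \<beta> w)) = (if \<gamma> = \<beta> then 1 else 0)"
proof -
  define J where "J \<beta> = (LINT w|gauss. e_mono \<gamma> w * cnj (e_mono \<beta> w))" for \<beta>
  have m: "(\<lambda>w. e_mono \<gamma> w * cnj (e_mono \<beta> w)) \<in> borel_measurable borel" for \<beta>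
    by (intro borel_measurable_continuous_onI continuous_intros)
  have off: "J \<beta> = 0" if ne: "\<beta> \<noteq> \<gamma>" for \<beta>
  proof -
    obtain j where j: "\<gamma> $ j \<noteq> \<beta> $ j" using ne by (metis vec_eq_iff)
    define m' where "m' = real (\<gamma> $ j) - real (\<beta> $ j)"
    have m': "m' \<noteq> 0" using j by (simp add: m'_def)
    \<comment> \<open>The product e_\<gamma> cnj e_\<beta> picks up c to the power m', the
      difference of the j-th exponents; this angle makes it cis pi = -1.\<close>
    define c where "c = cis (pi / m')"
    define R :: "complex \<Rightarrow> complex^'d \<Rightarrow> complex^'d"
      where "R b w = (\<chi> i. (if i = j then b else 1) * w $ i)" for b w
    have R: "linear (R b)" for b
      by (rule linearI) (auto simp: R_def vec_eq_iff algebra_simps scaleR_conv_of_real)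
    have nR: "norm (R c w) = norm w" for w
    proof -
      have "cmod ((if i = j then c else 1) * w $ i) = cmod (w $ i)" for i
        by (simp add: c_def norm_mult)
      then have "(norm (R c w))\<^sup>2 = (norm w)\<^sup>2" unfolding norm_vec_sq by (simp add: R_def)
      then show ?thesis by (rule power2_eq_imp_eq) auto
    qed
    have RQ: "R c (R (cnj c) w) = w" for w
    proof -
      have "c * cnj c = 1" by (simp add: c_def cis_cnj cis_mult)
      then show ?thesis by (auto simp: R_def vec_eq_iff mult.assoc[symmetric])
    qed
    have e: "e_mono \<alpha> (R b w) = b ^ (\<alpha> $ j) * e_mono \<alpha> w" for \<alpha> b w
    proof -
      have "(\<Prod>i\<in>UNIV. (R b w) $ i ^ (\<alpha> $ i)) =
        (\<Prod>i\<in>UNIV. (if i = j then b ^ (\<alpha> $ i) else 1) * w $ i ^ (\<alpha> $ i))"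
        by (intro prod.cong refl) (simp add: R_def power_mult_distrib)
      also have "\<dots> = b ^ (\<alpha> $ j) * (\<Prod>i\<in>UNIV. w $ i ^ (\<alpha> $ i))"
        by (simp add: prod.distrib)
      finally show ?thesis by (simp add: e_mono_def)
    qed
    have "c ^ (\<gamma> $ j) * cnj c ^ (\<beta> $ j) = cis (real (\<gamma> $ j) * (pi / m')) * cis (real (\<beta> $ j) * - (pi / m'))"
      unfolding c_def cis_cnj Complex.DeMoivre by simp
    also have "\<dots> = cis ((real (\<gamma> $ j) - real (\<beta> $ j)) * (pi / m'))"
      unfolding cis_mult by (simp add: algebra_simps)
    also have "\<dots> = -1" using m' unfolding m'_def[symmetric] by simp
    finally have c: "c ^ (\<gamma> $ j) * cnj c ^ (\<beta> $ j) = -1" .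
    have "J \<beta> = (LINT w|gauss. e_mono \<gamma> (R c w) * cnj (e_mono \<beta> (R c w)))"
      unfolding J_def by (rule gauss_isometry[OF R nR RQ m, symmetric])
    also have "\<dots> = (LINT w|gauss. (c ^ (\<gamma> $ j) * cnj c ^ (\<beta> $ j)) * (e_mono \<gamma> w * cnj (e_mono \<beta> w)))"
      by (simp add: e mult_ac)
    also have "\<dots> = - J \<beta>" unfolding c J_def by simp
    finally show ?thesis by simp
  qed
  have "((\<lambda>\<beta>. e_mono \<beta> v * J \<beta>) has_sum e_mono \<gamma> v) UNIV" for v
    unfolding J_def
  proof (rule gauss_coefficients_has_sum)
    show "continuous_on UNIV (e_mono \<gamma>)" by (rule continuous_on_e_mono[OF continuous_on_id])
    show "(\<lambda>t. e_mono \<gamma> (v + t *s u)) holomorphic_on UNIV" for v u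
      unfolding e_mono_def divide_inverse by (simp, intro holomorphic_intros)
    fix w :: "complex^'d"
    have "exp ((norm w)\<^sup>2 / 8) \<le> exp (3 / 4 * (norm w)\<^sup>2)" by simp
    then show "cmod (e_mono \<gamma> w) \<le> sqrt (4 ^ mi_abs \<gamma>) * exp (3 / 4 * (norm w)\<^sup>2)"
      by (rule order_trans[OF norm_e_mono_le mult_left_mono]) simp
  qed
  moreover have "((\<lambda>\<beta>. e_mono \<beta> v * J \<beta>) has_sum (\<Sum>\<beta>\<in>{\<gamma>}. e_mono \<beta> v * J \<beta>)) UNIV" for v
    by (rule has_sum_finite_neutralI[of "{\<gamma>}"]) (auto simp: off)
  ultimately have "e_mono \<gamma> v * J \<gamma> = e_mono \<gamma> v" for v
    using has_sum_unique by fastforce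
  moreover have "e_mono \<gamma> (\<chi> i. 1) \<noteq> 0"
    by (simp add: e_mono_def mi_fact_def)
  ultimately have "J \<gamma> = 1" by (metis mult_cancel_left1)
  then show ?thesis using off[of \<beta>] by (auto simp: J_def)
qed

lemma gauss_moments_zero:
  fixes h :: "complex^'d::finite \<Rightarrow> complex"
  assumes "continuous_on UNIV h" "\<And>v u. (\<lambda>t. h (v + t *s u)) holomorphic_on UNIV"
    and "\<And>w. cmod (h w) \<le> C * exp (3 / 4 * (norm w)\<^sup>2)"
    and "\<And>\<beta>. (LINT w|gauss. h w * cnj (e_mono \<beta> w)) = 0"
  shows "h v = 0"
  using gauss_coefficients_has_sum[OF assms(1-3), of v] has_sum_unique[OF has_sum_0]
  by (fastforce simp: assms(4))

section \<open>Entire power series and their symbols\<close>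

lemma A_tilde_continuous:
  assumes "a \<in> A_tilde"
  shows "continuous_on UNIV (\<lambda>w. a z w)"
proof -
  have c: "continuous_on UNIV (\<lambda>(z, w). a z (cnj_vec w))"
    using assms has_derivative_continuous unfolding A_tilde_def entire2_def
    by (intro continuous_at_imp_continuous_on ballI) blast
  have "continuous_on UNIV (\<lambda>w. (\<lambda>(z, w). a z (cnj_vec w)) (z, cnj_vec w))"
    by (rule continuous_on_compose2[OF c]) (auto intro!: continuous_intros)
  then show ?thesis by simp
qed

lemma A_tilde_holomorphic:
  assumes "a \<in> A_tilde"
  shows "(\<lambda>t. a z (cnj_vec (v + t *s u))) holomorphic_on UNIV"
proof -
  have "\<exists>f'. ((\<lambda>t. a z (cnj_vec (v + t *s u))) has_field_derivative f') (at t)" for t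
  proof -
    obtain D where D: "((\<lambda>(z, w). a z (cnj_vec w)) has_derivative D) (at (z, v + t *s u))"
      and lin: "\<And>k u v. D (k *s u, k *s v) = k * D (u, v)"
      using assms unfolding A_tilde_def entire2_def by blast
    have "linear (\<lambda>t. t *s u)"
    proof (rule linearI)
      show "(b + b') *s u = b *s u + b' *s u" for b b' by (rule vector_sadd_rdistrib)
      show "(r *\<^sub>R b) *s u = r *\<^sub>R (b *s u)" for r b
        by (simp add: vec_eq_iff)
    qed
    then have "((\<lambda>t. t *s u) has_derivative (\<lambda>t. t *s u)) (at t)"
      using linear_conv_bounded_linear bounded_linear_imp_has_derivative by blast
    then have "((\<lambda>t. (z, v + t *s u)) has_derivative (\<lambda>t. (0, 0 + t *s u))) (at t)"
      by (intro derivative_intros)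
    from has_derivative_compose[OF this D]
    have "((\<lambda>t. a z (cnj_vec (v + t *s u))) has_derivative (\<lambda>t. D (0, t *s u))) (at t)" by simp
    moreover have "D (0, k *s u) = D (0, u) * k" for k using lin[of k 0 u] by simp
    ultimately show ?thesis by (intro exI[of _ "D (0, u)"]) (simp add: has_field_derivative_def)
  qed
  then show ?thesis by (simp add: holomorphic_on_def field_differentiable_def)
qed

lemma A_tilde_diff:
  assumes "a \<in> A_tilde" "b \<in> A_tilde"
  shows "(\<lambda>z w. a z w - b z w) \<in> A_tilde"
  unfolding A_tilde_def entire2_def mem_Collect_eq
proof
  fix x
  obtain D E where *: "((\<lambda>(z, w). a z (cnj_vec w)) has_derivative D) (at x)"
      "((\<lambda>(z, w). b z (cnj_vec w)) has_derivative E) (at x)"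
    and lin: "\<And>k u v. D (k *s u, k *s v) = k * D (u, v)" "\<And>k u v. E (k *s u, k *s v) = k * E (u, v)"
    using assms unfolding A_tilde_def entire2_def by blast
  from has_derivative_diff[OF *(1,2)]
  show "\<exists>D. ((\<lambda>(z, w). a z (cnj_vec w) - b z (cnj_vec w)) has_derivative D) (at x) \<and>
      (\<forall>k u v. D (k *s u, k *s v) = k * D (u, v))"
    by (intro exI[of _ "\<lambda>x. D x - E x"]) (auto simp: lin case_prod_unfold algebra_simps)
qed

text \<open>Bounds the kernel a(z,w) exp (z,w) with a constant that may depend on z. The rate 3/4
  leaves room above the natural 1/2 for the term in |w|^(1/s), and below 1 for a factor
  e_\<beta>.\<close>

definition subgaussian_symbol :: "(complex ^ 'd::finite \<Rightarrow> complex ^ 'd \<Rightarrow> complex) \<Rightarrow> bool" where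
  "subgaussian_symbol a \<longleftrightarrow>
     (\<forall>z. \<exists>C. \<forall>w. cmod (a z w * exp (herm z w)) \<le> C * exp (3 / 4 * (norm w)\<^sup>2))"

lemma integrable_symbol_e_mono:
  assumes "a \<in> A_tilde" "subgaussian_symbol a"
  shows "integrable gauss (\<lambda>w. a z w * e_mono \<beta> w * exp (herm z w))"
proof -
  obtain C where C: "\<And>w. cmod (a z w * exp (herm z w)) \<le> C * exp (3 / 4 * (norm w)\<^sup>2)"
    using assms(2) unfolding subgaussian_symbol_def by blast
  have "(\<lambda>w. a z w * exp (herm z w)) \<in> borel_measurable borel"
    by (intro borel_measurable_continuous_onI continuous_intros A_tilde_continuous assms)
  from integrable_mult_e_mono[OF this C, of \<beta>] show ?thesis by (simp add: mult_ac)
qed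

text \<open>For fixed z the difference of the kernels has vanishing moments against every e_\<beta>,
  hence vanishes by the coefficient expansion. The nonzero factor exp (z,w) can then be
  removed.\<close>

lemma symbol_eqI:
  fixes a b :: "complex ^ 'd::finite \<Rightarrow> complex ^ 'd \<Rightarrow> complex"
  assumes a: "a \<in> A_tilde" "subgaussian_symbol a" and b: "b \<in> A_tilde" "subgaussian_symbol b"
    and eq: "\<And>z \<beta>. (LINT w|gauss. a z w * e_mono \<beta> w * exp (herm z w)) =
      (LINT w|gauss. b z w * e_mono \<beta> w * exp (herm z w))"
  shows "a = b"
proof (intro ext)
  fix z v
  define d where "d z w = a z w - b z w" for z w
  have d: "d \<in> A_tilde" unfolding d_def by (rule A_tilde_diff[OF a(1) b(1)])
  \<comment> \<open>Kernels are antiholomorphic in w; conjugating makes h entire, and the invariance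
    of the measure under conjugation turns e_\<beta> into cnj e_\<beta>.\<close>
  define h where "h w = d z (cnj_vec w) * exp (herm z (cnj_vec w))" for w
  obtain C C' where C: "\<And>w. cmod (a z w * exp (herm z w)) \<le> C * exp (3 / 4 * (norm w)\<^sup>2)"
    "\<And>w. cmod (b z w * exp (herm z w)) \<le> C' * exp (3 / 4 * (norm w)\<^sup>2)"
    using a(2) b(2) unfolding subgaussian_symbol_def by metis
  have cont: "continuous_on UNIV (\<lambda>w. d z w)" by (rule A_tilde_continuous[OF d])
  have "h (cnj_vec v) = 0"
  proof (rule gauss_moments_zero)
    show "continuous_on UNIV h"
      unfolding h_def
      by (intro continuous_intros continuous_on_compose2[OF cont]) auto
    show "(\<lambda>t. h (v + t *s u)) holomorphic_on UNIV" for v u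
    proof -
      have "herm z (cnj_vec (v + t *s u)) = herm z (cnj_vec v) + t * herm z (cnj_vec u)" for t
        by (simp add: herm_def cnj_vec_def algebra_simps sum.distrib sum_distrib_left)
      then show ?thesis
        unfolding h_def by (auto intro!: holomorphic_intros A_tilde_holomorphic d)
    qed
    show "cmod (h w) \<le> (C + C') * exp (3 / 4 * (norm w)\<^sup>2)" for w
    proof -
      have "h w = a z (cnj_vec w) * exp (herm z (cnj_vec w)) - b z (cnj_vec w) * exp (herm z (cnj_vec w))"
        by (simp add: h_def d_def algebra_simps)
      then have "cmod (h w) \<le> C * exp (3 / 4 * (norm (cnj_vec w))\<^sup>2) + C' * exp (3 / 4 * (norm (cnj_vec w))\<^sup>2)"
        using norm_triangle_le_diff[OF add_mono[OF C]] by metis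
      then show ?thesis by (simp add: norm_cnj_vec distrib_right)
    qed
    show "(LINT w|gauss. h w * cnj (e_mono \<beta> w)) = 0" for \<beta>
    proof -
      have m: "(\<lambda>w. h w * cnj (e_mono \<beta> w)) \<in> borel_measurable borel"
        unfolding h_def
        by (intro borel_measurable_continuous_onI continuous_intros continuous_on_compose2[OF cont]) auto
      have "(LINT w|gauss. h w * cnj (e_mono \<beta> w)) = (LINT w|gauss. h (cnj_vec w) * cnj (e_mono \<beta> (cnj_vec w)))"
        by (rule gauss_isometry[OF linear_cnj_vec norm_cnj_vec cnj_vec_cnj_vec m, symmetric])
      also have "\<dots> = (LINT w|gauss. a z w * e_mono \<beta> w * exp (herm z w) - b z w * e_mono \<beta> w * exp (herm z w))"
        by (simp add: h_def d_def cnj_e_mono algebra_simps)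
      also have "\<dots> = 0"
        by (subst Bochner_Integration.integral_diff)
          (simp_all add: eq integrable_symbol_e_mono a b)
      finally show ?thesis .
    qed
  qed
  then show "a z v = b z v" by (simp add: h_def d_def)
qed

section \<open>Double power series and termwise differentiation\<close>

lemma has_sum_mult_pairs:
  fixes f :: "'i \<Rightarrow> complex" and g :: "'j \<Rightarrow> complex"
  assumes f: "(\<lambda>i. cmod (f i)) summable_on UNIV" and g: "(\<lambda>j. cmod (g j)) summable_on UNIV"
  shows "((\<lambda>(i, j). cmod (f i * g j)) has_sum (\<Sum>\<^sub>\<infinity>i. cmod (f i)) * (\<Sum>\<^sub>\<infinity>j. cmod (g j))) UNIV"
    and "((\<lambda>(i, j). f i * g j) has_sum (\<Sum>\<^sub>\<infinity>i. f i) * (\<Sum>\<^sub>\<infinity>j. g j)) UNIV"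
proof -
  have 1: "((\<lambda>j. cmod (f i * g j)) has_sum cmod (f i) * (\<Sum>\<^sub>\<infinity>j. cmod (g j))) UNIV" for i
    unfolding norm_mult by (intro has_sum_cmult_right has_sum_infsum g)
  have 2: "((\<lambda>i. cmod (f i) * (\<Sum>\<^sub>\<infinity>j. cmod (g j))) has_sum (\<Sum>\<^sub>\<infinity>i. cmod (f i)) * (\<Sum>\<^sub>\<infinity>j. cmod (g j))) UNIV"
    by (intro has_sum_cmult_left has_sum_infsum f)
  have s: "(\<lambda>(i, j). cmod (f i * g j)) summable_on (UNIV \<times> UNIV)"
    by (rule summable_on_SigmaI[OF _ has_sum_imp_summable[OF 2]]) (use 1 in auto)
  show "((\<lambda>(i, j). cmod (f i * g j)) has_sum (\<Sum>\<^sub>\<infinity>i. cmod (f i)) * (\<Sum>\<^sub>\<infinity>j. cmod (g j))) UNIV"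
    using has_sum_SigmaI[OF _ 2 s] 1 by simp
  have s': "(\<lambda>(i, j). f i * g j) summable_on (UNIV \<times> UNIV)"
    by (rule abs_summable_summable) (use s in \<open>simp add: case_prod_unfold\<close>)
  have 3: "((\<lambda>j. f i * g j) has_sum f i * (\<Sum>\<^sub>\<infinity>j. g j)) UNIV" for i
    by (intro has_sum_cmult_right has_sum_infsum abs_summable_summable[OF g])
  have 4: "((\<lambda>i. f i * (\<Sum>\<^sub>\<infinity>j. g j)) has_sum (\<Sum>\<^sub>\<infinity>i. f i) * (\<Sum>\<^sub>\<infinity>j. g j)) UNIV"
    by (intro has_sum_cmult_left has_sum_infsum abs_summable_summable[OF f])
  show "((\<lambda>(i, j). f i * g j) has_sum (\<Sum>\<^sub>\<infinity>i. f i) * (\<Sum>\<^sub>\<infinity>j. g j)) UNIV"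
    using has_sum_SigmaI[OF _ 4 s'] 3 by simp
qed

text \<open>The majorant M bounds the operator norm of the tail of the derivative series uniformly
  on S, which is the uniform convergence of derivatives needed to differentiate a limit.\<close>

lemma has_derivative_infsum:
  fixes f :: "'i::countable \<Rightarrow> 'a::real_normed_vector \<Rightarrow> complex"
  assumes S: "open S" "convex S" "x \<in> S"
    and d: "\<And>i y. y \<in> S \<Longrightarrow> (f i has_derivative f' i y) (at y)"
    and b: "\<And>i y h. y \<in> S \<Longrightarrow> cmod (f' i y h) \<le> M i * norm h"
    and M: "M summable_on UNIV" "\<And>i. 0 \<le> M i" and s: "\<And>y. y \<in> S \<Longrightarrow> (\<lambda>i. f i y) summable_on UNIV"
  shows "((\<lambda>y. \<Sum>\<^sub>\<infinity>i. f i y) has_derivative (\<lambda>h. \<Sum>\<^sub>\<infinity>i. f' i x h)) (at x)"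
proof -
  define B where "B N = {i::'i. to_nat i < N}" for N
  have fin: "finite (B N)" for N
    unfolding B_def by (rule finite_to_nat_less)
  define F where "F N y = (\<Sum>i\<in>B N. f i y)" for N y
  define F' where "F' N y h = (\<Sum>i\<in>B N. f' i y h)" for N y h
  define G' where "G' y h = (\<Sum>\<^sub>\<infinity>i. f' i y h)" for y h
  have tail: "cmod (F' N y h - G' y h) \<le> (infsum M UNIV - (\<Sum>i\<in>B N. M i)) * norm h" if y: "y \<in> S" for N y h
  proof -
    have sM: "(\<lambda>i. M i * norm h) summable_on UNIV" by (rule summable_on_cmult_left[OF M(1)])
    have sn: "(\<lambda>i. cmod (f' i y h)) summable_on UNIV"
      by (rule summable_on_comparison_test[OF sM]) (use b[OF y] in auto)
    have sub: "u summable_on - B N" if "u summable_on UNIV" for u :: "'i \<Rightarrow> 'c::banach"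
      by (rule summable_on_subset_banach[OF that]) auto
    have split: "infsum u UNIV = (\<Sum>i\<in>B N. u i) + infsum u (- B N)" if "u summable_on UNIV" for u :: "'i \<Rightarrow> 'c::banach"
      using infsum_Un_disjoint[OF summable_on_finite[OF fin] sub[OF that], of N] fin by simp
    have "F' N y h - G' y h = - (\<Sum>\<^sub>\<infinity>i\<in>-B N. f' i y h)"
      unfolding F'_def G'_def using split[OF abs_summable_summable[OF sn]] by simp
    then have "cmod (F' N y h - G' y h) \<le> (\<Sum>\<^sub>\<infinity>i\<in>-B N. cmod (f' i y h))"
      using norm_infsum_bound[OF sub[OF sn]] by simp
    also have "\<dots> \<le> (\<Sum>\<^sub>\<infinity>i\<in>-B N. M i * norm h)"
      by (intro infsum_mono sub sn sM b y)
    also have "\<dots> = (infsum M UNIV - (\<Sum>i\<in>B N. M i)) * norm h"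
      using split[OF M(1)] by (simp add: infsum_cmult_left')
    finally show ?thesis .
  qed
  have lim: "(\<lambda>N. F N y) \<longlonglongrightarrow> (\<Sum>\<^sub>\<infinity>i. f i y)" if "y \<in> S" for y
    unfolding F_def B_def by (rule has_sum_LIMSEQ[OF has_sum_infsum[OF s[OF that]]])
  have limM: "(\<lambda>N. infsum M UNIV - (\<Sum>i\<in>B N. M i)) \<longlonglongrightarrow> infsum M UNIV - infsum M UNIV"
    unfolding B_def by (intro tendsto_intros has_sum_LIMSEQ[OF has_sum_infsum[OF M(1)]])
  have "\<exists>g. \<forall>y\<in>S. (\<lambda>N. F N y) \<longlonglongrightarrow> g y \<and> (g has_derivative G' y) (at y within S)"
  proof (rule has_derivative_sequence[where f = F and f' = F' and g' = G', OF S(2) _ _ S(3) lim[OF S(3)]])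
    show "(F N has_derivative F' N y) (at y within S)" if "y \<in> S" for N y
    proof -
      have "F N = (\<lambda>y. \<Sum>i\<in>B N. f i y)" "F' N y = (\<lambda>h. \<Sum>i\<in>B N. f' i y h)"
        by (auto simp: F_def F'_def)
      then show ?thesis
        using has_derivative_sum[of "B N" f "\<lambda>i. f' i y" "at y within S"]
          has_derivative_at_withinI[OF d[OF that]] by simp
    qed
    fix e :: real assume "0 < e"
    then have "\<forall>\<^sub>F N in sequentially. infsum M UNIV - (\<Sum>i\<in>B N. M i) < e"
      using order_tendstoD(2)[OF limM, of e] by simp
    then show "\<forall>\<^sub>F N in sequentially. \<forall>y\<in>S. \<forall>h. cmod (F' N y h - G' y h) \<le> e * norm h"
    proof eventually_elim
      case (elim N)
      then show ?case
        by (intro ballI allI order_trans[OF tail mult_right_mono]) auto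
    qed
  qed
  then obtain g where g: "\<And>y. y \<in> S \<Longrightarrow> (\<lambda>N. F N y) \<longlonglongrightarrow> g y" "(g has_derivative G' x) (at x within S)"
    using S(3) by blast
  have "g y = (\<Sum>\<^sub>\<infinity>i. f i y)" if "y \<in> S" for y
    using LIMSEQ_unique[OF g(1)[OF that] lim[OF that]] .
  then have "((\<lambda>y. \<Sum>\<^sub>\<infinity>i. f i y) has_derivative G' x) (at x within S)"
    using has_derivative_transform[OF S(3) _ g(2)] by simp
  then show ?thesis unfolding G'_def using at_within_open[OF S(3,1)] by simp
qed

definition e_deriv :: "nat ^ 'd::finite \<Rightarrow> complex ^ 'd \<Rightarrow> complex ^ 'd \<Rightarrow> complex" where
  "e_deriv \<alpha> z u = (\<Sum>j\<in>UNIV. (of_nat (\<alpha> $ j) * z $ j ^ (\<alpha> $ j - 1) * u $ j) *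
     (\<Prod>i\<in>UNIV - {j}. z $ i ^ (\<alpha> $ i))) / complex_of_real (sqrt (real (mi_fact \<alpha>)))"

lemma has_derivative_e_mono: "(e_mono \<alpha> has_derivative e_deriv \<alpha> z) (at z)"
proof -
  have "((\<lambda>z. \<Prod>j\<in>UNIV. z $ j ^ (\<alpha> $ j)) has_derivative (\<lambda>u. \<Sum>j\<in>UNIV.
     (of_nat (\<alpha> $ j) * u $ j * z $ j ^ (\<alpha> $ j - 1)) * (\<Prod>i\<in>UNIV - {j}. z $ i ^ (\<alpha> $ i)))) (at z)"
    by (intro has_derivative_prod has_derivative_power bounded_linear_imp_has_derivative bounded_linear_vec_nth)
  from has_derivative_mult_left[OF this, of "inverse (complex_of_real (sqrt (real (mi_fact \<alpha>))))"]
  have "((\<lambda>z. e_mono \<alpha> z) has_derivative (\<lambda>u. (\<Sum>j\<in>UNIV.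
     (of_nat (\<alpha> $ j) * u $ j * z $ j ^ (\<alpha> $ j - 1)) * (\<Prod>i\<in>UNIV - {j}. z $ i ^ (\<alpha> $ i))) *
      inverse (complex_of_real (sqrt (real (mi_fact \<alpha>)))))) (at z)"
    unfolding e_mono_def divide_inverse .
  then show ?thesis
    by (rule has_derivative_eq_rhs) (simp add: e_deriv_def fun_eq_iff divide_inverse mult_ac)
qed

lemma e_deriv_scale: "e_deriv \<alpha> z (k *s u) = k * e_deriv \<alpha> z u"
  by (simp add: e_deriv_def sum_distrib_left mult_ac)

lemma norm_e_mono_mono:
  fixes z :: "complex^'d::finite"
  assumes "\<And>j. cmod (z $ j) \<le> R"
  shows "cmod (e_mono \<alpha> z) \<le> cmod (e_mono \<alpha> (\<chi> j. complex_of_real R))"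
proof -
  have "0 \<le> R" using order_trans[OF norm_ge_zero assms] .
  then show ?thesis
    unfolding norm_e_mono using assms
    by (intro divide_right_mono prod_mono) (auto intro: power_mono)
qed

text \<open>Differentiation lowers one exponent, harmless for R \<ge> 1, and brings down factors of
  total size |\<alpha>| \<le> 2^|\<alpha>|, paid for by doubling the radius. The derivative is thus
  controlled by a value of the same monomial.\<close>

lemma norm_e_deriv_le:
  fixes z :: "complex^'d::finite"
  assumes z: "\<And>j. cmod (z $ j) \<le> R" and R: "1 \<le> R"
  shows "cmod (e_deriv \<alpha> z u) \<le> cmod (e_mono \<alpha> (\<chi> j. complex_of_real (2 * R))) * norm u"
proof -
  have "cmod (\<Sum>j\<in>UNIV. (of_nat (\<alpha> $ j) * z $ j ^ (\<alpha> $ j - 1) * u $ j) * (\<Prod>i\<in>UNIV - {j}. z $ i ^ (\<alpha> $ i)))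
     \<le> (\<Sum>j\<in>UNIV. real (\<alpha> $ j) * (R ^ mi_abs \<alpha> * norm u))"
  proof (rule sum_norm_le)
    fix j
    have "cmod (z $ j ^ (\<alpha> $ j - 1)) * cmod (\<Prod>i\<in>UNIV - {j}. z $ i ^ (\<alpha> $ i)) \<le>
        R ^ (\<alpha> $ j) * (\<Prod>i\<in>UNIV - {j}. R ^ (\<alpha> $ i))"
    proof (intro mult_mono)
      have "cmod (z $ j ^ (\<alpha> $ j - 1)) \<le> R ^ (\<alpha> $ j - 1)" using z by (simp add: norm_power power_mono)
      also have "\<dots> \<le> R ^ (\<alpha> $ j)" using R by (intro power_increasing) auto
      finally show "cmod (z $ j ^ (\<alpha> $ j - 1)) \<le> R ^ (\<alpha> $ j)" .
      show "cmod (\<Prod>i\<in>UNIV - {j}. z $ i ^ (\<alpha> $ i)) \<le> (\<Prod>i\<in>UNIV - {j}. R ^ (\<alpha> $ i))"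
        unfolding prod_norm[symmetric] using z by (intro prod_mono) (auto simp: norm_power power_mono)
    qed (use R in auto)
    also have "\<dots> = R ^ mi_abs \<alpha>"
      unfolding power_mi_abs by (rule prod.remove[symmetric]) auto
    finally have le: "cmod (z $ j ^ (\<alpha> $ j - 1)) * cmod (\<Prod>i\<in>UNIV - {j}. z $ i ^ (\<alpha> $ i)) \<le> R ^ mi_abs \<alpha>" .
    have "cmod ((of_nat (\<alpha> $ j) * z $ j ^ (\<alpha> $ j - 1) * u $ j) * (\<Prod>i\<in>UNIV - {j}. z $ i ^ (\<alpha> $ i))) =
       real (\<alpha> $ j) * ((cmod (z $ j ^ (\<alpha> $ j - 1)) * cmod (\<Prod>i\<in>UNIV - {j}. z $ i ^ (\<alpha> $ i))) * cmod (u $ j))"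
      by (simp add: norm_mult mult_ac)
    also have "\<dots> \<le> real (\<alpha> $ j) * (R ^ mi_abs \<alpha> * norm u)"
      using R by (intro mult_left_mono mult_mono le Finite_Cartesian_Product.norm_nth_le) auto
    finally show "cmod ((of_nat (\<alpha> $ j) * z $ j ^ (\<alpha> $ j - 1) * u $ j) * (\<Prod>i\<in>UNIV - {j}. z $ i ^ (\<alpha> $ i)))
       \<le> real (\<alpha> $ j) * (R ^ mi_abs \<alpha> * norm u)" .
  qed
  also have "\<dots> = real (mi_abs \<alpha>) * (R ^ mi_abs \<alpha> * norm u)"
    by (simp add: mi_abs_def sum_distrib_right)
  also have "\<dots> \<le> 2 ^ mi_abs \<alpha> * (R ^ mi_abs \<alpha> * norm u)"
    using R less_imp_le[OF of_nat_less_two_power] by (intro mult_right_mono) auto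
  also have "\<dots> = (\<Prod>j\<in>(UNIV::'d set). (2 * R) ^ (\<alpha> $ j)) * norm u"
    unfolding power_mi_abs[symmetric] by (simp add: power_mult_distrib)
  finally have "cmod (e_deriv \<alpha> z u) \<le> (\<Prod>j\<in>(UNIV::'d set). (2 * R) ^ (\<alpha> $ j)) * norm u / sqrt (mi_fact \<alpha>)"
    unfolding e_deriv_def norm_divide by (simp add: divide_right_mono)
  also have "\<dots> = cmod (e_mono \<alpha> (\<chi> j. complex_of_real (2 * R))) * norm u"
    unfolding norm_e_mono using R by simp
  finally show ?thesis .
qed

lemma entire2_power_series:
  fixes c :: "nat ^ 'd::finite \<Rightarrow> nat ^ 'd \<Rightarrow> complex"
  assumes s: "\<And>z w. (\<lambda>(\<alpha>, \<beta>). cmod (c \<alpha> \<beta> * e_mono \<alpha> z * e_mono \<beta> w)) summable_on UNIV"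
  shows "\<exists>D. ((\<lambda>(z, w). \<Sum>\<^sub>\<infinity>(\<alpha>, \<beta>). c \<alpha> \<beta> * e_mono \<alpha> z * e_mono \<beta> w) has_derivative D) (at x) \<and>
        (\<forall>k u v. D (k *s u, k *s v) = k * D (u, v))"
proof -
  define R where "R = norm x + 1"
  have R: "1 \<le> R" by (simp add: R_def)
  \<comment> \<open>Absolute convergence at the single point (q, q) supplies the majorant on the
    whole ball; the factor 2 in \<open>M\<close> counts the two terms of the product rule.\<close>
  define q where "q = (\<chi> j::'d. complex_of_real (2 * R))"
  define f where "f i y = c (fst i) (snd i) * e_mono (fst i) (fst y) * e_mono (snd i) (snd y)"
    for i :: "(nat^'d) \<times> (nat^'d)" and y
  define f' where "f' i y h = c (fst i) (snd i) * e_mono (fst i) (fst y) * e_deriv (snd i) (snd y) (snd h) +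
      (c (fst i) (snd i) * e_deriv (fst i) (fst y) (fst h)) * e_mono (snd i) (snd y)" for i y h
  define M where "M i = 2 * cmod (c (fst i) (snd i) * e_mono (fst i) q * e_mono (snd i) q)" for i
  have coord: "cmod (fst y $ j) \<le> R" "cmod (snd y $ j) \<le> R" if "y \<in> ball 0 R" for y :: "(complex^'d) \<times> (complex^'d)" and j
  proof -
    have "norm y \<le> R" using that by simp
    then show "cmod (fst y $ j) \<le> R" "cmod (snd y $ j) \<le> R"
      using norm_fst_le[of "fst y" "snd y"] norm_snd_le[of "snd y" "fst y"]
        Finite_Cartesian_Product.norm_nth_le[of "fst y" j] Finite_Cartesian_Product.norm_nth_le[of "snd y" j]
      by auto
  qed
  have "((\<lambda>y. \<Sum>\<^sub>\<infinity>i. f i y) has_derivative (\<lambda>h. \<Sum>\<^sub>\<infinity>i. f' i x h)) (at x)"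
  proof (rule has_derivative_infsum[of "ball 0 R" x f f' M])
    show "(f i has_derivative f' i y) (at y)" for i y
      unfolding f_def f'_def
      by (intro has_derivative_mult has_derivative_mult_right
         has_derivative_compose[OF has_derivative_fst[OF has_derivative_ident] has_derivative_e_mono]
         has_derivative_compose[OF has_derivative_snd[OF has_derivative_ident] has_derivative_e_mono])
    show "cmod (f' i y h) \<le> M i * norm h" if y: "y \<in> ball 0 R" for i y h
    proof -
      let ?c = "c (fst i) (snd i)"
      have "cmod (z $ j) \<le> 2 * R" if "cmod (z $ j) \<le> R" for z :: "complex^'d" and j using that R by simp
      then have e: "cmod (e_mono (fst i) (fst y)) \<le> cmod (e_mono (fst i) q)"
        "cmod (e_mono (snd i) (snd y)) \<le> cmod (e_mono (snd i) q)"
        unfolding q_def by (rule norm_e_mono_mono, use coord[OF y] in blast)+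
      have d: "cmod (e_deriv (fst i) (fst y) (fst h)) \<le> cmod (e_mono (fst i) q) * norm h"
        "cmod (e_deriv (snd i) (snd y) (snd h)) \<le> cmod (e_mono (snd i) q) * norm h"
        unfolding q_def using norm_fst_le[of "fst h" "snd h"] norm_snd_le[of "snd h" "fst h"]
        by (intro order_trans[OF norm_e_deriv_le[OF coord(1)[OF y] R]]
              order_trans[OF norm_e_deriv_le[OF coord(2)[OF y] R]] mult_left_mono norm_ge_zero; simp)+
      have "cmod (f' i y h) \<le> cmod ?c * cmod (e_mono (fst i) (fst y)) * cmod (e_deriv (snd i) (snd y) (snd h))
        + cmod ?c * cmod (e_deriv (fst i) (fst y) (fst h)) * cmod (e_mono (snd i) (snd y))"
        unfolding f'_def by (rule norm_triangle_le) (simp add: norm_mult)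
      also have "\<dots> \<le> cmod ?c * cmod (e_mono (fst i) q) * (cmod (e_mono (snd i) q) * norm h)
        + cmod ?c * (cmod (e_mono (fst i) q) * norm h) * cmod (e_mono (snd i) q)"
        by (intro add_mono mult_mono e d) auto
      also have "\<dots> = M i * norm h" by (simp add: M_def norm_mult)
      finally show ?thesis .
    qed
    show "M summable_on UNIV"
      unfolding M_def by (rule summable_on_cmult_right) (use s[of q q] in \<open>simp add: case_prod_unfold\<close>)
    show "(\<lambda>i. f i y) summable_on UNIV" for y
      unfolding f_def by (rule abs_summable_summable) (use s[of "fst y" "snd y"] in \<open>simp add: case_prod_unfold\<close>)
  qed (auto simp: R_def M_def)
  moreover have "(\<Sum>\<^sub>\<infinity>i. f' i x (k *s u, k *s v)) = k * (\<Sum>\<^sub>\<infinity>i. f' i x (u, v))" for k u v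
  proof -
    have "f' i x (k *s u, k *s v) = k * f' i x (u, v)" for i
      by (simp add: f'_def e_deriv_scale algebra_simps)
    then show ?thesis by (simp add: infsum_cmult_right')
  qed
  moreover have "(\<lambda>y. \<Sum>\<^sub>\<infinity>i. f i y) = (\<lambda>(z, w). \<Sum>\<^sub>\<infinity>(\<alpha>, \<beta>). c \<alpha> \<beta> * e_mono \<alpha> z * e_mono \<beta> w)"
    by (simp add: f_def case_prod_unfold)
  ultimately show ?thesis by (intro exI[of _ "\<lambda>h. \<Sum>\<^sub>\<infinity>i. f' i x h"]) simp
qed

section \<open>Kernel and symbol of a coefficient matrix\<close>

definition kernel :: "(nat ^ 'd::finite \<Rightarrow> nat ^ 'd \<Rightarrow> complex) \<Rightarrow> complex ^ 'd \<Rightarrow> complex ^ 'd \<Rightarrow> complex" where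
  "kernel c z w = (\<Sum>\<^sub>\<infinity>(\<alpha>, \<beta>). c \<alpha> \<beta> * e_mono \<alpha> z * e_mono \<beta> (cnj_vec w))"

definition symbol :: "(nat ^ 'd::finite \<Rightarrow> nat ^ 'd \<Rightarrow> complex) \<Rightarrow> complex ^ 'd \<Rightarrow> complex ^ 'd \<Rightarrow> complex" where
  "symbol c z w = exp (- herm z w) * kernel c z w"

abbreviation symbol_weight :: "real \<Rightarrow> real \<Rightarrow> complex ^ 'd::finite \<Rightarrow> complex ^ 'd \<Rightarrow> real" where
  "symbol_weight s x z w \<equiv>
     exp ((norm (z - w))\<^sup>2 / 2 + x * (norm z powr (1 / s) + norm w powr (1 / s)))"

lemma symbol_mult_exp: "symbol c z w * exp (herm z w) = kernel c z w"
  by (simp add: symbol_def exp_minus)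

text \<open>Polarisation, |z - w|^2 = |z|^2 + |w|^2 - 2 Re (z,w): the factor separating symbol from
  kernel turns the product of the two Gaussian growth factors into the weight of the claim.\<close>

lemma norm_exp_herm:
  fixes z w :: "complex^'d::finite"
  shows "cmod (exp (- herm z w)) * exp ((norm z)\<^sup>2 / 2 + (norm w)\<^sup>2 / 2) = exp ((norm (z - w))\<^sup>2 / 2)"
proof -
  have "complex_of_real ((norm (z - w))\<^sup>2) = herm z z + herm w w - (herm z w + herm w z)"
    unfolding herm_self[symmetric] by (simp add: herm_def algebra_simps sum.distrib sum_subtractf)
  moreover have "herm w z = cnj (herm z w)" by (simp add: herm_def mult.commute)
  ultimately have "complex_of_real ((norm (z - w))\<^sup>2)
      = complex_of_real ((norm z)\<^sup>2) + complex_of_real ((norm w)\<^sup>2) - (herm z w + cnj (herm z w))"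
    by (simp only: herm_self)
  then have "(norm (z - w))\<^sup>2 = (norm z)\<^sup>2 + (norm w)\<^sup>2 - 2 * Re (herm z w)"
    by (simp only: complex_add_cnj of_real_add[symmetric] of_real_diff[symmetric] of_real_eq_iff)
  then show ?thesis by (simp add: norm_exp_eq_Re exp_add[symmetric] diff_divide_distrib add_divide_distrib)
qed

lemma infsum_mult_of_real:
  fixes f :: "'i \<Rightarrow> real" and g :: "'j \<Rightarrow> real"
  assumes "\<And>i. 0 \<le> f i" "\<And>j. 0 \<le> g j" "f summable_on UNIV" "g summable_on UNIV"
  shows "((\<lambda>(i, j). f i * g j) has_sum infsum f UNIV * infsum g UNIV) UNIV"
  using has_sum_mult_pairs(1)[of "\<lambda>i. complex_of_real (f i)" "\<lambda>j. complex_of_real (g j)"] assms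
  by (simp add: norm_mult abs_of_nonneg)

lemma summable_le_infsum:
  fixes f g :: "'i \<Rightarrow> real"
  assumes "\<And>i. 0 \<le> f i" "\<And>i. f i \<le> g i" "(g has_sum G) UNIV"
  shows "f summable_on UNIV \<and> infsum f UNIV \<le> G"
proof -
  have g: "g summable_on UNIV" by (rule has_sum_imp_summable[OF assms(3)])
  have f: "f summable_on UNIV" by (rule summable_on_comparison_test[OF g assms(2,1)])
  then show ?thesis using infsum_mono[OF f g assms(2)] infsumI[OF assms(3)] by simp
qed

context
  fixes s :: real
  assumes s: "1 / 2 \<le> s"
begin

lemma ps_eval_abs:
  fixes w :: "complex^'d::finite"
  assumes F: "\<And>\<beta>. cmod (F \<beta>) \<le> M * vartheta r s \<beta>"
  shows "(\<lambda>\<beta>. cmod (F \<beta> * e_mono \<beta> w)) summable_on UNIV \<and>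
    (\<Sum>\<^sub>\<infinity>\<beta>. cmod (F \<beta> * e_mono \<beta> w)) \<le> M * wsum r s w"
proof (rule summable_le_infsum)
  show "((\<lambda>\<beta>. M * (vartheta r s \<beta> * cmod (e_mono \<beta> w))) has_sum M * wsum r s w) UNIV"
    unfolding wsum_def by (intro has_sum_cmult_right has_sum_infsum wsum_summable[OF s])
  show "cmod (F \<beta> * e_mono \<beta> w) \<le> M * (vartheta r s \<beta> * cmod (e_mono \<beta> w))" for \<beta>
    using mult_right_mono[OF F, of "cmod (e_mono \<beta> w)" \<beta>] by (simp add: norm_mult mult.assoc)
qed auto

lemma kernel_abs:
  fixes z w :: "complex^'d::finite"
  assumes c: "\<And>\<alpha> \<beta>. cmod (c \<alpha> \<beta>) \<le> C * vartheta r s \<alpha> * vartheta r s \<beta>"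
  shows "(\<lambda>(\<alpha>, \<beta>). cmod (c \<alpha> \<beta> * e_mono \<alpha> z * e_mono \<beta> w)) summable_on UNIV \<and>
    (\<Sum>\<^sub>\<infinity>(\<alpha>, \<beta>). cmod (c \<alpha> \<beta> * e_mono \<alpha> z * e_mono \<beta> w)) \<le> C * (wsum r s z * wsum r s w)"
proof (rule summable_le_infsum)
  have v: "0 \<le> vartheta r s \<alpha>" for \<alpha> :: "nat^'d" by (simp add: vartheta_def)
  let ?g = "\<lambda>(\<alpha>, \<beta>). (vartheta r s \<alpha> * cmod (e_mono \<alpha> z)) * (vartheta r s \<beta> * cmod (e_mono \<beta> w))"
  have "(?g has_sum (wsum r s z * wsum r s w)) UNIV"
    unfolding wsum_def by (rule infsum_mult_of_real) (simp_all add: v wsum_summable[OF s])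
  then show "((\<lambda>i. C * ?g i) has_sum C * (wsum r s z * wsum r s w)) UNIV" by (rule has_sum_cmult_right)
  show "(case i of (\<alpha>, \<beta>) \<Rightarrow> cmod (c \<alpha> \<beta> * e_mono \<alpha> z * e_mono \<beta> w)) \<le> C * ?g i" for i
  proof (cases i)
    case (Pair \<alpha> \<beta>)
    have "cmod (c \<alpha> \<beta>) * (cmod (e_mono \<alpha> z) * cmod (e_mono \<beta> w))
      \<le> C * vartheta r s \<alpha> * vartheta r s \<beta> * (cmod (e_mono \<alpha> z) * cmod (e_mono \<beta> w))"
      by (intro mult_right_mono c) auto
    then show ?thesis by (simp add: Pair norm_mult mult_ac)
  qed
qed auto

lemma symbol_in_A_tilde:
  assumes c: "\<And>\<alpha> \<beta>. cmod (c \<alpha> \<beta>) \<le> C * vartheta r s \<alpha> * vartheta r s (\<beta> :: nat^'d::finite)"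
  shows "symbol c \<in> A_tilde"
  unfolding A_tilde_def entire2_def mem_Collect_eq
proof
  fix x :: "(complex^'d) \<times> (complex^'d)"
  obtain D where D: "((\<lambda>(z, w). \<Sum>\<^sub>\<infinity>(\<alpha>, \<beta>). c \<alpha> \<beta> * e_mono \<alpha> z * e_mono \<beta> w) has_derivative D) (at x)"
    and lin: "\<And>k u v. D (k *s u, k *s v) = k * D (u, v)"
    using entire2_power_series[of c x] kernel_abs[OF c] by blast
  \<comment> \<open>After conjugation of the second variable the form (z,w) becomes a polynomial, so
    its exponential is entire in both variables.\<close>
  define P where "P y = - (\<Sum>j\<in>UNIV. fst y $ j * snd y $ j)" for y :: "(complex^'d) \<times> (complex^'d)"
  define P' where "P' h = - (\<Sum>j\<in>UNIV. fst x $ j * snd h $ j + fst h $ j * snd x $ j)" for h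
  have "(P has_derivative P') (at x)"
  proof -
    have "((\<lambda>y. fst y $ j) has_derivative (\<lambda>h. fst h $ j)) (at x)" "((\<lambda>y. snd y $ j) has_derivative (\<lambda>h. snd h $ j)) (at x)" for j
      by (intro bounded_linear_imp_has_derivative bounded_linear_compose[OF bounded_linear_vec_nth]
          bounded_linear_fst bounded_linear_snd)+
    then show ?thesis
      unfolding P_def[abs_def] P'_def[abs_def] by (intro has_derivative_minus has_derivative_sum has_derivative_mult)
  qed
  moreover have "(exp has_derivative (\<lambda>h. exp (P x) * h)) (at (P x))"
    using DERIV_exp[of "P x"] by (simp add: has_field_derivative_def)
  ultimately have "((\<lambda>y. exp (P y)) has_derivative (\<lambda>h. exp (P x) * P' h)) (at x)"
    by (rule has_derivative_compose)
  from has_derivative_mult[OF this D]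
  have "((\<lambda>y. exp (P y) * (case y of (z, w) \<Rightarrow> \<Sum>\<^sub>\<infinity>(\<alpha>, \<beta>). c \<alpha> \<beta> * e_mono \<alpha> z * e_mono \<beta> w)) has_derivative
     (\<lambda>h. exp (P x) * D h + exp (P x) * P' h * (case x of (z, w) \<Rightarrow> \<Sum>\<^sub>\<infinity>(\<alpha>, \<beta>). c \<alpha> \<beta> * e_mono \<alpha> z * e_mono \<beta> w))) (at x)" .
  moreover have "(\<lambda>y. exp (P y) * (case y of (z, w) \<Rightarrow> \<Sum>\<^sub>\<infinity>(\<alpha>, \<beta>). c \<alpha> \<beta> * e_mono \<alpha> z * e_mono \<beta> w)) =
      (\<lambda>(z, w). symbol c z (cnj_vec w))"
  proof
    fix y :: "(complex^'d) \<times> (complex^'d)"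
    have "herm (fst y) (cnj_vec (snd y)) = (\<Sum>j\<in>UNIV. fst y $ j * snd y $ j)"
      by (simp add: herm_def cnj_vec_def)
    then show "exp (P y) * (case y of (z, w) \<Rightarrow> \<Sum>\<^sub>\<infinity>(\<alpha>, \<beta>). c \<alpha> \<beta> * e_mono \<alpha> z * e_mono \<beta> w) =
      (case y of (z, w) \<Rightarrow> symbol c z (cnj_vec w))"
      by (simp add: case_prod_unfold symbol_def kernel_def P_def)
  qed
  moreover have "P' (k *s u, k *s v) = k * P' (u, v)" for k u v
    by (simp add: P'_def sum_distrib_left sum.distrib algebra_simps)
  ultimately show "\<exists>D. ((\<lambda>(z, w). symbol c z (cnj_vec w)) has_derivative D) (at x) \<and>
      (\<forall>k u v. D (k *s u, k *s v) = k * D (u, v))"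
    using lin by (intro exI[of _ "\<lambda>h. exp (P x) * D h + exp (P x) * P' h * (case x of (z, w) \<Rightarrow> \<Sum>\<^sub>\<infinity>(\<alpha>, \<beta>). c \<alpha> \<beta> * e_mono \<alpha> z * e_mono \<beta> w)"])
      (simp add: algebra_simps)
qed

lemma norm_kernel_le:
  fixes z w :: "complex^'d::finite"
  assumes c: "\<And>\<alpha> \<beta>. cmod (c \<alpha> \<beta>) \<le> C * vartheta r s \<alpha> * vartheta r s \<beta>"
  shows "cmod (kernel c z w) \<le> C * (wsum r s z * wsum r s w)"
proof -
  have *: "(\<lambda>i. cmod (case i of (\<alpha>, \<beta>) \<Rightarrow> c \<alpha> \<beta> * e_mono \<alpha> z * e_mono \<beta> (cnj_vec w))) summable_on UNIV"
    "(\<Sum>\<^sub>\<infinity>i. cmod (case i of (\<alpha>, \<beta>) \<Rightarrow> c \<alpha> \<beta> * e_mono \<alpha> z * e_mono \<beta> (cnj_vec w))) \<le> C * (wsum r s z * wsum r s (cnj_vec w))"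
    using kernel_abs[OF c, of z "cnj_vec w"] by (simp_all add: case_prod_unfold)
  have "cmod (kernel c z w) \<le> C * (wsum r s z * wsum r s (cnj_vec w))"
    unfolding kernel_def using norm_infsum_bound[OF *(1)] *(2) by (rule order_trans)
  also have "wsum r s (cnj_vec w) = wsum r s w"
    unfolding wsum_def by (simp add: cnj_e_mono[symmetric])
  finally show ?thesis .
qed

lemma symbol_bound:
  assumes c: "\<And>\<alpha> \<beta>. cmod (c \<alpha> \<beta>) \<le> C * vartheta r s \<alpha> * vartheta r s (\<beta> :: nat^'d::finite)"
    and growth: "growth_le TYPE('d) s r x"
  shows "\<exists>B>0. \<forall>z w. cmod (symbol c z w) \<le>
    B * symbol_weight s x z w"
proof -
  have C: "0 \<le> C"
    using order_trans[OF norm_ge_zero c[of 0 0]] by (simp add: zero_le_mult_iff vartheta_def)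
  obtain C1 where W: "\<And>z::complex^'d. wsum r s z \<le> C1 * gauss_weight s x z"
    using growth unfolding growth_le_def by blast
  have W0: "0 \<le> C1 * gauss_weight s x z" for z :: "complex^'d"
    using order_trans[OF wsum_nonneg[OF s] W] .
  have "cmod (symbol c z w) \<le>
    (C * C1 * C1 + 1) * symbol_weight s x z w" for z w
  proof -
    have "cmod (kernel c z w) \<le> C * (wsum r s z * wsum r s w)" by (rule norm_kernel_le[OF c])
    also have "\<dots> \<le> C * ((C1 * gauss_weight s x z) * (C1 * gauss_weight s x w))"
      by (intro mult_left_mono[OF _ C] mult_mono W wsum_nonneg[OF s] W0)
    also have "\<dots> = (C * C1 * C1) * (exp ((norm z)\<^sup>2 / 2 + (norm w)\<^sup>2 / 2) * exp (x * (norm z powr (1 / s) + norm w powr (1 / s))))"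
      by (simp add: exp_add[symmetric] algebra_simps)
    finally have "cmod (symbol c z w) \<le> cmod (exp (- herm z w)) *
        ((C * C1 * C1) * (exp ((norm z)\<^sup>2 / 2 + (norm w)\<^sup>2 / 2) * exp (x * (norm z powr (1 / s) + norm w powr (1 / s)))))"
      unfolding symbol_def norm_mult by (rule mult_left_mono) simp
    also have "\<dots> = (C * C1 * C1) * ((cmod (exp (- herm z w)) * exp ((norm z)\<^sup>2 / 2 + (norm w)\<^sup>2 / 2)) *
       exp (x * (norm z powr (1 / s) + norm w powr (1 / s))))"
      by (simp only: mult_ac)
    also have "\<dots> = (C * C1 * C1) * symbol_weight s x z w"
      unfolding norm_exp_herm by (simp only: exp_add)
    also have "\<dots> \<le> (C * C1 * C1 + 1) * symbol_weight s x z w"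
      by (intro mult_right_mono) auto
    finally show ?thesis .
  qed
  moreover have "0 < C * C1 * C1 + 1" using C by (simp add: mult.assoc add_nonneg_pos)
  ultimately show ?thesis by blast
qed

text \<open>The symbol bound gives the kernel the rate 1/2 plus r |w|^(1/s). At s = 1/2 the latter
  is r |w|^2, so r \<le> 1/4 keeps the total at 3/4; for s > 1/2 any r is absorbed up to a
  constant.\<close>

lemma subgaussian_symbolI:
  fixes a :: "complex^'d::finite \<Rightarrow> complex^'d \<Rightarrow> complex"
  assumes r: "r \<le> 1 / 4 \<or> 1 / 2 < s"
    and a: "\<And>z w. cmod (a z w) \<le> C * symbol_weight s r z w"
  shows "subgaussian_symbol a"
  unfolding subgaussian_symbol_def
proof
  fix z
  have s0: "0 < s" using s by simp
  have C: "0 \<le> C" using order_trans[OF norm_ge_zero a[of 0 0]] by (simp add: zero_le_mult_iff)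
  obtain D where D: "\<And>w::complex^'d. r * norm w powr (1 / s) \<le> 1 / 4 * (norm w)\<^sup>2 + D"
  proof (cases "1 / 2 < s")
    case True
    then have "1 / (2 * s) < 1" by (simp add: field_simps)
    then obtain D where "\<And>t. 0 \<le> t \<Longrightarrow> r * t powr (1 / (2 * s)) \<le> 1 / 4 * t + D"
      using powr_sublinear[of "1 / (2 * s)" "1 / 4" r] s0 by auto
    from this[OF zero_le_power2[of "norm w" for w]] show thesis
      using that norm_sq_powr[OF s0] by metis
  next
    case False
    have "r * norm w powr (1 / s) \<le> 1 / 4 * (norm w)\<^sup>2 + 1 / 4" for w :: "complex^'d"
    proof -
      have "r * norm w powr (1 / s) \<le> 1 / 4 * norm w powr (1 / s)" using r False by (intro mult_right_mono) auto
      also have "\<dots> \<le> 1 / 4 * (1 + (norm w)\<^sup>2)"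
        using powr_le_one_plus[of "(norm w)\<^sup>2" "1 / (2 * s)"] sigma[OF s] norm_sq_powr[OF s0, of w]
        by (intro mult_left_mono) auto
      finally show ?thesis by simp
    qed
    then show thesis by (rule that)
  qed
  have "cmod (a z w * exp (herm z w)) \<le> (C * exp ((norm z)\<^sup>2 / 2 + r * norm z powr (1 / s) + D)) * exp (3 / 4 * (norm w)\<^sup>2)" for w
  proof -
    let ?e = "r * (norm z powr (1 / s) + norm w powr (1 / s))"
    have inv: "cmod (exp (- herm z w)) * cmod (exp (herm z w)) = 1"
      by (simp only: norm_mult[symmetric] exp_add[symmetric]) simp
    have "cmod (a z w * exp (herm z w)) \<le> C * exp ((norm (z - w))\<^sup>2 / 2 + ?e) * cmod (exp (herm z w))"
      unfolding norm_mult by (intro mult_right_mono a) simp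
    also have "\<dots> = C * ((cmod (exp (- herm z w)) * cmod (exp (herm z w))) * exp ((norm z)\<^sup>2 / 2 + (norm w)\<^sup>2 / 2) * exp ?e)"
      unfolding exp_add[of "(norm (z - w))\<^sup>2 / 2"] norm_exp_herm[symmetric] by (simp only: mult_ac)
    also have "\<dots> = C * exp (((norm z)\<^sup>2 / 2 + r * norm z powr (1 / s)) + ((norm w)\<^sup>2 / 2 + r * norm w powr (1 / s)))"
      unfolding inv by (simp add: exp_add[symmetric] algebra_simps)
    also have "\<dots> \<le> C * exp (((norm z)\<^sup>2 / 2 + r * norm z powr (1 / s) + D) + 3 / 4 * (norm w)\<^sup>2)"
      using D[of w] C by (intro mult_left_mono) auto
    finally show ?thesis by (simp add: exp_add)
  qed
  then show "\<exists>C. \<forall>w. cmod (a z w * exp (herm z w)) \<le> C * exp (3 / 4 * (norm w)\<^sup>2)" by blast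
qed

text \<open>Both factors are expanded into one family indexed by ((\<alpha>, \<beta>), \<gamma>).
  Its absolute sum is at most a multiple of exp(|w|^2 + (x + y) |w|^(1/s)), so x + y < 0 is what
  permits termwise integration.\<close>

lemma symbol_integral:
  fixes F G :: "'d::finite pseries"
  assumes c: "\<And>\<alpha> \<beta>. cmod (c \<alpha> \<beta>) \<le> C * vartheta r s \<alpha> * vartheta r s (\<beta> :: nat^'d)"
    and F: "\<And>\<beta>. cmod (F \<beta>) \<le> M * vartheta r' s \<beta>"
    and growth: "growth_le TYPE('d) s r x" "growth_le TYPE('d) s r' y"
    and xy: "x + y < 0"
    and G: "\<And>\<alpha>. ((\<lambda>\<beta>. c \<alpha> \<beta> * F \<beta>) has_sum G \<alpha>) UNIV"
  shows "integrable gauss (\<lambda>w. symbol c z w * ps_eval F w * exp (herm z w))"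
    and "(LINT w|gauss. symbol c z w * ps_eval F w * exp (herm z w)) = ps_eval G z"
proof -
  obtain C1 C2 where W: "\<And>z::complex^'d. wsum r s z \<le> C1 * gauss_weight s x z"
    and W': "\<And>z::complex^'d. wsum r' s z \<le> C2 * gauss_weight s y z"
    using growth unfolding growth_le_def by blast
  define p where "p w = (\<lambda>(\<alpha>, \<beta>). c \<alpha> \<beta> * e_mono \<alpha> z * e_mono \<beta> (cnj_vec w))" for w
  define q where "q w \<gamma> = F \<gamma> * e_mono \<gamma> w" for w \<gamma>
  define f where "f = (\<lambda>(i, \<gamma>) w. p w i * q w \<gamma>)"
  define B where "B = C * wsum r s z * C1 * (M * C2)"
  define g where "g w = B * exp ((norm w)\<^sup>2 + (x + y) * norm w powr (1 / s))" for w :: "complex^'d"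
  have C: "0 \<le> C" using order_trans[OF norm_ge_zero c[of 0 0]] by (simp add: zero_le_mult_iff vartheta_def)
  have M: "0 \<le> M" using order_trans[OF norm_ge_zero F[of 0]] by (simp add: zero_le_mult_iff vartheta_def)
  have ps: "(\<lambda>i. cmod (p w i)) summable_on UNIV" "(\<Sum>\<^sub>\<infinity>i. cmod (p w i)) \<le> C * (wsum r s z * wsum r s w)" for w
  proof -
    have "wsum r s (cnj_vec w) = wsum r s w"
      unfolding wsum_def by (simp add: cnj_e_mono[symmetric])
    then show "(\<lambda>i. cmod (p w i)) summable_on UNIV" "(\<Sum>\<^sub>\<infinity>i. cmod (p w i)) \<le> C * (wsum r s z * wsum r s w)"
      using kernel_abs[OF c, of z "cnj_vec w"] by (simp_all add: p_def case_prod_unfold)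
  qed
  have qs: "(\<lambda>\<gamma>. cmod (q w \<gamma>)) summable_on UNIV" "(\<Sum>\<^sub>\<infinity>\<gamma>. cmod (q w \<gamma>)) \<le> M * wsum r' s w" for w
    using ps_eval_abs[OF F, of w] by (simp_all add: q_def)
  have fs: "((\<lambda>i. cmod (f i w)) has_sum (\<Sum>\<^sub>\<infinity>i. cmod (p w i)) * (\<Sum>\<^sub>\<infinity>\<gamma>. cmod (q w \<gamma>))) UNIV" for w
    using has_sum_mult_pairs(1)[OF ps(1) qs(1)] by (simp add: f_def case_prod_unfold)
  have f_le: "(\<Sum>\<^sub>\<infinity>i. cmod (f i w)) \<le> g w" for w
  proof -
    have "(\<Sum>\<^sub>\<infinity>i. cmod (f i w)) = (\<Sum>\<^sub>\<infinity>i. cmod (p w i)) * (\<Sum>\<^sub>\<infinity>\<gamma>. cmod (q w \<gamma>))"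
      by (rule infsumI[OF fs])
    also have "\<dots> \<le> (C * (wsum r s z * wsum r s w)) * (M * wsum r' s w)"
      by (intro mult_mono ps qs) (auto intro!: mult_nonneg_nonneg infsum_nonneg C wsum_nonneg[OF s])
    also have "\<dots> = (C * wsum r s z * M) * (wsum r s w * wsum r' s w)" by (simp add: mult_ac)
    also have "\<dots> \<le> (C * wsum r s z * M) * ((C1 * gauss_weight s x w) *
       (C2 * gauss_weight s y w))"
      by (intro mult_left_mono mult_mono W W' mult_nonneg_nonneg C M wsum_nonneg[OF s]
          order_trans[OF wsum_nonneg[OF s] W])
    also have "\<dots> = B * (gauss_weight s x w * gauss_weight s y w)"
      by (simp only: B_def mult_ac)
    also have "\<dots> = g w"
      unfolding g_def exp_add[symmetric] by (simp add: algebra_simps)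
    finally show ?thesis .
  qed
  have g0: "0 \<le> g w" for w using order_trans[OF infsum_nonneg f_le] by simp
  have g: "integrable gauss g"
  proof -
    have "integrable gauss (\<lambda>w. complex_of_real (g w))"
    proof (rule integrable_gaussI[where \<tau> = "1 / s" and \<kappa> = "- (x + y)" and C = B])
      show "(\<lambda>w. complex_of_real (g w)) \<in> borel_measurable borel" unfolding g_def by measurable
      show "cmod (complex_of_real (g w)) \<le> B * exp ((norm w)\<^sup>2 - - (x + y) * norm w powr (1 / s))" for w
      proof -
        have "cmod (complex_of_real (g w)) = g w" using g0[of w] by (simp only: norm_of_real abs_of_nonneg)
        then show ?thesis by (simp add: g_def algebra_simps)
      qed
    qed (use s xy in auto)
    then show ?thesis by (simp only: complex_of_real_integrable_eq)
  qed
  have fi: "integrable gauss (f i)" for i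
  proof (rule Bochner_Integration.integrable_bound[OF g])
    obtain \<alpha> \<beta> \<gamma> where i: "i = ((\<alpha>, \<beta>), \<gamma>)" by (metis surj_pair)
    have "continuous_on UNIV (f i)"
      unfolding f_def p_def q_def i by (simp, intro continuous_intros)
    then show "f i \<in> borel_measurable gauss" 
      using measurable_cong_sets[OF sets_gauss refl] borel_measurable_continuous_onI by blast
    have "cmod (f i w) \<le> g w" for w
      using finite_sum_le_infsum[OF has_sum_imp_summable[OF fs], of "{i}" w] f_le[of w] by simp
    then show "AE w in gauss. norm (f i w) \<le> norm (g w)" using g0 by simp
  qed
  have f_sum: "(\<Sum>\<^sub>\<infinity>i. f i w) = symbol c z w * ps_eval F w * exp (herm z w)" for w
  proof -
    have "(\<Sum>\<^sub>\<infinity>i. f i w) = (\<Sum>\<^sub>\<infinity>i. p w i) * (\<Sum>\<^sub>\<infinity>\<gamma>. q w \<gamma>)"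
      using infsumI[OF has_sum_mult_pairs(2)[OF ps(1) qs(1)]] by (simp add: f_def case_prod_unfold)
    also have "\<dots> = kernel c z w * ps_eval F w" by (simp add: p_def q_def kernel_def ps_eval_def)
    finally show ?thesis by (simp add: symbol_mult_exp[symmetric] mult_ac)
  qed
  note fs' = has_sum_imp_summable[OF fs]
  show "integrable gauss (\<lambda>w. symbol c z w * ps_eval F w * exp (herm z w))"
    using integrable_infsum[OF fi g fs' f_le] unfolding f_sum .
  define I where "I = (LINT w|gauss. symbol c z w * ps_eval F w * exp (herm z w))"
  have h: "((\<lambda>i. LINT w|gauss. f i w) has_sum I) UNIV"
    using has_sum_integral[OF fi g fs' f_le] unfolding f_sum I_def .
  have Lf: "(LINT w|gauss. f ((\<alpha>, \<beta>), \<gamma>) w) = (if \<gamma> = \<beta> then c \<alpha> \<beta> * e_mono \<alpha> z * F \<beta> else 0)" for \<alpha> \<beta> \<gamma>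
  proof -
    have "(LINT w|gauss. f ((\<alpha>, \<beta>), \<gamma>) w) = (LINT w|gauss. (c \<alpha> \<beta> * e_mono \<alpha> z * F \<gamma>) * (e_mono \<gamma> w * cnj (e_mono \<beta> w)))"
      by (simp add: f_def p_def q_def cnj_e_mono mult_ac)
    also have "\<dots> = (c \<alpha> \<beta> * e_mono \<alpha> z * F \<gamma>) * (LINT w|gauss. e_mono \<gamma> w * cnj (e_mono \<beta> w))"
      by (rule integral_mult_right_zero)
    finally show ?thesis by (simp add: gauss_orthonormal)
  qed
  \<comment> \<open>Orthonormality leaves only the terms with \<gamma> = \<beta>; d parametrises
    this diagonal, so that the sum can be pulled back to pairs and then taken over \<beta>
    first.\<close>
  define d where "d = (\<lambda>(\<alpha> :: nat^'d, \<beta> :: nat^'d). ((\<alpha>, \<beta>), \<beta>))" 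
  have d: "inj_on d (UNIV :: ((nat^'d) \<times> (nat^'d)) set)" by (auto simp: d_def inj_on_def)
  have "((\<lambda>i. LINT w|gauss. f i w) has_sum I) (range d)"
    using h by (subst (asm) has_sum_cong_neutral[where T = "range d" and g = "\<lambda>i. LINT w|gauss. f i w"])
      (auto simp: d_def Lf image_iff)
  moreover have "(LINT w|gauss. f (x, snd x) w) = c (fst x) (snd x) * e_mono (fst x) z * F (snd x)" for x
    using Lf[of "fst x" "snd x" "snd x"] by simp
  ultimately have "((\<lambda>(\<alpha>, \<beta>). c \<alpha> \<beta> * e_mono \<alpha> z * F \<beta>) has_sum I) (UNIV \<times> UNIV)"
    unfolding has_sum_reindex[OF d] by (simp add: d_def o_def case_prod_unfold)
  then have "((\<lambda>\<alpha>. G \<alpha> * e_mono \<alpha> z) has_sum I) UNIV"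
  proof (rule has_sum_SigmaD)
    fix \<alpha>
    show "((\<lambda>\<beta>. case (\<alpha>, \<beta>) of (\<alpha>, \<beta>) \<Rightarrow> c \<alpha> \<beta> * e_mono \<alpha> z * F \<beta>) has_sum G \<alpha> * e_mono \<alpha> z) UNIV"
      using has_sum_cmult_left[OF G[of \<alpha>], of "e_mono \<alpha> z"] by (simp add: mult_ac)
  qed
  then show "(LINT w|gauss. symbol c z w * ps_eval F w * exp (herm z w)) = ps_eval G z"
    unfolding I_def[symmetric] ps_eval_def[of G] by (rule infsumI[symmetric])
qed

section \<open>Existence and uniqueness for an abstract domain\<close>

lemma ps_eval_delta: "ps_eval (delta \<beta>) z = e_mono \<beta> z"
proof -
  have "((\<lambda>\<alpha>. delta \<beta> \<alpha> * e_mono \<alpha> z) has_sum (\<Sum>\<alpha>\<in>{\<beta>}. delta \<beta> \<alpha> * e_mono \<alpha> z)) UNIV"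
    by (rule has_sum_finite_neutralI[of "{\<beta>}"]) (auto simp: delta_def)
  then show ?thesis unfolding ps_eval_def by (simp add: infsumI delta_def)
qed

text \<open>\<open>P\<close> stands for the growth condition on the symbol. The exponents in
  \<open>bounds\<close> may depend on F, because in one of the two cases the kernel bound is chosen
  only after F. Uniqueness compares the operators on basis functions, where \<open>sub\<close>
  guarantees that both are given by the integral.\<close>

lemma kernel_theorem:
  fixes T :: "'d::finite pseries \<Rightarrow> 'd pseries"
  assumes expansion: "\<And>F \<alpha>. F \<in> topspace X \<Longrightarrow> ((\<lambda>\<beta>. T (delta \<beta>) \<alpha> * F \<beta>) has_sum T F \<alpha>) UNIV"
    and delta: "\<And>\<beta>. delta \<beta> \<in> topspace X"
    and bounds: "\<And>F. F \<in> topspace X \<Longrightarrow> \<exists>r r' x y C M. x + y < 0 \<and>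
      growth_le TYPE('d) s r x \<and> growth_le TYPE('d) s r' y \<and>
      (\<forall>\<alpha> \<beta>. cmod (T (delta \<beta>) \<alpha>) \<le> C * vartheta r s \<alpha> * vartheta r s \<beta>) \<and>
      (\<forall>\<beta>. cmod (F \<beta>) \<le> M * vartheta r' s \<beta>)"
    and P: "P (symbol (\<lambda>\<alpha> \<beta>. T (delta \<beta>) \<alpha>))"
    and sub: "\<And>a. P a \<Longrightarrow> subgaussian_symbol a"
  shows "\<exists>!a. a \<in> A_tilde \<and> P a \<and> represents a X T"
proof -
  let ?c = "\<lambda>\<alpha> \<beta>. T (delta \<beta>) \<alpha>"
  \<comment> \<open>Analyticity needs some bound on the matrix alone; any element of the domain
    yields one, here the constant function 1.\<close>
  have A: "symbol ?c \<in> A_tilde"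
    using bounds[OF delta[of 0]] symbol_in_A_tilde[of ?c] by blast
  have R: "represents (symbol ?c) X T"
    unfolding represents_def
  proof (intro ballI allI)
    fix F z assume F: "F \<in> topspace X"
    obtain r r' x y C M where *: "x + y < 0" "growth_le TYPE('d) s r x" "growth_le TYPE('d) s r' y"
      "\<And>\<alpha> \<beta>. cmod (T (delta \<beta>) \<alpha>) \<le> C * vartheta r s \<alpha> * vartheta r s \<beta>"
      "\<And>\<beta>. cmod (F \<beta>) \<le> M * vartheta r' s \<beta>"
      using bounds[OF F] by metis
    note i = symbol_integral[of ?c, OF *(4,5,2,3,1) expansion[OF F]]
    show "ps_eval (T F) z = Op_V (symbol ?c) F z"
      unfolding Op_V_def using i(1) by (simp add: i(2))
  qed
  have U: "a = symbol ?c" if a: "a \<in> A_tilde" "P a" "represents a X T" for a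
  proof (rule symbol_eqI[OF a(1) sub[OF a(2)] A sub[OF P]])
    fix z \<beta>
    have *: "ps_eval (T (delta \<beta>)) z = (LINT w|gauss. b z w * e_mono \<beta> w * exp (herm z w))"
      if "represents b X T" "b \<in> A_tilde" "P b" for b
    proof -
      have "ps_eval (T (delta \<beta>)) z = Op_V b (delta \<beta>) z"
        using that(1) delta unfolding represents_def by blast
      then show ?thesis
        using integrable_symbol_e_mono[OF that(2) sub[OF that(3)], of _ \<beta>]
        unfolding Op_V_def ps_eval_delta by simp
    qed
    then show "(LINT w|gauss. a z w * e_mono \<beta> w * exp (herm z w)) =
      (LINT w|gauss. symbol ?c z w * e_mono \<beta> w * exp (herm z w))"
      using *[OF a(3,1,2)] *[OF R A P] by simp
  qed
  show ?thesis using A P R U by blast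
qed

end

section \<open>Operators between the spaces and their duals\<close>

lemma vartheta_uminus: "vartheta (- r) s \<alpha> = 1 / vartheta r s \<alpha>"
  by (simp add: vartheta_def exp_minus inverse_eq_divide)

lemma vartheta_mono: "r \<le> r' \<Longrightarrow> vartheta r s \<alpha> \<le> vartheta r' s \<alpha>"
  by (simp add: vartheta_def mult_right_mono)

lemma weights_vartheta:
  fixes e :: real
  assumes "1 \<le> p" "0 < s" and e: "e = 1 \<or> e = -1"
  shows "weights p (\<lambda>r. vartheta (e * r) s :: nat^'d::finite \<Rightarrow> real)"
proof
  show "(\<forall>\<alpha>::nat^'d. vartheta (e * r) s \<alpha> \<le> vartheta (e * r') s \<alpha>) \<or>
      (\<forall>\<alpha>::nat^'d. vartheta (e * r') s \<alpha> \<le> vartheta (e * r) s \<alpha>)" for r r'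
    using linear[of "e * r" "e * r'"] by (auto intro: vartheta_mono)
  show "\<exists>r'>0. (\<lambda>\<alpha>::nat^'d. vartheta (e * r') s \<alpha> / vartheta (e * r) s \<alpha>) summable_on UNIV" if r: "0 < r" for r
  proof -
    \<comment> \<open>The quotient of two weights is a weight whose exponent is the difference,
      summable once negative: halve r for e = 1, double it for e = -1.\<close>
    have "\<exists>r'>0. e * r' - e * r < 0"
      using e r by (auto intro: exI[of _ "r / 2"] exI[of _ "2 * r"])
    then obtain r' where r': "0 < r'" "e * r' - e * r < 0" by blast
    have "(\<lambda>\<alpha>::nat^'d. vartheta (e * r') s \<alpha> / vartheta (e * r) s \<alpha>) = vartheta (e * r' - e * r) s"
      by (simp add: vartheta_def exp_diff[symmetric] left_diff_distrib fun_eq_iff)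
    then show ?thesis using vartheta_summable[OF r'(2) assms(2)] r'(1) by auto
  qed
  show "\<exists>\<rho>::nat \<Rightarrow> real. (\<forall>n. 0 < \<rho> n) \<and>
      (\<forall>r>0. \<exists>N. \<forall>n\<ge>N. \<forall>\<alpha>::nat^'d. vartheta (e * \<rho> n) s \<alpha> \<le> vartheta (e * r) s \<alpha>)"
    \<comment> \<open>The weight decreases as r tends to 0 for e = 1 and as r tends to infinity for
      e = -1, hence the sequences 1/(n+1) and n+1.\<close>
    using e
  proof
    assume "e = 1"
    have "\<exists>N. \<forall>n\<ge>N. 1 / real (Suc n) \<le> r" if r: "0 < r" for r
    proof -
      obtain N where N: "1 / real (Suc N) < r" using nat_approx_posE[OF r] by blast
      have "1 / real (Suc n) \<le> 1 / real (Suc N)" if "n \<ge> N" for n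
        using that by (intro divide_left_mono) auto
      then show ?thesis using N by (intro exI[of _ N]) force
    qed
    then show ?thesis using \<open>e = 1\<close>
      by (intro exI[of _ "\<lambda>n. 1 / real (Suc n)"]) (auto, meson vartheta_mono)
  next
    assume "e = -1"
    have "\<exists>N. \<forall>n\<ge>N. - real (Suc n) \<le> - r" for r
    proof -
      obtain N where "r \<le> real N" using real_arch_simple by blast
      then show ?thesis by (intro exI[of _ N]) auto
    qed
    then show ?thesis using \<open>e = -1\<close>
      by (intro exI[of _ "\<lambda>n. real (Suc n)"]) (simp, meson vartheta_mono)
  qed
qed (use assms in \<open>auto simp: vartheta_pos\<close>)

text \<open>The sign \<open>e = 1\<close> covers the spaces \<open>A_s, A_s'\<close>, the sign \<open>e = -1\<close> the spaces
  \<open>A_{0,s}', A_{0,s}\<close>: taking inverse weights interchanges projective and inductive limits.\<close>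

locale signed_weights =
  fixes p :: ennreal and s e :: real and dim :: "'d::finite itself"
  assumes p: "1 \<le> p" and s: "1 / 2 \<le> s" and e: "e = 1 \<or> e = -1 \<and> 1 / 2 < s"
begin

sublocale weights p "\<lambda>r. vartheta (e * r) s :: nat^'d \<Rightarrow> real"
  using p s e by (intro weights_vartheta) auto

text \<open>A coefficient exponent is prescribed and a growth exponent found;
  \<open>growth_pos\<close> goes the other way. For e = -1 the signs flip, so this becomes an
  estimate for growing weights and \<open>growth_pos\<close> one for decaying weights, both relying
  on s > 1/2.\<close>

lemma growth_neg: "0 < r \<Longrightarrow> \<exists>x>0. growth_le TYPE('d) s (- (e * r)) (- (e * x))"
  using e
proof
  assume r: "0 < r" and "e = 1"
  then show ?thesis using growth_le_neg[OF s, of "- r"]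
    by (metis minus_minus mult_1 neg_0_less_iff_less)
next
  assume r: "0 < r" and "e = -1 \<and> 1 / 2 < s"
  then show ?thesis using growth_le_pos'[OF s _ r] by auto
qed

lemma growth_pos: "0 < x \<Longrightarrow> \<exists>r>0. growth_le TYPE('d) s (e * r) (e * x)"
  using e
proof
  assume "0 < x" "e = 1"
  then show ?thesis using growth_le_pos[OF s] by simp
next
  assume x: "0 < x" and "e = -1 \<and> 1 / 2 < s"
  then show ?thesis using growth_le_neg'[OF s, of "- x"]
    by (metis minus_minus mult_minus1 neg_0_less_iff_less neg_less_0_iff_less)
qed

text \<open>Supplies the strict inequality that makes the total exponent in the operator integral
  negative.\<close>

lemma smaller_exponent: "0 < x \<Longrightarrow> \<exists>y>0. e * y < e * x"
  using e by (auto intro: exI[of _ "x / 2"] exI[of _ "2 * x"])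

text \<open>The kernel fixes r and thereby x; afterwards y and r' are chosen to suit it, which is
  possible because elements of the projective limit satisfy the coefficient bound for every
  r'.\<close>

lemma proj_to_ind_symbol:
  assumes T: "linear_continuous proj ind T"
  shows "\<exists>!a. a \<in> A_tilde \<and>
      (\<exists>r>0. \<exists>C>0. \<forall>z w. cmod (a z w) \<le>
         C * symbol_weight s (- (e * r)) z w) \<and>
      represents a proj T"
proof -
  obtain r C where r: "0 < r" and C: "\<And>\<alpha> \<beta>. cmod (T (delta \<beta>) \<alpha>) * vartheta (e * r) s \<alpha> * vartheta (e * r) s \<beta> \<le> C"
    using proj_to_ind_kernel[OF T] by blast
  have c: "cmod (T (delta \<beta>) \<alpha>) \<le> C * vartheta (- (e * r)) s \<alpha> * vartheta (- (e * r)) s \<beta>" for \<alpha> \<beta>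
    using C[of \<beta> \<alpha>] pos[of r \<alpha>] pos[of r \<beta>] by (simp add: vartheta_uminus field_simps)
  obtain x where x: "0 < x" "growth_le TYPE('d) s (- (e * r)) (- (e * x))" using growth_neg[OF r] by blast
  obtain y where y: "0 < y" "e * y < e * x" using smaller_exponent[OF x(1)] by blast
  obtain r' where r': "0 < r'" "growth_le TYPE('d) s (e * r') (e * y)" using growth_pos[OF y(1)] by blast
  show ?thesis
  proof (rule kernel_theorem[OF s proj_to_ind_expansion[OF T] delta_in_proj])
    fix F assume "F \<in> topspace proj"
    then obtain M where "\<And>\<beta>. cmod (F \<beta>) \<le> M * vartheta (e * r') s \<beta>" using proj_bound r'(1) by blast
    moreover have "- (e * x) + e * y < 0" using y by simp
    ultimately show "\<exists>r r' x y C M. x + y < 0 \<and>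
      growth_le TYPE('d) s r x \<and> growth_le TYPE('d) s r' y \<and>
      (\<forall>\<alpha> \<beta>. cmod (T (delta \<beta>) \<alpha>) \<le> C * vartheta r s \<alpha> * vartheta r s \<beta>) \<and>
      (\<forall>\<beta>. cmod (F \<beta>) \<le> M * vartheta r' s \<beta>)"
      using c x(2) r'(2) by blast
  next
    show "\<exists>r>0. \<exists>C>0. \<forall>z w. cmod (symbol (\<lambda>\<alpha> \<beta>. T (delta \<beta>) \<alpha>) z w) \<le>
         C * symbol_weight s (- (e * r)) z w"
      using symbol_bound[OF s c x(2)] x(1) by blast
  next
    fix a :: "complex^'d \<Rightarrow> complex^'d \<Rightarrow> complex"
    assume "\<exists>r>0. \<exists>C>0. \<forall>z w. cmod (a z w) \<le>
         C * symbol_weight s (- (e * r)) z w"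
    then obtain r C where "0 < r" and "\<And>z w. cmod (a z w) \<le>
         C * symbol_weight s (- (e * r)) z w" by blast
    then show "subgaussian_symbol a" using e by (intro subgaussian_symbolI[OF s, of "- (e * r)" a C]) auto
  qed
qed

text \<open>The order of choices is reversed: F fixes r' and y, and the kernel, bounded for every r,
  is then estimated with an exponent x that y outweighs.\<close>

lemma ind_to_proj_symbol:
  assumes T: "linear_continuous ind proj T"
  shows "\<exists>!a. a \<in> A_tilde \<and>
      (\<forall>r>0. \<exists>C>0. \<forall>z w. cmod (a z w) \<le>
         C * symbol_weight s (e * r) z w) \<and>
      represents a ind T"
proof (rule kernel_theorem[OF s ind_to_proj_expansion[OF T] delta_in_ind])
  fix F assume F: "F \<in> topspace ind"
  obtain r' M where r': "0 < r'" and M: "\<And>\<beta>. cmod (F \<beta>) * vartheta (e * r') s \<beta> \<le> M"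
    using ind_bound[OF F] by blast
  have M': "cmod (F \<beta>) \<le> M * vartheta (- (e * r')) s \<beta>" for \<beta>
    using M[of \<beta>] pos[of r' \<beta>] by (simp add: vartheta_uminus field_simps)
  obtain y where y: "0 < y" "growth_le TYPE('d) s (- (e * r')) (- (e * y))" using growth_neg[OF r'] by blast
  obtain x where x: "0 < x" "e * x < e * y" using smaller_exponent[OF y(1)] by blast
  obtain r where r: "0 < r" "growth_le TYPE('d) s (e * r) (e * x)" using growth_pos[OF x(1)] by blast
  have "e * x + - (e * y) < 0" using x by simp
  then show "\<exists>r r' x y C M. x + y < 0 \<and>
      growth_le TYPE('d) s r x \<and> growth_le TYPE('d) s r' y \<and>
      (\<forall>\<alpha> \<beta>. cmod (T (delta \<beta>) \<alpha>) \<le> C * vartheta r s \<alpha> * vartheta r s \<beta>) \<and>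
      (\<forall>\<beta>. cmod (F \<beta>) \<le> M * vartheta r' s \<beta>)"
    using ind_to_proj_kernel[OF T r(1)] M' y(2) r(2) by blast
next
  show "\<forall>r>0. \<exists>C>0. \<forall>z w. cmod (symbol (\<lambda>\<alpha> \<beta>. T (delta \<beta>) \<alpha>) z w) \<le>
         C * symbol_weight s (e * r) z w"
  proof (intro allI impI)
    fix x :: real assume "0 < x"
    then obtain r where r: "0 < r" "growth_le TYPE('d) s (e * r) (e * x)" using growth_pos by blast
    obtain C where c: "\<And>\<alpha> \<beta>. cmod (T (delta \<beta>) \<alpha>) \<le> C * vartheta (e * r) s \<alpha> * vartheta (e * r) s \<beta>"
      using ind_to_proj_kernel[OF T r(1)] by blast
    show "\<exists>C>0. \<forall>z w. cmod (symbol (\<lambda>\<alpha> \<beta>. T (delta \<beta>) \<alpha>) z w) \<le>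
         C * symbol_weight s (e * x) z w"
      by (rule symbol_bound[OF s c r(2)])
  qed
next
  fix a :: "complex^'d \<Rightarrow> complex^'d \<Rightarrow> complex"
  assume "\<forall>r>0. \<exists>C>0. \<forall>z w. cmod (a z w) \<le>
         C * symbol_weight s (e * r) z w"
  \<comment> \<open>The value 1/4 is the largest that \<open>subgaussian_symbolI\<close> accepts at
    s = 1/2.\<close>
  from this[rule_format, of "1 / 4"] obtain C where "\<And>z w. cmod (a z w) \<le>
         C * symbol_weight s (e * (1 / 4)) z w" by auto
  then show "subgaussian_symbol a" using e by (intro subgaussian_symbolI[OF s, of "e * (1 / 4)" a C]) auto
qed

end

theorem theorem3p9:
  fixes s :: real and p :: ennreal
  assumes "1 \<le> p"
  shows
    "(1 / 2 \<le> s \<longrightarrow>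
        (\<forall>T :: 'd::finite pseries \<Rightarrow> 'd pseries.
           linear_continuous (A_dual p s) (A_space p s) T \<longrightarrow>
           (\<exists>!a. a \<in> A_tilde \<and>
              (\<exists>r>0. \<exists>C>0. \<forall>z w. cmod (a z w) \<le>
                 C * exp ((norm (z - w))\<^sup>2 / 2 - r * (norm z powr (1 / s) + norm w powr (1 / s)))) \<and>
              represents a (A_dual p s) T)) \<and>
        (\<forall>T :: 'd pseries \<Rightarrow> 'd pseries.
           linear_continuous (A_space p s) (A_dual p s) T \<longrightarrow>
           (\<exists>!a. a \<in> A_tilde \<and>
              (\<forall>r>0. \<exists>C>0. \<forall>z w. cmod (a z w) \<le>
                 C * exp ((norm (z - w))\<^sup>2 / 2 + r * (norm z powr (1 / s) + norm w powr (1 / s)))) \<and>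
              represents a (A_space p s) T))) \<and>
     (1 / 2 < s \<longrightarrow>
        (\<forall>T :: 'd pseries \<Rightarrow> 'd pseries.
           linear_continuous (A0_dual p s) (A0_space p s) T \<longrightarrow>
           (\<exists>!a. a \<in> A_tilde \<and>
              (\<forall>r>0. \<exists>C>0. \<forall>z w. cmod (a z w) \<le>
                 C * exp ((norm (z - w))\<^sup>2 / 2 - r * (norm z powr (1 / s) + norm w powr (1 / s)))) \<and>
              represents a (A0_dual p s) T)) \<and>
        (\<forall>T :: 'd pseries \<Rightarrow> 'd pseries.
           linear_continuous (A0_space p s) (A0_dual p s) T \<longrightarrow>
           (\<exists>!a. a \<in> A_tilde \<and>
              (\<exists>r>0. \<exists>C>0. \<forall>z w. cmod (a z w) \<le>
                 C * exp ((norm (z - w))\<^sup>2 / 2 + r * (norm z powr (1 / s) + norm w powr (1 / s)))) \<and>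
              represents a (A0_space p s) T)))"
proof -
  have inverse: "(\<lambda>\<alpha>::nat^'d. 1 / vartheta r s \<alpha>) = vartheta (- r) s" for r
    by (simp add: vartheta_uminus fun_eq_iff)
  have A: "signed_weights p s 1" if "1 / 2 \<le> s"
    using assms that by unfold_locales auto
  have A0: "signed_weights p s (-1)" if "1 / 2 < s"
    using assms that by unfold_locales auto
  \<comment> \<open>For e = -1 the inductive limit is \<open>A0_dual\<close> and the projective one
    \<open>A0_space\<close>. Hence the map from \<open>A0_dual\<close> is the case
    \<open>ind_to_proj_symbol\<close>, and the quantifiers on r swap relative to e = 1.\<close>
  show ?thesis
    using signed_weights.proj_to_ind_symbol[OF A, where 'd = 'd]
      signed_weights.ind_to_proj_symbol[OF A, where 'd = 'd]
      signed_weights.proj_to_ind_symbol[OF A0, where 'd = 'd]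
      signed_weights.ind_to_proj_symbol[OF A0, where 'd = 'd]
    by (intro conjI impI allI)
      (simp_all add: A_dual_def A_space_def A0_dual_def A0_space_def inverse)
qed

end
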